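(* Let $(\Omega,\mathcal F,P)$ be a probability space, let $S$ be a $\mathcal T_{\varepsilon,\lambda}$-complete random normed module over $K$ ($K=\mathbb R$ or $\mathbb C$) with base $(\Omega,\mathcal F,P)$, and let $f:[0,\infty)\to (S,\mathcal T_{\varepsilon,\lambda})$ be a continuous function such that, for some $M\in L^0_+(\mathcal F)$ and $\xi\in L^0(\mathcal F,\mathbb R)$, $\|f(s)\|\le M e^{\xi s}$ for all $s\ge 0$. For $\eta\in G_\xi$ let $H(\eta)=\int_0^\infty e^{-\eta s}f(s)\,ds$ be the Laplace transform of $f$. Then for every positive integer $k$ and every $\eta\in G_\xi$, the $k$-th $\mathcal T_c$-derivative of $H:G_\xi\to S$ at $\eta$ exists and $$\mathcal T_c\text{-}H^{(k)}(\eta)=\int_0^\infty e^{-\eta s}(-s)^k f(s)\,ds .$$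
   Context: $L^0(\mathcal F,K)$ is the algebra of ($P$-a.s.) equivalence classes of $K$-valued $\mathcal F$-measurable random variables on $\Omega$. For $f,g\in L^0(\mathcal F,\mathbb R)$, $f\le g$ means a.s. inequality and "$f>g$ on $\Omega$" means $f(\omega)>g(\omega)$ for almost all $\omega$. $L^0_+(\mathcal F)=\{\xi\in L^0(\mathcal F,\mathbb R):\xi\ge 0\}$, $L^0_{++}(\mathcal F)=\{\xi\in L^0(\mathcal F,\mathbb R):\xi>0\text{ on }\Omega\}$, and $G_\xi=\{\eta\in L^0(\mathcal F,\mathbb R):\eta>\xi\text{ on }\Omega\}$. A random normed module over $K$ with base $(\Omega,\mathcal F,P)$ is a left $L^0(\mathcal F,K)$-module $S$ with a map $\|\cdot\|:S\to L^0_+(\mathcal F)$ (the $L^0$-norm) such that $\|x\|=0\Rightarrow x=\theta$ (the zero of $S$), $\|\zeta x\|=|\zeta|\,\|x\|$ and $\|x+y\|\le\|x\|+\|y\|$ for $\zeta\in L^0(\mathcal F,K)$, $x,y\in S$. The $(\varepsilon,\lambda)$-topology $\mathcal T_{\varepsilon,\lambda}$ on $S$ is the metrizable linear topology with local base at $\theta$ the sets $\{z: P(\|z\|<\varepsilon)>1-\lambda\}$, $\varepsilon>0$, $0<\lambda<1$; thus $z_n\to z$ iff $\|z_n-z\|\to0$ in probability. The locally $L^0$-convex topology $\mathcal T_c$ has local base at $\theta$ the sets $\{x\in S:\|x\|<\varepsilon\text{ on }\Omega\}$, $\varepsilon\in L^0_{++}(\mathcal F)$; it is defined in particular on $L^0(\mathcal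 F,\mathbb R)$ with $\|\cdot\|=|\cdot|$. $G_\xi$ is a $\mathcal T_c$-open subset of $L^0(\mathcal F,\mathbb R)$. Integrals over compact intervals are Riemann integrals ($\mathcal T_{\varepsilon,\lambda}$-limits of Riemann sums; a $\mathcal T_{\varepsilon,\lambda}$-continuous $g:[a,b]\to S$ with $\bigvee_{u\in[a,b]}\|g(u)\|\in L^0_+(\mathcal F)$ is Riemann integrable), and $\int_0^\infty$ is the $\mathcal T_{\varepsilon,\lambda}$-limit of $\int_0^L$ as $L\to\infty$. $\mathcal T_c$-derivative: for a $\mathcal T_c$-open set $G\subset L^0(\mathcal F,\mathbb R)$, $H:G\to S$ and $x_0\in G$, $H$ is $\mathcal T_c$-differentiable at $x_0$ with $\mathcal T_c$-derivative $I\in S$ if $\frac{H(x_0+r)-H(x_0)}{r}-I$ converges to $\theta$ in $\mathcal T_c$ as $r\to 0$ in $\mathcal T_c$ through $r\in L^0(\mathcal F,\mathbb R)$ with $|r|\in L^0_{++}(\mathcal F)$ (so that $r$ is invertible in $L^0(\mathcal F,\mathbb R)$). $\mathcal T_c\text{-}H^{(k)}$ denotes the $k$-fold iterated $\mathcal T_c$-derivative. *)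

theory Defs
  imports "HOL-Probability.Probability" "HOL-Algebra.Module"
begin

section \<open>The algebra of equivalence classes of random variables\<close>

definition L0_rel ::
    "'w measure \<Rightarrow> (('w \<Rightarrow> 'k::topological_space) \<times> ('w \<Rightarrow> 'k)) set" where
  "L0_rel P = {(f, g). f \<in> borel_measurable P \<and> g \<in> borel_measurable P \<and>
                       (AE \<omega> in P. f \<omega> = g \<omega>)}"

definition L0_class ::
    "'w measure \<Rightarrow> ('w \<Rightarrow> 'k::topological_space) \<Rightarrow> ('w \<Rightarrow> 'k) set" where
  "L0_class P f = L0_rel P `` {f}"

text \<open>
  Pointwise operations on classes, by operating on representatives: for a Borel measurable
  operation \<open>\<phi>\<close> and classes \<open>a\<close>, \<open>b\<close>, all the classes in the unions below coincide.
\<close>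

definition L0_map ::
    "'w measure \<Rightarrow> ('j::topological_space \<Rightarrow> 'k::topological_space) \<Rightarrow>
     ('w \<Rightarrow> 'j) set \<Rightarrow> ('w \<Rightarrow> 'k) set" where
  "L0_map P \<phi> a = (\<Union>f\<in>a. L0_class P (\<lambda>\<omega>. \<phi> (f \<omega>)))"

definition L0_map2 ::
    "'w measure \<Rightarrow> ('k::topological_space \<Rightarrow> 'k \<Rightarrow> 'k) \<Rightarrow>
     ('w \<Rightarrow> 'k) set \<Rightarrow> ('w \<Rightarrow> 'k) set \<Rightarrow> ('w \<Rightarrow> 'k) set" where
  "L0_map2 P \<phi> a b = (\<Union>f\<in>a. \<Union>g\<in>b. L0_class P (\<lambda>\<omega>. \<phi> (f \<omega>) (g \<omega>)))"

definition L0 :: "'w measure \<Rightarrow> ('w \<Rightarrow> 'k::real_normed_field) set ring" where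
  "L0 P = \<lparr>carrier = borel_measurable P // L0_rel P,
           mult = L0_map2 P (*),
           one = L0_class P (\<lambda>_. 1),
           zero = L0_class P (\<lambda>_. 0),
           add = L0_map2 P (+)\<rparr>"

text \<open>
  The relations below are meant for elements of \<open>carrier (L0 P)\<close>, i.e. nonempty classes modulo
  almost sure equality, so that it does not matter whether representatives are quantified
  universally or existentially.
\<close>

definition L0_le :: "'w measure \<Rightarrow> ('w \<Rightarrow> real) set \<Rightarrow> ('w \<Rightarrow> real) set \<Rightarrow> bool" where
  "L0_le P a b \<longleftrightarrow> (\<forall>f\<in>a. \<forall>g\<in>b. AE \<omega> in P. f \<omega> \<le> g \<omega>)"

definition L0_less :: "'w measure \<Rightarrow> ('w \<Rightarrow> real) set \<Rightarrow> ('w \<Rightarrow> real) set \<Rightarrow> bool" where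
  "L0_less P a b \<longleftrightarrow> (\<forall>f\<in>a. \<forall>g\<in>b. AE \<omega> in P. f \<omega> < g \<omega>)"

definition L0_plus :: "'w measure \<Rightarrow> ('w \<Rightarrow> real) set set" where
  "L0_plus P = {a \<in> carrier (L0 P). L0_le P \<zero>\<^bsub>L0 P\<^esub> a}"

definition L0_pplus :: "'w measure \<Rightarrow> ('w \<Rightarrow> real) set set" where
  "L0_pplus P = {a \<in> carrier (L0 P). L0_less P \<zero>\<^bsub>L0 P\<^esub> a}"

definition L0_above :: "'w measure \<Rightarrow> ('w \<Rightarrow> real) set \<Rightarrow> ('w \<Rightarrow> real) set set" where
  "L0_above P \<xi> = {\<eta> \<in> carrier (L0 P). L0_less P \<xi> \<eta>}"


section \<open>Random normed modules and their two topologies\<close>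

text \<open>
  The type class constraint \<open>{real_normed_field,euclidean_space}\<close> on \<open>'k\<close> says that the scalar field
  is the real or the complex field: both types are instances, and up to isomorphism there are no
  others.
\<close>

locale random_normed_module =
  prob_space P + Module.module "L0 P" S
  for P :: "'w measure"
    and S :: "(('w \<Rightarrow> 'k::{real_normed_field,euclidean_space}) set, 's, 'm) module_scheme" +
  fixes nrm :: "'s \<Rightarrow> ('w \<Rightarrow> real) set"
  assumes nrm_in_L0_plus: "x \<in> carrier S \<Longrightarrow> nrm x \<in> L0_plus P"
    and nrm_eq_zero: "x \<in> carrier S \<Longrightarrow> nrm x = \<zero>\<^bsub>L0 P\<^esub> \<Longrightarrow> x = \<zero>\<^bsub>S\<^esub>"
    and nrm_smult: "\<zeta> \<in> carrier (L0 P) \<Longrightarrow> x \<in> carrier S \<Longrightarrow>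
                    nrm (\<zeta> \<odot>\<^bsub>S\<^esub> x) = L0_map P norm \<zeta> \<otimes>\<^bsub>L0 P\<^esub> nrm x"
    and nrm_triangle: "x \<in> carrier S \<Longrightarrow> y \<in> carrier S \<Longrightarrow>
                       L0_le P (nrm (x \<oplus>\<^bsub>S\<^esub> y)) (nrm x \<oplus>\<^bsub>L0 P\<^esub> nrm y)"

text \<open>
  Only the additive structure of \<open>S\<close> enters the topologies. They are therefore defined for any
  ring record, so as to apply to a module (whose record type extends that of rings) and also to
  \<open>L0 P\<close> itself, with \<open>L0_map P abs\<close> as \<open>L\<^sup>0\<close>-norm.
\<close>

definition el_nbhd ::
    "'w measure \<Rightarrow> ('s, 'm) ring_scheme \<Rightarrow> ('s \<Rightarrow> ('w \<Rightarrow> real) set) \<Rightarrow>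
     real \<Rightarrow> real \<Rightarrow> 's set" where
  "el_nbhd P S nrm \<epsilon> l =
     {z \<in> carrier S. \<forall>h\<in>nrm z. measure P {\<omega> \<in> space P. h \<omega> < \<epsilon>} > 1 - l}"

definition el_topology ::
    "'w measure \<Rightarrow> ('s, 'm) ring_scheme \<Rightarrow> ('s \<Rightarrow> ('w \<Rightarrow> real) set) \<Rightarrow> 's topology" where
  "el_topology P S nrm = topology (\<lambda>U. U \<subseteq> carrier S \<and>
     (\<forall>x\<in>U. \<exists>\<epsilon>>0. \<exists>l\<in>{0<..<1}. \<forall>z\<in>el_nbhd P S nrm \<epsilon> l. x \<oplus>\<^bsub>S\<^esub> z \<in> U))"

definition Tc_nbhd ::
    "'w measure \<Rightarrow> ('s, 'm) ring_scheme \<Rightarrow> ('s \<Rightarrow> ('w \<Rightarrow> real) set) \<Rightarrow>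
     ('w \<Rightarrow> real) set \<Rightarrow> 's set" where
  "Tc_nbhd P S nrm \<epsilon> = {z \<in> carrier S. L0_less P (nrm z) \<epsilon>}"

definition Tc_topology ::
    "'w measure \<Rightarrow> ('s, 'm) ring_scheme \<Rightarrow> ('s \<Rightarrow> ('w \<Rightarrow> real) set) \<Rightarrow> 's topology" where
  "Tc_topology P S nrm = topology (\<lambda>U. U \<subseteq> carrier S \<and>
     (\<forall>x\<in>U. \<exists>\<epsilon>\<in>L0_pplus P. \<forall>z\<in>Tc_nbhd P S nrm \<epsilon>. x \<oplus>\<^bsub>S\<^esub> z \<in> U))"

definition el_complete ::
    "'w measure \<Rightarrow> ('s, 'm) ring_scheme \<Rightarrow> ('s \<Rightarrow> ('w \<Rightarrow> real) set) \<Rightarrow> bool" where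
  "el_complete P S nrm \<longleftrightarrow>
     (\<forall>X :: nat \<Rightarrow> 's. range X \<subseteq> carrier S \<longrightarrow>
        (\<forall>\<epsilon>>0. \<forall>l\<in>{0<..<1}. \<exists>N. \<forall>m\<ge>N. \<forall>n\<ge>N. X m \<ominus>\<^bsub>S\<^esub> X n \<in> el_nbhd P S nrm \<epsilon> l) \<longrightarrow>
        (\<exists>x. limitin (el_topology P S nrm) X x sequentially))"


section \<open>Riemann integrals\<close>

text \<open>
  Tagged partitions of \<open>{a..b}\<close>, directed by the mesh tending to \<open>0\<close>. The constant gauge
  \<open>\<lambda>x. ball x d\<close> is what makes this the Riemann and not the Henstock-Kurzweil integral.
\<close>

definition riemann_filter :: "real \<Rightarrow> real \<Rightarrow> (real \<times> real set) set filter" where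
  "riemann_filter a b =
     (INF d\<in>{0<..}. principal {p. p tagged_division_of {a..b} \<and> (\<lambda>x. ball x d) fine p})"

definition riemann_sum ::
    "'w measure \<Rightarrow> (('w \<Rightarrow> 'k::real_normed_field) set, 's, 'm) module_scheme \<Rightarrow>
     (real \<Rightarrow> 's) \<Rightarrow> (real \<times> real set) set \<Rightarrow> 's" where
  "riemann_sum P S g p =
     finsum S (\<lambda>(x, J). L0_class P (\<lambda>_. of_real (measure lborel J)) \<odot>\<^bsub>S\<^esub> g x) p"

definition has_riemann_integral ::
    "'w measure \<Rightarrow> (('w \<Rightarrow> 'k::real_normed_field) set, 's, 'm) module_scheme \<Rightarrow>
     ('s \<Rightarrow> ('w \<Rightarrow> real) set) \<Rightarrow> (real \<Rightarrow> 's) \<Rightarrow> real \<Rightarrow> real \<Rightarrow> 's \<Rightarrow> bool" where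
  "has_riemann_integral P S nrm g a b I \<longleftrightarrow>
     limitin (el_topology P S nrm) (riemann_sum P S g) I (riemann_filter a b)"

definition has_integral_0_inf ::
    "'w measure \<Rightarrow> (('w \<Rightarrow> 'k::real_normed_field) set, 's, 'm) module_scheme \<Rightarrow>
     ('s \<Rightarrow> ('w \<Rightarrow> real) set) \<Rightarrow> (real \<Rightarrow> 's) \<Rightarrow> 's \<Rightarrow> bool" where
  "has_integral_0_inf P S nrm g I \<longleftrightarrow>
     (\<exists>J. (\<forall>L\<ge>0. has_riemann_integral P S nrm g 0 L (J L)) \<and>
          limitin (el_topology P S nrm) J I at_top)"

definition integral_0_inf ::
    "'w measure \<Rightarrow> (('w \<Rightarrow> 'k::real_normed_field) set, 's, 'm) module_scheme \<Rightarrow>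
     ('s \<Rightarrow> ('w \<Rightarrow> real) set) \<Rightarrow> (real \<Rightarrow> 's) \<Rightarrow> 's" where
  "integral_0_inf P S nrm g = (THE I. has_integral_0_inf P S nrm g I)"

text \<open>The integrand \<open>e\<^bsup>-\<eta>s\<^esup> (-s)\<^sup>k f(s)\<close>; for \<open>k = 0\<close> that of the Laplace transform.\<close>

definition laplace_integrand ::
    "'w measure \<Rightarrow> (('w \<Rightarrow> 'k::real_normed_field) set, 's, 'm) module_scheme \<Rightarrow>
     (real \<Rightarrow> 's) \<Rightarrow> nat \<Rightarrow> ('w \<Rightarrow> real) set \<Rightarrow> real \<Rightarrow> 's" where
  "laplace_integrand P S f k \<eta> s =
     L0_map P (\<lambda>y. of_real (exp (- y * s) * (- s) ^ k)) \<eta> \<odot>\<^bsub>S\<^esub> f s"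

definition laplace ::
    "'w measure \<Rightarrow> (('w \<Rightarrow> 'k::real_normed_field) set, 's, 'm) module_scheme \<Rightarrow>
     ('s \<Rightarrow> ('w \<Rightarrow> real) set) \<Rightarrow> (real \<Rightarrow> 's) \<Rightarrow> ('w \<Rightarrow> real) set \<Rightarrow> 's" where
  "laplace P S nrm f \<eta> = integral_0_inf P S nrm (laplace_integrand P S f 0 \<eta>)"


section \<open>Derivatives with respect to the locally \<open>L\<^sup>0\<close>-convex topology\<close>

text \<open>
  Increments \<open>r\<close> are real random variables; \<open>L0_map P of_real\<close> embeds them into the scalars of \<open>S\<close>,
  and the inverse is the one of the ring \<open>L0 P\<close>. The condition \<open>x \<oplus> r \<in> G\<close> holds for all
  \<open>r\<close> near \<open>0\<close> as \<open>G\<close> is open.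
\<close>

definition has_Tc_derivative ::
    "'w measure \<Rightarrow> (('w \<Rightarrow> 'k::real_normed_field) set, 's, 'm) module_scheme \<Rightarrow>
     ('s \<Rightarrow> ('w \<Rightarrow> real) set) \<Rightarrow> ('w \<Rightarrow> real) set set \<Rightarrow>
     (('w \<Rightarrow> real) set \<Rightarrow> 's) \<Rightarrow> ('w \<Rightarrow> real) set \<Rightarrow> 's \<Rightarrow> bool" where
  "has_Tc_derivative P S nrm G H x I \<longleftrightarrow>
     openin (Tc_topology P (L0 P) (L0_map P abs)) G \<and> H \<in> G \<rightarrow> carrier S \<and>
     x \<in> G \<and> I \<in> carrier S \<and>
     limitin (Tc_topology P S nrm)
       (\<lambda>r. inv\<^bsub>L0 P\<^esub> (L0_map P of_real r) \<odot>\<^bsub>S\<^esub> (H (x \<oplus>\<^bsub>L0 P\<^esub> r) \<ominus>\<^bsub>S\<^esub> H x) \<ominus>\<^bsub>S\<^esub> I)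
       \<zero>\<^bsub>S\<^esub>
       (atin_within (Tc_topology P (L0 P) (L0_map P abs)) \<zero>\<^bsub>L0 P\<^esub>
          {r \<in> carrier (L0 P). L0_map P abs r \<in> L0_pplus P \<and> x \<oplus>\<^bsub>L0 P\<^esub> r \<in> G})"

text \<open>
  For the derivative of order \<open>Suc k\<close> at \<open>x\<close> to exist, the one of order \<open>k\<close> must exist
  on all of \<open>G\<close>.
\<close>

primrec has_nth_Tc_derivative ::
    "nat \<Rightarrow> 'w measure \<Rightarrow> (('w \<Rightarrow> 'k::real_normed_field) set, 's, 'm) module_scheme \<Rightarrow>
     ('s \<Rightarrow> ('w \<Rightarrow> real) set) \<Rightarrow> ('w \<Rightarrow> real) set set \<Rightarrow>
     (('w \<Rightarrow> real) set \<Rightarrow> 's) \<Rightarrow> ('w \<Rightarrow> real) set \<Rightarrow> 's \<Rightarrow> bool" where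
  "has_nth_Tc_derivative 0 P S nrm G H x I \<longleftrightarrow> I = H x"
| "has_nth_Tc_derivative (Suc k) P S nrm G H x I \<longleftrightarrow>
     (\<exists>D. (\<forall>y\<in>G. has_nth_Tc_derivative k P S nrm G H y (D y)) \<and>
          has_Tc_derivative P S nrm G D x I)"

section \<open>The definitions are meaningful\<close>

text \<open>
  Operations and relations on classes are independent of representatives, \<open>L0 P\<close> is a commutative
  ring, and the two predicates passed to \<^const>\<open>topology\<close> above do define topologies.
\<close>

lemma equiv_L0_rel: "equiv (borel_measurable P) (L0_rel P)"
  unfolding equiv_def refl_on_def sym_def trans_def L0_rel_def
  by (fastforce elim: AE_mp)

lemma L0_class_in: "f \<in> borel_measurable P \<Longrightarrow> L0_class P (f::'w \<Rightarrow> 'k::real_normed_field) \<in> carrier (L0 P)"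
  by (simp add: L0_def L0_class_def quotientI)

lemma L0_class_rep:
  assumes "a \<in> carrier (L0 P)"
  obtains f where "f \<in> borel_measurable P" "a = L0_class P f"
  using assms unfolding L0_def L0_class_def by (auto elim: quotientE)

lemma L0_mem_class: "g \<in> L0_class P f \<longleftrightarrow> f \<in> borel_measurable P \<and> g \<in> borel_measurable P \<and> (AE \<omega> in P. f \<omega> = g \<omega>)"
  by (auto simp: L0_class_def L0_rel_def)

lemma L0_class_eq: "f \<in> borel_measurable P \<Longrightarrow> g \<in> borel_measurable P \<Longrightarrow> AE \<omega> in P. f \<omega> = g \<omega> \<Longrightarrow> L0_class P f = L0_class P g"
  unfolding L0_class_def using equiv_L0_rel[of P] by (auto intro!: equiv_class_eq simp: L0_rel_def)

lemma L0_map_class: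
  assumes [measurable]: "f \<in> borel_measurable P" "\<phi> \<in> borel_measurable borel"
  shows "L0_map P \<phi> (L0_class P f) = L0_class P (\<lambda>\<omega>. \<phi> (f \<omega>))"
proof -
  have "L0_class P (\<lambda>\<omega>. \<phi> (g \<omega>)) = L0_class P (\<lambda>\<omega>. \<phi> (f \<omega>))" if "g \<in> L0_class P f" for g
    using that by (intro L0_class_eq) (auto simp: L0_mem_class elim!: AE_mp)
  moreover have "f \<in> L0_class P f" by (simp add: L0_mem_class)
  ultimately show ?thesis unfolding L0_map_def by blast
qed

lemma L0_map2_class:
  fixes \<phi> :: "'k::{second_countable_topology} \<Rightarrow> 'k \<Rightarrow> 'k"
  assumes [measurable]: "f \<in> borel_measurable P" "g \<in> borel_measurable P"
    and c: "continuous_on UNIV (\<lambda>x. \<phi> (fst x) (snd x))"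
  shows "L0_map2 P \<phi> (L0_class P f) (L0_class P g) = L0_class P (\<lambda>\<omega>. \<phi> (f \<omega>) (g \<omega>))"
proof -
  have "L0_class P (\<lambda>\<omega>. \<phi> (f' \<omega>) (g' \<omega>)) = L0_class P (\<lambda>\<omega>. \<phi> (f \<omega>) (g \<omega>))" 
    if "f' \<in> L0_class P f" "g' \<in> L0_class P g" for f' g'
  proof (intro L0_class_eq)
    have m: "f' \<in> borel_measurable P" "g' \<in> borel_measurable P" using that by (auto simp: L0_mem_class)
    then show "(\<lambda>\<omega>. \<phi> (f' \<omega>) (g' \<omega>)) \<in> borel_measurable P"
      using borel_measurable_continuous_Pair[OF _ _ c] by blast
    show "(\<lambda>\<omega>. \<phi> (f \<omega>) (g \<omega>)) \<in> borel_measurable P"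
      using borel_measurable_continuous_Pair[OF assms(1,2) c] .
    have "AE \<omega> in P. f \<omega> = f' \<omega>" "AE \<omega> in P. g \<omega> = g' \<omega>" using that by (auto simp: L0_mem_class)
    then show "AE \<omega> in P. \<phi> (f' \<omega>) (g' \<omega>) = \<phi> (f \<omega>) (g \<omega>)" by eventually_elim auto
  qed
  moreover have "f \<in> L0_class P f" "g \<in> L0_class P g" by (simp_all add: L0_mem_class)
  ultimately show ?thesis unfolding L0_map2_def by blast
qed

lemma L0_add_class:
  fixes f g :: "'w \<Rightarrow> 'k::{real_normed_field,euclidean_space}"
  assumes "f \<in> borel_measurable P" "g \<in> borel_measurable P"
  shows "L0_class P f \<oplus>\<^bsub>L0 P\<^esub> L0_class P g = L0_class P (\<lambda>\<omega>. f \<omega> + g \<omega>)"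
  using L0_map2_class[OF assms, of "(+)"] by (simp add: L0_def continuous_intros)

lemma L0_mult_class:
  fixes f g :: "'w \<Rightarrow> 'k::{real_normed_field,euclidean_space}"
  assumes "f \<in> borel_measurable P" "g \<in> borel_measurable P"
  shows "L0_class P f \<otimes>\<^bsub>L0 P\<^esub> L0_class P g = L0_class P (\<lambda>\<omega>. f \<omega> * g \<omega>)"
  using L0_map2_class[OF assms, of "(*)"] by (simp add: L0_def continuous_intros)

lemma L0_one_class: "\<one>\<^bsub>L0 P\<^esub> = L0_class P (\<lambda>_. 1)" and L0_zero_class: "\<zero>\<^bsub>L0 P\<^esub> = L0_class P (\<lambda>_. 0)"
  by (simp_all add: L0_def)

lemma cring_L0: "cring (L0 P :: ('w \<Rightarrow> 'k::{real_normed_field,euclidean_space}) set ring)"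
proof (rule cringI)
  note defs = L0_add_class L0_mult_class L0_one_class L0_zero_class L0_class_in
  show "abelian_group (L0 P :: ('w \<Rightarrow> 'k) set ring)"
  proof (rule abelian_groupI)
    fix x :: "('w \<Rightarrow> 'k) set" assume "x \<in> carrier (L0 P)"
    then obtain f where f: "f \<in> borel_measurable P" "x = L0_class P f" by (rule L0_class_rep)
    have "L0_class P (\<lambda>\<omega>. - f \<omega>) \<oplus>\<^bsub>L0 P\<^esub> x = \<zero>\<^bsub>L0 P\<^esub>"
      using f by (simp add: defs)
    then show "\<exists>y\<in>carrier (L0 P). y \<oplus>\<^bsub>L0 P\<^esub> x = \<zero>\<^bsub>L0 P\<^esub>"
      using f by (intro bexI[of _ "L0_class P (\<lambda>\<omega>. - f \<omega>)"]) (auto intro!: L0_class_in)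
  qed (auto elim!: L0_class_rep simp: defs algebra_simps)
  show "comm_monoid (L0 P :: ('w \<Rightarrow> 'k) set ring)"
    by (rule comm_monoidI) (auto elim!: L0_class_rep simp: defs algebra_simps)
qed (auto elim!: L0_class_rep simp: L0_add_class L0_mult_class L0_class_in algebra_simps)

lemma L0_less_class: "f \<in> borel_measurable P \<Longrightarrow> g \<in> borel_measurable P \<Longrightarrow>
  L0_less P (L0_class P f) (L0_class P g) \<longleftrightarrow> (AE \<omega> in P. f \<omega> < g \<omega>)"
proof
  assume "f \<in> borel_measurable P" "g \<in> borel_measurable P" "L0_less P (L0_class P f) (L0_class P g)"
  moreover have "f \<in> L0_class P f" "g \<in> L0_class P g" using calculation by (simp_all add: L0_mem_class)
  ultimately show "AE \<omega> in P. f \<omega> < g \<omega>" unfolding L0_less_def by blast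
next
  assume l: "AE \<omega> in P. f \<omega> < g \<omega>"
  show "L0_less P (L0_class P f) (L0_class P g)" unfolding L0_less_def
  proof (intro ballI)
    fix f' g' assume "f' \<in> L0_class P f" "g' \<in> L0_class P g"
    then have "AE \<omega> in P. f \<omega> = f' \<omega>" "AE \<omega> in P. g \<omega> = g' \<omega>" by (auto simp: L0_mem_class)
    with l show "AE \<omega> in P. f' \<omega> < g' \<omega>" by eventually_elim auto
  qed
qed

lemma L0_pplus_min:
  assumes "a \<in> L0_pplus P" "b \<in> L0_pplus P"
  obtains c where "c \<in> L0_pplus P" "\<And>x. x \<in> carrier (L0 P) \<Longrightarrow> L0_less P x c \<Longrightarrow> L0_less P x a \<and> L0_less P x b"
proof -
  obtain f where f[measurable]: "f \<in> borel_measurable P" "a = L0_class P f" using assms by (auto simp: L0_pplus_def elim: L0_class_rep)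
  obtain g where g[measurable]: "g \<in> borel_measurable P" "b = L0_class P g" using assms by (auto simp: L0_pplus_def elim: L0_class_rep)
  have m[measurable]: "(\<lambda>\<omega>. min (f \<omega>) (g \<omega>)) \<in> borel_measurable P" by measurable
  show ?thesis
  proof (rule that)
    show "L0_class P (\<lambda>\<omega>. min (f \<omega>) (g \<omega>)) \<in> L0_pplus P"
      using assms f g by (auto simp: L0_pplus_def L0_zero_class L0_less_class L0_class_in)
    show "\<And>x. x \<in> carrier (L0 P) \<Longrightarrow> L0_less P x (L0_class P (\<lambda>\<omega>. min (f \<omega>) (g \<omega>))) \<Longrightarrow> L0_less P x a \<and> L0_less P x b"
      using f g by (auto elim!: L0_class_rep simp: L0_less_class)
  qed
qed

lemma istopology_Tc: 
  assumes n: "\<And>x. x \<in> carrier S \<Longrightarrow> nrm x \<in> carrier (L0 P)"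
  shows "istopology (\<lambda>U. U \<subseteq> carrier S \<and>
     (\<forall>x\<in>U. \<exists>\<epsilon>\<in>L0_pplus P. \<forall>z\<in>Tc_nbhd P S nrm \<epsilon>. x \<oplus>\<^bsub>S\<^esub> z \<in> U))"
  unfolding istopology_def
proof (intro conjI allI impI)
  fix U V assume *: "U \<subseteq> carrier S \<and> (\<forall>x\<in>U. \<exists>\<epsilon>\<in>L0_pplus P. \<forall>z\<in>Tc_nbhd P S nrm \<epsilon>. x \<oplus>\<^bsub>S\<^esub> z \<in> U)"
    "V \<subseteq> carrier S \<and> (\<forall>x\<in>V. \<exists>\<epsilon>\<in>L0_pplus P. \<forall>z\<in>Tc_nbhd P S nrm \<epsilon>. x \<oplus>\<^bsub>S\<^esub> z \<in> V)"
  show "U \<inter> V \<subseteq> carrier S" using * by auto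
  show "\<forall>x\<in>U \<inter> V. \<exists>\<epsilon>\<in>L0_pplus P. \<forall>z\<in>Tc_nbhd P S nrm \<epsilon>. x \<oplus>\<^bsub>S\<^esub> z \<in> U \<inter> V"
  proof
    fix x assume "x \<in> U \<inter> V"
    then obtain a b where a: "a \<in> L0_pplus P" "\<forall>z\<in>Tc_nbhd P S nrm a. x \<oplus>\<^bsub>S\<^esub> z \<in> U"
      and b: "b \<in> L0_pplus P" "\<forall>z\<in>Tc_nbhd P S nrm b. x \<oplus>\<^bsub>S\<^esub> z \<in> V"
      using * by blast
    obtain c where c: "c \<in> L0_pplus P"
      "\<And>x. x \<in> carrier (L0 P) \<Longrightarrow> L0_less P x c \<Longrightarrow> L0_less P x a \<and> L0_less P x b"
      using L0_pplus_min[OF a(1) b(1)] by metis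
    have "Tc_nbhd P S nrm c \<subseteq> Tc_nbhd P S nrm a \<inter> Tc_nbhd P S nrm b"
      using c(2) n by (auto simp: Tc_nbhd_def)
    then show "\<exists>\<epsilon>\<in>L0_pplus P. \<forall>z\<in>Tc_nbhd P S nrm \<epsilon>. x \<oplus>\<^bsub>S\<^esub> z \<in> U \<inter> V"
      using a(2) b(2) c(1) by (intro bexI[of _ c]) auto
  qed
next
  fix K assume K: "\<forall>U\<in>K. U \<subseteq> carrier S \<and> (\<forall>x\<in>U. \<exists>\<epsilon>\<in>L0_pplus P. \<forall>z\<in>Tc_nbhd P S nrm \<epsilon>. x \<oplus>\<^bsub>S\<^esub> z \<in> U)"
  show "\<Union>K \<subseteq> carrier S" using K by auto
  show "\<forall>x\<in>\<Union>K. \<exists>\<epsilon>\<in>L0_pplus P. \<forall>z\<in>Tc_nbhd P S nrm \<epsilon>. x \<oplus>\<^bsub>S\<^esub> z \<in> \<Union>K"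
  proof
    fix x assume "x \<in> \<Union>K"
    then obtain U where U: "U \<in> K" "x \<in> U" by blast
    with K have "\<exists>\<epsilon>\<in>L0_pplus P. \<forall>z\<in>Tc_nbhd P S nrm \<epsilon>. x \<oplus>\<^bsub>S\<^esub> z \<in> U" by auto
    then show "\<exists>\<epsilon>\<in>L0_pplus P. \<forall>z\<in>Tc_nbhd P S nrm \<epsilon>. x \<oplus>\<^bsub>S\<^esub> z \<in> \<Union>K" using U(1) by (meson UnionI)
  qed
qed

lemma istopology_el: 
  assumes "prob_space P" and n: "\<And>x. x \<in> carrier S \<Longrightarrow> nrm x \<in> carrier (L0 P)"
  shows "istopology (\<lambda>U. U \<subseteq> carrier S \<and>
     (\<forall>x\<in>U. \<exists>\<epsilon>>0. \<exists>l\<in>{0<..<1}. \<forall>z\<in>el_nbhd P S nrm \<epsilon> l. x \<oplus>\<^bsub>S\<^esub> z \<in> U))"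
proof -
  interpret prob_space P by fact
  have mono: "el_nbhd P S nrm e l \<subseteq> el_nbhd P S nrm e' l'" if "e \<le> e'" "l \<le> l'" for e e' l l'
  proof
    fix z assume z: "z \<in> el_nbhd P S nrm e l"
    then obtain f where f: "f \<in> borel_measurable P" "nrm z = L0_class P f" using n[of z] L0_class_rep[of "nrm z" P] by (auto simp: el_nbhd_def)
    have "1 - l' < measure P {\<omega> \<in> space P. h \<omega> < e'}" if h: "h \<in> nrm z" for h
    proof -
      have [measurable]: "h \<in> borel_measurable P" using h f by (simp add: L0_mem_class)
      have "measure P {\<omega> \<in> space P. h \<omega> < e} \<le> measure P {\<omega> \<in> space P. h \<omega> < e'}"
        using \<open>e \<le> e'\<close> by (intro finite_measure_mono) auto
      then show ?thesis using z h \<open>l \<le> l'\<close> unfolding el_nbhd_def by force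
    qed
    then show "z \<in> el_nbhd P S nrm e' l'" using z by (auto simp: el_nbhd_def)
  qed
  show ?thesis
  unfolding istopology_def
  proof (intro conjI allI impI)
  fix U V assume *: "U \<subseteq> carrier S \<and> (\<forall>x\<in>U. \<exists>\<epsilon>>0. \<exists>l\<in>{0<..<1}. \<forall>z\<in>el_nbhd P S nrm \<epsilon> l. x \<oplus>\<^bsub>S\<^esub> z \<in> U)"
    "V \<subseteq> carrier S \<and> (\<forall>x\<in>V. \<exists>\<epsilon>>0. \<exists>l\<in>{0<..<1}. \<forall>z\<in>el_nbhd P S nrm \<epsilon> l. x \<oplus>\<^bsub>S\<^esub> z \<in> V)"
  show "U \<inter> V \<subseteq> carrier S" using * by auto
  show "\<forall>x\<in>U \<inter> V. \<exists>\<epsilon>>0. \<exists>l\<in>{0<..<1}. \<forall>z\<in>el_nbhd P S nrm \<epsilon> l. x \<oplus>\<^bsub>S\<^esub> z \<in> U \<inter> V"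
  proof
    fix x assume "x \<in> U \<inter> V"
    then obtain a l where a: "a > 0" "l \<in> {0<..<1}" "\<forall>z\<in>el_nbhd P S nrm a l. x \<oplus>\<^bsub>S\<^esub> z \<in> U"
      using *(1) by (elim IntE conjE) (drule (1) bspec, blast)
    obtain b m where b: "b > 0" "m \<in> {0<..<1}" "\<forall>z\<in>el_nbhd P S nrm b m. x \<oplus>\<^bsub>S\<^esub> z \<in> V"
      using *(2) \<open>x \<in> U \<inter> V\<close> by (elim IntE conjE) (drule (1) bspec, blast)
    show "\<exists>\<epsilon>>0. \<exists>l\<in>{0<..<1}. \<forall>z\<in>el_nbhd P S nrm \<epsilon> l. x \<oplus>\<^bsub>S\<^esub> z \<in> U \<inter> V"
      using a b mono[of "min a b" a "min l m" l] mono[of "min a b" b "min l m" m]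
      by (intro exI[of _ "min a b"] conjI bexI[of _ "min l m"] ballI) auto
  qed
next
  fix K assume K: "\<forall>U\<in>K. U \<subseteq> carrier S \<and> (\<forall>x\<in>U. \<exists>\<epsilon>>0. \<exists>l\<in>{0<..<1}. \<forall>z\<in>el_nbhd P S nrm \<epsilon> l. x \<oplus>\<^bsub>S\<^esub> z \<in> U)"
  show "\<Union>K \<subseteq> carrier S" using K by auto
  show "\<forall>x\<in>\<Union>K. \<exists>\<epsilon>>0. \<exists>l\<in>{0<..<1}. \<forall>z\<in>el_nbhd P S nrm \<epsilon> l. x \<oplus>\<^bsub>S\<^esub> z \<in> \<Union>K"
  proof
    fix x assume "x \<in> \<Union>K"
    then obtain U where U: "U \<in> K" "x \<in> U" by blast
    with K have "\<exists>\<epsilon>>0. \<exists>l\<in>{0<..<1}. \<forall>z\<in>el_nbhd P S nrm \<epsilon> l. x \<oplus>\<^bsub>S\<^esub> z \<in> U" by auto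
    then show "\<exists>\<epsilon>>0. \<exists>l\<in>{0<..<1}. \<forall>z\<in>el_nbhd P S nrm \<epsilon> l. x \<oplus>\<^bsub>S\<^esub> z \<in> \<Union>K" using U(1) by (meson UnionI)
  qed
qed
qed

end

theory Submission
  imports Defs
begin

text \<open>
  All estimates are almost sure inequalities between norms. If \<open>\<parallel>g s\<parallel> \<le> C exp (-c s)\<close> a.s. for
  every \<open>s \<ge> 0\<close>, with random \<open>C \<ge> 0\<close> and \<open>c > 0\<close>, then Riemann sums of mesh less than \<open>1\<close> over
  \<open>{a..b}\<close> have norm at most \<open>C exp c / c exp (-c a)\<close>, and this passes to limits in probability.
  Together with the Cauchy property of Riemann sums (compare two partitions on their common
  refinement) it gives convergence of \<open>\<integral>\<^sub>0\<^sup>\<infinity> g\<close> and the bound \<open>C exp c / c\<close> for its norm.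
  For \<open>\<bar>r\<bar> \<le> (\<eta> - \<xi>) / 2\<close> the second-order Taylor estimate of \<open>exp\<close> bounds the integrand of
  (difference quotient minus derivative) by \<open>\<bar>r\<bar> C exp (-c s)\<close> with \<open>C\<close> and \<open>c = (\<eta> - \<xi>) / 4\<close>
  independent of \<open>r\<close>. Hence the error is at most \<open>\<bar>r\<bar>\<close> times a fixed random variable, which is
  convergence in the locally \<open>L\<^sup>0\<close>-convex topology.
\<close>

section \<open>The pseudometric of convergence in probability\<close>

text \<open>The bound on \<open>f s\<close> holds outside a null set that may depend on
  \<open>s\<close>, so the integrals cannot be computed path by path: only finitely many tags at a
  time can be handled almost surely, and every estimate has to be proved for Riemann sums before it
  is carried to limits. A second obstacle is that the locally \<open>L\<^sup>0\<close>-convex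
  topology is finer than convergence in probability, so that no limit theorem in probability gives
  the derivative by itself. An almost sure inequality with an explicit factor
  \<open>\<bar>r\<bar>\<close> does, because the radius that makes \<open>\<bar>r\<bar>\<close>
  times a fixed random variable small may itself be random. The common refinement of two partitions
  is not constructed: the contents of the intersections of their cells serve as weights of a double
  sum. The constant \<open>(\<eta> - \<xi>) / 4\<close> comes from a budget: of the decay rate
  \<open>\<eta> - \<xi>\<close>, one half is given up for the shift by \<open>r\<close>, one quarter
  pays for the power of \<open>s\<close> left by the kernel and the Taylor remainder, and one
  quarter remains to integrate.\<close>

lemma L0_le_class:
  assumes "f \<in> borel_measurable P" "g \<in> borel_measurable P"
  shows "L0_le P (L0_class P f) (L0_class P g) \<longleftrightarrow> (AE \<omega> in P. f \<omega> \<le> g \<omega>)"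
proof
  assume "L0_le P (L0_class P f) (L0_class P g)"
  moreover have "f \<in> L0_class P f" "g \<in> L0_class P g"
    using assms by (simp_all add: L0_mem_class)
  ultimately show "AE \<omega> in P. f \<omega> \<le> g \<omega>" unfolding L0_le_def by blast
next
  assume l: "AE \<omega> in P. f \<omega> \<le> g \<omega>"
  show "L0_le P (L0_class P f) (L0_class P g)" unfolding L0_le_def
  proof (intro ballI)
    fix f' g' assume "f' \<in> L0_class P f" "g' \<in> L0_class P g"
    then have "AE \<omega> in P. f \<omega> = f' \<omega>" "AE \<omega> in P. g \<omega> = g' \<omega>" by (auto simp: L0_mem_class)
    with l show "AE \<omega> in P. f' \<omega> \<le> g' \<omega>" by eventually_elim auto
  qed
qed

lemma L0_class_eq_iff:
  assumes "f \<in> borel_measurable P" "g \<in> borel_measurable P"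
  shows "L0_class P f = L0_class P g \<longleftrightarrow> (AE \<omega> in P. f \<omega> = g \<omega>)"
proof
  assume "L0_class P f = L0_class P g"
  moreover have "g \<in> L0_class P g" using assms by (simp add: L0_mem_class)
  ultimately have "g \<in> L0_class P f" by simp
  then show "AE \<omega> in P. f \<omega> = g \<omega>" by (simp add: L0_mem_class)
qed (rule L0_class_eq[OF assms])

lemma L0_minus_class:
  fixes f :: "'w \<Rightarrow> 'k::{real_normed_field,euclidean_space}"
  assumes "f \<in> borel_measurable P"
  shows "\<ominus>\<^bsub>L0 P\<^esub> L0_class P f = L0_class P (\<lambda>\<omega>. - f \<omega>)"
proof -
  interpret cring "L0 P :: ('w \<Rightarrow> 'k) set ring" by (rule cring_L0)
  have m: "(\<lambda>\<omega>. - f \<omega>) \<in> borel_measurable P" using assms by simp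
  show ?thesis
    by (rule minus_equality) (use assms m in \<open>auto simp: L0_class_in L0_add_class L0_zero_class\<close>)
qed

text \<open>On the null set where \<open>f\<close> vanishes, \<open>inverse\<close> takes the value
  0, which the class does not see; as inverses in a commutative ring are unique, this class is the
  one denoted by \<open>inv\<close>.\<close>

lemma L0_inv_class:
  fixes f :: "'w \<Rightarrow> 'k::{real_normed_field,euclidean_space}"
  assumes "f \<in> borel_measurable P" "(\<lambda>\<omega>. inverse (f \<omega>)) \<in> borel_measurable P" "AE \<omega> in P. f \<omega> \<noteq> 0"
  shows "inv\<^bsub>L0 P\<^esub> L0_class P f = L0_class P (\<lambda>\<omega>. inverse (f \<omega>))"
proof -
  interpret cring "L0 P :: ('w \<Rightarrow> 'k) set ring" by (rule cring_L0)
  have "L0_class P (\<lambda>\<omega>. f \<omega> * inverse (f \<omega>)) = L0_class P (\<lambda>_. 1 :: 'k)"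
    using assms by (intro L0_class_eq) auto
  then show ?thesis
    using assms by (intro comm_inv_char) (auto simp: L0_class_in L0_mult_class L0_one_class)
qed

context prob_space
begin

text \<open>\<open>pd (X - Y)\<close> metrizes convergence in probability.\<close>

definition pd :: "('a \<Rightarrow> real) \<Rightarrow> real" where
  "pd X = (\<integral>\<omega>. min 1 \<bar>X \<omega>\<bar> \<partial>M)"

lemma integrable_min_1: "X \<in> borel_measurable M \<Longrightarrow> integrable M (\<lambda>\<omega>. min 1 \<bar>X \<omega> :: real\<bar>)"
  by (rule integrable_const_bound[of _ 1]) auto

lemma pd_nonneg: "pd X \<ge> 0"
  unfolding pd_def by simp

lemma pd_mono:
  assumes "X \<in> borel_measurable M" "Y \<in> borel_measurable M" "AE \<omega> in M. \<bar>X \<omega>\<bar> \<le> \<bar>Y \<omega>\<bar>"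
  shows "pd X \<le> pd Y"
  unfolding pd_def
proof (intro integral_mono_AE integrable_min_1 assms)
  show "AE \<omega> in M. min 1 \<bar>X \<omega>\<bar> \<le> min 1 \<bar>Y \<omega>\<bar>"
    using assms(3) by eventually_elim auto
qed

lemma pd_triangle:
  assumes "X \<in> borel_measurable M" "Y \<in> borel_measurable M" "Z \<in> borel_measurable M"
    and "AE \<omega> in M. \<bar>X \<omega>\<bar> \<le> \<bar>Y \<omega>\<bar> + \<bar>Z \<omega>\<bar>"
  shows "pd X \<le> pd Y + pd Z"
proof -
  have "pd X \<le> (\<integral>\<omega>. min 1 \<bar>Y \<omega>\<bar> + min 1 \<bar>Z \<omega>\<bar> \<partial>M)"
    unfolding pd_def
  proof (intro integral_mono_AE Bochner_Integration.integrable_add integrable_min_1 assms)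
    show "AE \<omega> in M. min 1 \<bar>X \<omega>\<bar> \<le> min 1 \<bar>Y \<omega>\<bar> + min 1 \<bar>Z \<omega>\<bar>"
      using assms(4) by eventually_elim linarith
  qed
  also have "\<dots> = pd Y + pd Z"
    unfolding pd_def by (intro Bochner_Integration.integral_add integrable_min_1 assms)
  finally show ?thesis .
qed

lemma pd_eq_0:
  assumes "X \<in> borel_measurable M" "pd X = 0"
  shows "AE \<omega> in M. X \<omega> = 0"
proof -
  have "AE \<omega> in M. min 1 \<bar>X \<omega>\<bar> = 0"
    using integral_nonneg_eq_0_iff_AE[OF integrable_min_1[OF assms(1)]] assms(2)
    by (auto simp: pd_def)
  then show ?thesis by eventually_elim (auto simp: min_def split: if_splits)
qed

lemma pd_le_expectation:
  assumes "integrable M X" "AE \<omega> in M. 0 \<le> X \<omega>"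
  shows "pd X \<le> expectation X"
  unfolding pd_def
proof (intro integral_mono_AE integrable_min_1 assms)
  show "AE \<omega> in M. min 1 \<bar>X \<omega>\<bar> \<le> X \<omega>"
    using assms(2) by eventually_elim auto
qed (use assms in auto)

text \<open>Markov's inequality survives the truncation in \<open>pd\<close> for levels
  \<open>e \<le> 1\<close>: where \<open>e \<le> X \<omega>\<close>, also
  \<open>e \<le> min 1 \<bar>X \<omega>\<bar>\<close>. Together with \<open>pd_le_prob\<close> it
  identifies smallness of \<open>pd\<close> with smallness in probability.\<close>

lemma pd_Markov:
  assumes [measurable]: "X \<in> borel_measurable M" and "0 < e" "e \<le> 1"
  shows "e * prob {\<omega> \<in> space M. e \<le> X \<omega>} \<le> pd X"
proof -
  have "e * prob {\<omega> \<in> space M. e \<le> X \<omega>} = (\<integral>\<omega>. e * indicator {\<omega> \<in> space M. e \<le> X \<omega>} \<omega> \<partial>M)"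
    by simp
  also have "\<dots> \<le> pd X" unfolding pd_def
  proof (rule integral_mono)
    show "integrable M (\<lambda>\<omega>. e * indicator {\<omega> \<in> space M. e \<le> X \<omega>} \<omega>)"
      by (intro integrable_mult_right) (simp add: integrable_indicator_iff emeasure_finite less_top[symmetric])
  qed (use assms in \<open>auto intro!: integrable_min_1 simp: indicator_def\<close>)
  finally show ?thesis .
qed

text \<open>The truncated variable is below \<open>e\<close> off the event and at most 1 on
  it.\<close>

lemma pd_le_prob:
  assumes [measurable]: "X \<in> borel_measurable M" and "0 < e" "AE \<omega> in M. 0 \<le> X \<omega>"
  shows "pd X \<le> e + prob {\<omega> \<in> space M. e \<le> X \<omega>}"
proof -
  have i: "integrable M (\<lambda>\<omega>. e + indicator {\<omega> \<in> space M. e \<le> X \<omega>} \<omega>)"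
    by (intro Bochner_Integration.integrable_add) (auto simp: integrable_indicator_iff emeasure_finite less_top[symmetric])
  have "pd X \<le> (\<integral>\<omega>. e + indicator {\<omega> \<in> space M. e \<le> X \<omega>} \<omega> \<partial>M)"
    unfolding pd_def
  proof (rule integral_mono_AE[OF integrable_min_1 i])
    show "AE \<omega> in M. min 1 \<bar>X \<omega>\<bar> \<le> e + indicator {\<omega> \<in> space M. e \<le> X \<omega>} \<omega>"
      using assms(3) AE_space
      by eventually_elim (use \<open>0 < e\<close> in \<open>auto simp: indicator_def min_def\<close>)
  qed simp
  also have "\<dots> = e + prob {\<omega> \<in> space M. e \<le> X \<omega>}"
    by (subst Bochner_Integration.integral_add) (auto simp: integrable_indicator_iff emeasure_finite less_top[symmetric] prob_space)
  finally show ?thesis .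
qed

text \<open>A finite-valued random variable is tight: the events decrease to the empty set. Asking
  for \<open>c \<ge> 1\<close> prepares the truncation argument of
  \<open>pd_mult_small\<close>.\<close>

lemma pd_tail:
  fixes A :: "'a \<Rightarrow> real"
  assumes [measurable]: "A \<in> borel_measurable M" and "e > 0"
  obtains c where "c \<ge> 1" "prob {\<omega> \<in> space M. c \<le> \<bar>A \<omega>\<bar>} < e"
proof -
  have "(\<lambda>n. prob {\<omega> \<in> space M. real n \<le> \<bar>A \<omega>\<bar>}) \<longlonglongrightarrow> prob (\<Inter>n. {\<omega> \<in> space M. real n \<le> \<bar>A \<omega>\<bar>})"
    by (rule finite_Lim_measure_decseq) (auto simp: decseq_def)
  moreover have "(\<Inter>n. {\<omega> \<in> space M. real n \<le> \<bar>A \<omega>\<bar>}) = {}"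
  proof -
    have "\<exists>n. \<not> real n \<le> \<bar>A \<omega>\<bar>" for \<omega>
      using reals_Archimedean2[of "\<bar>A \<omega>\<bar>"] by (auto simp: not_le)
    then show ?thesis by blast
  qed
  ultimately have "(\<lambda>n. prob {\<omega> \<in> space M. real n \<le> \<bar>A \<omega>\<bar>}) \<longlonglongrightarrow> 0" by simp
  then have "eventually (\<lambda>n. prob {\<omega> \<in> space M. real n \<le> \<bar>A \<omega>\<bar>} < e) sequentially"
    using \<open>e > 0\<close> by (simp add: order_tendstoD(2))
  with eventually_ge_at_top[of "1::nat"]
  have "eventually (\<lambda>n. n \<ge> 1 \<and> prob {\<omega> \<in> space M. real n \<le> \<bar>A \<omega>\<bar>} < e) sequentially"
    by eventually_elim simp
  then obtain n where "n \<ge> 1" "prob {\<omega> \<in> space M. real n \<le> \<bar>A \<omega>\<bar>} < e"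
    by (auto simp: eventually_sequentially)
  then show ?thesis using that[of "real n"] by auto
qed

text \<open>Multiplication by an unbounded random factor is continuous in probability, and uniformly
  so: \<open>\<delta>\<close> is determined by \<open>A\<close> and \<open>e\<close> alone. Off the
  event \<open>c \<le> \<bar>A \<omega>\<bar>\<close> the factor acts like the constant
  \<open>c\<close>, and that event has small probability.\<close>

lemma pd_mult_small:
  fixes A :: "'a \<Rightarrow> real"
  assumes A[measurable]: "A \<in> borel_measurable M" and "e > 0"
  obtains \<delta> where "\<delta> > 0"
    "\<And>X Y. X \<in> borel_measurable M \<Longrightarrow> Y \<in> borel_measurable M \<Longrightarrow>
       AE \<omega> in M. \<bar>Y \<omega>\<bar> \<le> A \<omega> * \<bar>X \<omega>\<bar> \<Longrightarrow> pd X < \<delta> \<Longrightarrow> pd Y < e"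
proof -
  obtain c where c: "c \<ge> 1" "prob {\<omega> \<in> space M. c \<le> \<bar>A \<omega>\<bar>} < e / 2"
    using pd_tail[OF A, of "e/2"] \<open>e > 0\<close> by auto
  define I :: "'a \<Rightarrow> real" where "I = indicator {\<omega> \<in> space M. c \<le> \<bar>A \<omega>\<bar>}"
  have [measurable]: "I \<in> borel_measurable M" unfolding I_def by measurable
  have iI: "integrable M I" unfolding I_def
    by (auto simp: integrable_indicator_iff emeasure_finite less_top[symmetric])
  show ?thesis
  \<comment> \<open>One half of \<open>e\<close> is reserved for the event where \<open>A\<close> is
    large, the other for \<open>c * pd X\<close>.\<close>
  proof (rule that[of "e / (2 * c)"])
    show "e / (2 * c) > 0" using \<open>e > 0\<close> c by simp
    fix X Y assume m: "X \<in> borel_measurable M" "Y \<in> borel_measurable M"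
      and le: "AE \<omega> in M. \<bar>Y \<omega>\<bar> \<le> A \<omega> * \<bar>X \<omega>\<bar>" and X: "pd X < e / (2 * c)"
    have "pd Y \<le> (\<integral>\<omega>. c * min 1 \<bar>X \<omega>\<bar> + I \<omega> \<partial>M)" unfolding pd_def
    proof (rule integral_mono_AE)
      show "AE \<omega> in M. min 1 \<bar>Y \<omega>\<bar> \<le> c * min 1 \<bar>X \<omega>\<bar> + I \<omega>"
        using le AE_space
      proof eventually_elim
        case (elim \<omega>)
        show ?case
        proof (cases "c \<le> \<bar>A \<omega>\<bar>")
          case True
          then have "I \<omega> = 1" using elim by (simp add: I_def)
          moreover have "0 \<le> c * min 1 \<bar>X \<omega>\<bar>" using c by simp
          ultimately show ?thesis by linarith
        next
          case False
          then have "\<bar>Y \<omega>\<bar> \<le> c * \<bar>X \<omega>\<bar>"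
            using elim by (smt (verit) mult_right_mono)
          \<comment> \<open>Here \<open>c \<ge> 1\<close> matters: it lets the constant pass through
            the truncation.\<close>
          moreover have "min 1 (c * \<bar>X \<omega>\<bar>) \<le> c * min 1 \<bar>X \<omega>\<bar>"
            using c by (simp add: min_mult_distrib_left)
          moreover have "I \<omega> = 0" using False by (simp add: I_def)
          ultimately show ?thesis by linarith
        qed
      qed
    qed (use m iI in \<open>auto intro!: integrable_min_1 Bochner_Integration.integrable_add integrable_mult_right\<close>)
    also have "\<dots> = c * pd X + prob {\<omega> \<in> space M. c \<le> \<bar>A \<omega>\<bar>}"
      unfolding pd_def using integrable_min_1[OF m(1)] iI
      by (subst Bochner_Integration.integral_add) (auto simp: I_def)
    also have "c * pd X \<le> e / 2"
      using X c by (simp add: field_simps)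
    finally show "pd Y < e" using c by simp
  qed
qed

lemma tendsto_pd_mult:
  fixes A :: "'a \<Rightarrow> real" 
  assumes A: "A \<in> borel_measurable M"
    and "\<forall>\<^sub>F i in F. X i \<in> borel_measurable M \<and> Y i \<in> borel_measurable M \<and>
       (AE \<omega> in M. \<bar>Y i \<omega>\<bar> \<le> A \<omega> * \<bar>X i \<omega>\<bar>)"
    and X: "((\<lambda>i. pd (X i)) \<longlongrightarrow> 0) F"
  shows "((\<lambda>i. pd (Y i)) \<longlongrightarrow> 0) F"
proof (rule order_tendstoI)
  fix a :: real assume "a < 0" then show "\<forall>\<^sub>F i in F. a < pd (Y i)"
    by (intro always_eventually allI) (use pd_nonneg less_le_trans in blast)
next
  fix e :: real assume "0 < e"
  obtain \<delta> where \<delta>: "\<delta> > 0"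
    "\<And>X Y. X \<in> borel_measurable M \<Longrightarrow> Y \<in> borel_measurable M \<Longrightarrow>
       AE \<omega> in M. \<bar>Y \<omega>\<bar> \<le> A \<omega> * \<bar>X \<omega>\<bar> \<Longrightarrow> pd X < \<delta> \<Longrightarrow> pd Y < e"
    using pd_mult_small[OF A \<open>0 < e\<close>] by metis
  show "\<forall>\<^sub>F i in F. pd (Y i) < e"
    using order_tendstoD(2)[OF X \<delta>(1)] assms(2)
    by eventually_elim (use \<delta>(2) in auto)
qed

lemma tendsto_pd_const:
  assumes "(f \<longlongrightarrow> 0) F"
  shows "((\<lambda>i. pd (\<lambda>_. f i)) \<longlongrightarrow> 0) F"
proof -
  have "((\<lambda>i. min 1 \<bar>f i\<bar>) \<longlongrightarrow> min 1 \<bar>0\<bar>) F"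
    by (intro tendsto_intros assms)
  then show ?thesis by (simp add: pd_def prob_space)
qed

end

section \<open>Almost sure calculus with the \<open>L\<^sup>0\<close>-norm\<close>

context random_normed_module
begin

text \<open>A fixed representative of the \<open>L\<^sup>0\<close>-norm, so that estimates become almost sure inequalities of functions.\<close>

definition N :: "'s \<Rightarrow> 'w \<Rightarrow> real" where
  "N x = (SOME h. h \<in> nrm x)"

lemma
  assumes "x \<in> carrier S"
  shows N_measurable [measurable]: "N x \<in> borel_measurable P"
    and nrm_eq_class: "nrm x = L0_class P (N x)"
proof -
  obtain f where f: "f \<in> borel_measurable P" "nrm x = L0_class P f"
    using nrm_in_L0_plus[OF assms] by (auto simp: L0_plus_def elim: L0_class_rep)
  then have "f \<in> nrm x" by (simp add: L0_mem_class)
  then have "N x \<in> nrm x" unfolding N_def by (rule someI[of "\<lambda>h. h \<in> nrm x"])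
  then have *: "N x \<in> L0_class P f" using f by simp
  then show m: "N x \<in> borel_measurable P" by (simp add: L0_mem_class)
  show "nrm x = L0_class P (N x)"
    using * f m by (simp add: L0_class_eq_iff L0_mem_class)
qed

lemma N_nonneg: "x \<in> carrier S \<Longrightarrow> AE \<omega> in P. 0 \<le> N x \<omega>"
  using nrm_in_L0_plus[of x]
  by (simp add: L0_plus_def nrm_eq_class L0_zero_class L0_le_class)

lemma N_eq_zero:
  assumes "x \<in> carrier S" "AE \<omega> in P. N x \<omega> = 0"
  shows "x = \<zero>\<^bsub>S\<^esub>"
proof (rule nrm_eq_zero[OF assms(1)])
  show "nrm x = \<zero>\<^bsub>L0 P\<^esub>"
    using assms by (simp add: nrm_eq_class L0_zero_class L0_class_eq_iff)
qed

lemma N_smult: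
  fixes \<zeta> :: "'w \<Rightarrow> 'k"
  assumes "\<zeta> \<in> borel_measurable P" "x \<in> carrier S"
  shows "AE \<omega> in P. N (L0_class P \<zeta> \<odot>\<^bsub>S\<^esub> x) \<omega> = norm (\<zeta> \<omega>) * N x \<omega>"
proof -
  have c: "L0_class P \<zeta> \<odot>\<^bsub>S\<^esub> x \<in> carrier S"
    using assms by (simp add: L0_class_in)
  have "L0_class P (N (L0_class P \<zeta> \<odot>\<^bsub>S\<^esub> x)) = L0_class P (\<lambda>\<omega>. norm (\<zeta> \<omega>) * N x \<omega>)"
    using nrm_smult[OF L0_class_in[OF assms(1)] assms(2)] assms c
    by (simp add: nrm_eq_class L0_map_class L0_mult_class)
  then show ?thesis
    using assms c by (simp add: L0_class_eq_iff)
qed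

lemma N_add:
  assumes "x \<in> carrier S" "y \<in> carrier S"
  shows "AE \<omega> in P. N (x \<oplus>\<^bsub>S\<^esub> y) \<omega> \<le> N x \<omega> + N y \<omega>"
  using nrm_triangle[OF assms] assms
  by (simp add: nrm_eq_class L0_add_class L0_le_class)

lemma N_uminus:
  assumes "x \<in> carrier S"
  shows "AE \<omega> in P. N (\<ominus>\<^bsub>S\<^esub> x) \<omega> = N x \<omega>"
proof -
  have "\<ominus>\<^bsub>S\<^esub> x = (\<ominus>\<^bsub>L0 P\<^esub> \<one>\<^bsub>L0 P\<^esub>) \<odot>\<^bsub>S\<^esub> x"
    using assms by (simp add: smult_l_minus)
  then have "\<ominus>\<^bsub>S\<^esub> x = L0_class P (\<lambda>_. - 1) \<odot>\<^bsub>S\<^esub> x"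
    by (simp add: L0_one_class L0_minus_class)
  then show ?thesis using N_smult[of "\<lambda>_. - 1" x] assms by simp
qed

lemma N_diff_commute:
  assumes "x \<in> carrier S" "y \<in> carrier S"
  shows "AE \<omega> in P. N (x \<ominus>\<^bsub>S\<^esub> y) \<omega> = N (y \<ominus>\<^bsub>S\<^esub> x) \<omega>"
proof -
  have "\<ominus>\<^bsub>S\<^esub> (y \<ominus>\<^bsub>S\<^esub> x) = x \<ominus>\<^bsub>S\<^esub> y"
    using assms by (simp add: a_minus_def M.minus_add M.a_comm)
  then show ?thesis using N_uminus[of "y \<ominus>\<^bsub>S\<^esub> x"] assms by simp
qed

lemma diff_telescope:
  assumes "x \<in> carrier S" "y \<in> carrier S" "z \<in> carrier S"
  shows "(x \<ominus>\<^bsub>S\<^esub> y) \<oplus>\<^bsub>S\<^esub> (y \<ominus>\<^bsub>S\<^esub> z) = x \<ominus>\<^bsub>S\<^esub> z"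
proof -
  have "(x \<ominus>\<^bsub>S\<^esub> y) \<oplus>\<^bsub>S\<^esub> (y \<ominus>\<^bsub>S\<^esub> z) = x \<oplus>\<^bsub>S\<^esub> ((\<ominus>\<^bsub>S\<^esub> y \<oplus>\<^bsub>S\<^esub> y) \<oplus>\<^bsub>S\<^esub> \<ominus>\<^bsub>S\<^esub> z)"
    using assms by (simp only: a_minus_def M.a_assoc M.a_closed M.a_inv_closed)
  then show ?thesis using assms by (simp add: M.l_neg a_minus_def)
qed

lemma diff_add_cancel:
  assumes "x \<in> carrier S" "y \<in> carrier S"
  shows "(x \<ominus>\<^bsub>S\<^esub> y) \<oplus>\<^bsub>S\<^esub> y = x"
  using assms by (simp add: a_minus_def M.a_assoc M.l_neg)

lemma add_diff_cancel:
  assumes "x \<in> carrier S" "y \<in> carrier S"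
  shows "x \<oplus>\<^bsub>S\<^esub> (y \<ominus>\<^bsub>S\<^esub> x) = y"
  using diff_add_cancel[OF assms(2,1)] assms by (simp add: M.a_comm)

lemma N_diff_triangle:
  assumes "x \<in> carrier S" "y \<in> carrier S" "z \<in> carrier S"
  shows "AE \<omega> in P. N (x \<ominus>\<^bsub>S\<^esub> z) \<omega> \<le> N (x \<ominus>\<^bsub>S\<^esub> y) \<omega> + N (y \<ominus>\<^bsub>S\<^esub> z) \<omega>"
  using N_add[of "x \<ominus>\<^bsub>S\<^esub> y" "y \<ominus>\<^bsub>S\<^esub> z"] assms by (simp add: diff_telescope)

lemma N_diff:
  assumes "x \<in> carrier S" "y \<in> carrier S"
  shows "AE \<omega> in P. N (x \<ominus>\<^bsub>S\<^esub> y) \<omega> \<le> N x \<omega> + N y \<omega>"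
proof -
  have "AE \<omega> in P. N (x \<ominus>\<^bsub>S\<^esub> y) \<omega> \<le> N x \<omega> + N (\<ominus>\<^bsub>S\<^esub> y) \<omega>"
    using N_add[of x "\<ominus>\<^bsub>S\<^esub> y"] assms by (simp add: a_minus_def)
  with N_uminus[OF assms(2)] show ?thesis by eventually_elim simp
qed

text \<open>The axioms state the converse; this direction comes from homogeneity with the scalar
  0.\<close>

lemma N_zero: "AE \<omega> in P. N \<zero>\<^bsub>S\<^esub> \<omega> = 0"
  using N_smult[of "\<lambda>_. 0" "\<zero>\<^bsub>S\<^esub>"] by (simp add: L0_zero_class[symmetric])

lemma N_finsum:
  assumes "finite A" "f \<in> A \<rightarrow> carrier S"
  shows "AE \<omega> in P. N (finsum S f A) \<omega> \<le> (\<Sum>a\<in>A. N (f a) \<omega>)"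
  using assms
proof (induction A rule: finite_induct)
  case empty
  from N_zero show ?case by eventually_elim simp
next
  case (insert a A)
  then have f: "f a \<in> carrier S" "f \<in> A \<rightarrow> carrier S" by auto
  have "AE \<omega> in P. N (f a \<oplus>\<^bsub>S\<^esub> finsum S f A) \<omega> \<le> N (f a) \<omega> + N (finsum S f A) \<omega>"
    using f by (intro N_add) auto
  with insert.IH[OF f(2)] have "AE \<omega> in P. N (f a \<oplus>\<^bsub>S\<^esub> finsum S f A) \<omega> \<le> N (f a) \<omega> + (\<Sum>a\<in>A. N (f a) \<omega>)"
    by eventually_elim simp
  then show ?case using insert.hyps f by simp
qed

section \<open>The metric behind the (\<epsilon>,\<lambda>)-topology\<close>

definition pdist :: "'s \<Rightarrow> 's \<Rightarrow> real" where
  "pdist x y = pd (N (x \<ominus>\<^bsub>S\<^esub> y))"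

lemma pdist_nonneg: "pdist x y \<ge> 0"
  unfolding pdist_def by (rule pd_nonneg)

lemma pdist_commute:
  assumes "x \<in> carrier S" "y \<in> carrier S"
  shows "pdist x y = pdist y x"
  unfolding pdist_def pd_def
  using N_diff_commute[OF assms] assms by (intro integral_cong_AE) auto

lemma pd_N_triangle:
  assumes "x \<in> carrier S" "y \<in> carrier S" "z \<in> carrier S"
    and "AE \<omega> in P. N x \<omega> \<le> N y \<omega> + N z \<omega>"
  shows "pd (N x) \<le> pd (N y) + pd (N z)"
proof (rule pd_triangle)
  show "AE \<omega> in P. \<bar>N x \<omega>\<bar> \<le> \<bar>N y \<omega>\<bar> + \<bar>N z \<omega>\<bar>"
    using assms(4) N_nonneg[OF assms(1)] by eventually_elim auto
qed (use assms in auto)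

lemma pdist_triangle:
  assumes "x \<in> carrier S" "y \<in> carrier S" "z \<in> carrier S"
  shows "pdist x z \<le> pdist x y + pdist y z"
  unfolding pdist_def using N_diff_triangle[OF assms] assms by (intro pd_N_triangle) auto

lemma pdist_self:
  assumes "x \<in> carrier S"
  shows "pdist x x = 0"
proof -
  have "pd (N \<zero>\<^bsub>S\<^esub>) \<le> pd (\<lambda>_. 0)"
    using N_zero by (intro pd_mono) auto
  moreover have "x \<ominus>\<^bsub>S\<^esub> x = \<zero>\<^bsub>S\<^esub>"
    using assms by (simp add: a_minus_def M.r_neg)
  ultimately show ?thesis
    using pd_nonneg[of "N \<zero>\<^bsub>S\<^esub>"] by (simp add: pdist_def pd_def[of "\<lambda>_. 0"])
qed

lemma pdist_eq_0:
  assumes "x \<in> carrier S" "y \<in> carrier S" "pdist x y = 0"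
  shows "x = y"
proof -
  have "AE \<omega> in P. N (x \<ominus>\<^bsub>S\<^esub> y) \<omega> = 0"
    using assms by (intro pd_eq_0) (auto simp: pdist_def)
  then have "x \<ominus>\<^bsub>S\<^esub> y = \<zero>\<^bsub>S\<^esub>" using assms by (intro N_eq_zero) auto
  moreover have "(x \<ominus>\<^bsub>S\<^esub> y) \<oplus>\<^bsub>S\<^esub> y = x"
    using assms by (intro diff_add_cancel)
  ultimately show ?thesis using assms by simp
qed

text \<open>The neighbourhoods quantify over all representatives of the norm; these agree almost
  surely, so their events have the same probability and one representative decides.\<close>

lemma el_nbhd_iff:
  assumes "z \<in> carrier S"
  shows "z \<in> el_nbhd P S nrm \<epsilon> l \<longleftrightarrow> prob {\<omega> \<in> space P. N z \<omega> < \<epsilon>} > 1 - l"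
proof -
  have *: "prob {\<omega> \<in> space P. h \<omega> < \<epsilon>} = prob {\<omega> \<in> space P. N z \<omega> < \<epsilon>}" if "h \<in> nrm z" for h
  proof -
    have m: "N z \<in> borel_measurable P" "h \<in> borel_measurable P" "AE \<omega> in P. N z \<omega> = h \<omega>"
      using that assms by (auto simp: nrm_eq_class L0_mem_class)
    note m(1,2)[measurable]
    from m(3) have "AE \<omega> in P. (\<omega> \<in> {\<omega> \<in> space P. h \<omega> < \<epsilon>}) = (\<omega> \<in> {\<omega> \<in> space P. N z \<omega> < \<epsilon>})"
      by eventually_elim auto
    then show ?thesis by (rule finite_measure_eq_AE) measurable
  qed
  have "N z \<in> nrm z" using assms by (simp add: nrm_eq_class L0_mem_class)
  with assms show ?thesis
    unfolding el_nbhd_def mem_Collect_eq by (metis (no_types, lifting) *)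
qed

lemma openin_el_topology:
  "openin (el_topology P S nrm) U \<longleftrightarrow> U \<subseteq> carrier S \<and>
     (\<forall>x\<in>U. \<exists>\<epsilon>>0. \<exists>l\<in>{0<..<1}. \<forall>z\<in>el_nbhd P S nrm \<epsilon> l. x \<oplus>\<^bsub>S\<^esub> z \<in> U)"
  unfolding el_topology_def
  by (subst topology_inverse'[OF istopology_el])
    (use prob_space_axioms nrm_in_L0_plus in \<open>auto simp: L0_plus_def\<close>)

lemma prob_less_eq: 
  assumes "z \<in> carrier S"
  shows "prob {\<omega> \<in> space P. N z \<omega> < \<epsilon>} = 1 - prob {\<omega> \<in> space P. \<epsilon> \<le> N z \<omega>}"
proof -
  note N_measurable[OF assms, measurable]
  have "prob (space P - {\<omega> \<in> space P. \<epsilon> \<le> N z \<omega>}) = 1 - prob {\<omega> \<in> space P. \<epsilon> \<le> N z \<omega>}"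
    by (rule prob_compl) measurable
  moreover have "space P - {\<omega> \<in> space P. \<epsilon> \<le> N z \<omega>} = {\<omega> \<in> space P. N z \<omega> < \<epsilon>}" by auto
  ultimately show ?thesis by simp
qed

lemma openin_pdist_ball:
  assumes x: "x \<in> carrier S"
  shows "openin (el_topology P S nrm) {y \<in> carrier S. pdist y x < e}"
  unfolding openin_el_topology
proof (intro conjI ballI)
  fix y assume "y \<in> {y \<in> carrier S. pdist y x < e}"
  then have y: "y \<in> carrier S" "pdist y x < e" by auto
  \<comment> \<open>The same number serves as level and as probability, and
    \<open>pd_le_prob\<close> adds the two; hence half of the remaining distance. The cap
    \<open>1 / 2\<close> keeps it in the open unit interval.\<close>
  define l where "l = min ((e - pdist y x) / 2) (1 / 2)"
  have l: "l > 0" "l < 1" "2 * l \<le> e - pdist y x" using y by (auto simp: l_def min_def)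
  have "y \<oplus>\<^bsub>S\<^esub> z \<in> {y \<in> carrier S. pdist y x < e}" if "z \<in> el_nbhd P S nrm l l" for z
  proof -
    have z: "z \<in> carrier S" using that by (simp add: el_nbhd_def)
    have "prob {\<omega> \<in> space P. l \<le> N z \<omega>} < l"
      using that z by (simp add: el_nbhd_iff prob_less_eq)
    moreover have "pd (N z) \<le> l + prob {\<omega> \<in> space P. l \<le> N z \<omega>}"
      using z l by (intro pd_le_prob N_nonneg) auto
    ultimately have "pd (N z) < e - pdist y x" using l by simp
    moreover have "pdist (y \<oplus>\<^bsub>S\<^esub> z) x \<le> pdist y x + pd (N z)"
    proof -
      have "(y \<oplus>\<^bsub>S\<^esub> z) \<ominus>\<^bsub>S\<^esub> x = (y \<ominus>\<^bsub>S\<^esub> x) \<oplus>\<^bsub>S\<^esub> z"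
        using x y z by (simp add: a_minus_def M.a_ac)
      then show ?thesis
        unfolding pdist_def using N_add[of "y \<ominus>\<^bsub>S\<^esub> x" z] x y z by (intro pd_N_triangle) auto
    qed
    ultimately show ?thesis using y z by simp
  qed
  then show "\<exists>\<epsilon>>0. \<exists>l\<in>{0<..<1}. \<forall>z\<in>el_nbhd P S nrm \<epsilon> l. y \<oplus>\<^bsub>S\<^esub> z \<in> {y \<in> carrier S. pdist y x < e}"
    using l by (intro exI[of _ l] conjI bexI[of _ l]) auto
qed auto

text \<open>Markov's inequality at the level \<open>min \<epsilon> 1\<close>, the cap being forced
  by the truncation in \<open>pd\<close>. This is the half of the comparison that puts a metric ball
  inside a given neighbourhood.\<close>

lemma pd_N_el_nbhd:
  assumes "z \<in> carrier S" "0 < \<epsilon>" "pd (N z) < min \<epsilon> 1 * l"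
  shows "z \<in> el_nbhd P S nrm \<epsilon> l"
proof -
  define e where "e = min \<epsilon> 1"
  have e: "0 < e" "e \<le> 1" "e \<le> \<epsilon>" using assms by (auto simp: e_def)
  note N_measurable[OF assms(1), measurable]
  have "e * prob {\<omega> \<in> space P. e \<le> N z \<omega>} < e * l"
    using pd_Markov[OF N_measurable[OF assms(1)] e(1,2)] assms(3) by (simp add: e_def)
  then have "prob {\<omega> \<in> space P. N z \<omega> < e} > 1 - l"
    using e assms(1) by (simp add: prob_less_eq)
  also have "prob {\<omega> \<in> space P. N z \<omega> < e} \<le> prob {\<omega> \<in> space P. N z \<omega> < \<epsilon>}"
    using e by (intro finite_measure_mono) auto
  finally show ?thesis using assms(1) by (simp add: el_nbhd_iff)
qed

lemma topspace_el: "topspace (el_topology P S nrm) = carrier S"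
proof
  have "openin (el_topology P S nrm) (carrier S)"
    unfolding openin_el_topology
    by (intro conjI ballI exI[of _ "1::real"] bexI[of _ "1/2::real"]) (auto simp: el_nbhd_def)
  then show "carrier S \<subseteq> topspace (el_topology P S nrm)" by (rule openin_subset)
  show "topspace (el_topology P S nrm) \<subseteq> carrier S"
    unfolding topspace_def by (auto simp: openin_el_topology)
qed

text \<open>Metric balls are open by \<open>openin_pdist_ball\<close>, and every neighbourhood
  contains one by \<open>pd_N_el_nbhd\<close>. From here on, statements about the
  (\<epsilon>,\<lambda>)-topology become limits of real numbers, along arbitrary filters.\<close>

lemma limitin_el_iff:
  "limitin (el_topology P S nrm) X x F \<longleftrightarrow>
     x \<in> carrier S \<and> (\<forall>\<^sub>F i in F. X i \<in> carrier S) \<and> ((\<lambda>i. pdist (X i) x) \<longlongrightarrow> 0) F"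
proof (intro iffI conjI)
  assume *: "limitin (el_topology P S nrm) X x F"
  then show x: "x \<in> carrier S" by (simp add: limitin_def topspace_el)
  show "\<forall>\<^sub>F i in F. X i \<in> carrier S"
    using limitinD[OF *, of "carrier S"] x openin_topspace[of "el_topology P S nrm"] by (simp add: topspace_el)
  show "((\<lambda>i. pdist (X i) x) \<longlongrightarrow> 0) F"
  proof (rule order_tendstoI)
    fix e :: real assume "0 < e"
    then have "\<forall>\<^sub>F i in F. X i \<in> {y \<in> carrier S. pdist y x < e}"
      using x by (intro limitinD[OF *] openin_pdist_ball) (auto simp: pdist_self)
    then show "\<forall>\<^sub>F i in F. pdist (X i) x < e" by eventually_elim simp
  next
    fix a :: real assume "a < 0"
    then show "\<forall>\<^sub>F i in F. a < pdist (X i) x"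
      by (intro always_eventually allI) (use pdist_nonneg less_le_trans in blast)
  qed
next
  assume *: "x \<in> carrier S \<and> (\<forall>\<^sub>F i in F. X i \<in> carrier S) \<and> ((\<lambda>i. pdist (X i) x) \<longlongrightarrow> 0) F"
  then have x: "x \<in> carrier S" and ev: "\<forall>\<^sub>F i in F. X i \<in> carrier S"
    and lim: "((\<lambda>i. pdist (X i) x) \<longlongrightarrow> 0) F" by auto
  show "limitin (el_topology P S nrm) X x F" unfolding limitin_def
  proof (intro conjI allI impI)
    show "x \<in> topspace (el_topology P S nrm)" using x by (simp add: topspace_el)
    fix U assume U: "openin (el_topology P S nrm) U \<and> x \<in> U"
    then obtain \<epsilon> l where \<epsilon>: "\<epsilon> > 0" "0 < l" "\<And>z. z \<in> el_nbhd P S nrm \<epsilon> l \<Longrightarrow> x \<oplus>\<^bsub>S\<^esub> z \<in> U"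
      unfolding openin_el_topology by fastforce
    have "\<forall>\<^sub>F i in F. pdist (X i) x < min \<epsilon> 1 * l"
      using \<epsilon> by (intro order_tendstoD(2)[OF lim]) auto
    with ev show "\<forall>\<^sub>F i in F. X i \<in> U"
    proof eventually_elim
      case (elim i)
      have "x \<oplus>\<^bsub>S\<^esub> (X i \<ominus>\<^bsub>S\<^esub> x) = X i"
        using elim x by (intro add_diff_cancel) auto
      with \<epsilon>(3)[of "X i \<ominus>\<^bsub>S\<^esub> x"] pd_N_el_nbhd[of "X i \<ominus>\<^bsub>S\<^esub> x" \<epsilon> l] elim x \<epsilon>(1)
      show ?case by (simp add: pdist_def)
    qed
  qed
qed

lemma el_complete_pdist:
  assumes "el_complete P S nrm" "\<And>n. X n \<in> carrier S"
    and C: "\<And>e. e > 0 \<Longrightarrow> \<exists>n0. \<forall>m\<ge>n0. \<forall>n\<ge>n0. pdist (X m) (X n) < e"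
  obtains x where "x \<in> carrier S" "(\<lambda>n. pdist (X n) x) \<longlonglongrightarrow> 0"
proof -
  have "\<exists>n0. \<forall>m\<ge>n0. \<forall>n\<ge>n0. X m \<ominus>\<^bsub>S\<^esub> X n \<in> el_nbhd P S nrm \<epsilon> l" if "\<epsilon> > 0" "l \<in> {0<..<1}" for \<epsilon> l :: real
  proof -
    obtain n0 where "\<forall>m\<ge>n0. \<forall>n\<ge>n0. pdist (X m) (X n) < min \<epsilon> 1 * l"
      using C[of "min \<epsilon> 1 * l"] \<open>\<epsilon> > 0\<close> \<open>l \<in> {0<..<1}\<close> by auto
    then show ?thesis
      using assms(2) \<open>\<epsilon> > 0\<close> by (auto simp: pdist_def intro!: exI[of _ n0] pd_N_el_nbhd)
  qed
  then obtain x where "limitin (el_topology P S nrm) X x sequentially"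
    using assms(1,2) unfolding el_complete_def by blast
  then show ?thesis using that[of x] by (simp add: limitin_el_iff)
qed

lemma tendsto_unique_pdist:
  assumes "F \<noteq> bot" "\<forall>\<^sub>F i in F. X i \<in> carrier S" "x \<in> carrier S" "y \<in> carrier S"
    and "((\<lambda>i. pdist (X i) x) \<longlongrightarrow> 0) F" "((\<lambda>i. pdist (X i) y) \<longlongrightarrow> 0) F"
  shows "x = y"
proof (rule pdist_eq_0[OF assms(3,4)])
  have "((\<lambda>i. pdist (X i) x + pdist (X i) y) \<longlongrightarrow> 0) F"
    using tendsto_add[OF assms(5,6)] by simp
  moreover have "\<forall>\<^sub>F i in F. pdist x y \<le> pdist (X i) x + pdist (X i) y"
    using assms(2)
  proof eventually_elim
    case (elim i)
    then show ?case
      using pdist_triangle[of x "X i" y] pdist_commute[of x "X i"] assms(3,4) by simp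
  qed
  ultimately have "pdist x y \<le> 0"
    by (rule tendsto_lowerbound[OF _ _ assms(1)])
  then show "pdist x y = 0" using pdist_nonneg[of x y] by simp
qed

text \<open>Almost sure bounds pass to limits in probability along any nontrivial filter, without
  extracting an almost surely convergent subsequence: the excess \<open>Z\<close> of
  \<open>N x\<close> over \<open>Y\<close> is dominated by the norm of
  \<open>X i \<ominus> x\<close>, so its \<open>pd\<close> is 0.\<close>

lemma N_le_limit:
  assumes "F \<noteq> bot" "x \<in> carrier S" "((\<lambda>i. pdist (X i) x) \<longlongrightarrow> 0) F"
    and Y[measurable]: "Y \<in> borel_measurable P"
    and le: "\<forall>\<^sub>F i in F. X i \<in> carrier S \<and> (AE \<omega> in P. N (X i) \<omega> \<le> Y \<omega>)"
  shows "AE \<omega> in P. N x \<omega> \<le> Y \<omega>"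
proof -
  note N_measurable[OF assms(2), measurable]
  define Z where "Z \<omega> = max 0 (N x \<omega> - Y \<omega>)" for \<omega>
  have Z[measurable]: "Z \<in> borel_measurable P" unfolding Z_def by measurable
  have "\<forall>\<^sub>F i in F. pd Z \<le> pdist (X i) x"
    using le
  proof eventually_elim
    case (elim i)
    then have Xi: "X i \<in> carrier S" and l: "AE \<omega> in P. N (X i) \<omega> \<le> Y \<omega>" by auto
    have "AE \<omega> in P. N (X i \<oplus>\<^bsub>S\<^esub> (x \<ominus>\<^bsub>S\<^esub> X i)) \<omega> \<le> N (X i) \<omega> + N (x \<ominus>\<^bsub>S\<^esub> X i) \<omega>"
      using Xi assms(2) by (intro N_add) auto
    moreover have "X i \<oplus>\<^bsub>S\<^esub> (x \<ominus>\<^bsub>S\<^esub> X i) = x"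
      using Xi assms(2) by (intro add_diff_cancel)
    ultimately have "AE \<omega> in P. N x \<omega> \<le> N (X i) \<omega> + N (x \<ominus>\<^bsub>S\<^esub> X i) \<omega>" by simp
    with l N_diff_commute[OF Xi assms(2)] N_nonneg[of "x \<ominus>\<^bsub>S\<^esub> X i"]
    have "AE \<omega> in P. \<bar>Z \<omega>\<bar> \<le> \<bar>N (X i \<ominus>\<^bsub>S\<^esub> x) \<omega>\<bar>"
      using Xi assms(2) by (auto simp: Z_def elim!: eventually_elim2)
    then show ?case unfolding pdist_def
      using Xi assms(2) by (intro pd_mono) auto
  qed
  then have "pd Z \<le> 0" by (rule tendsto_lowerbound[OF assms(3) _ assms(1)])
  then have "AE \<omega> in P. Z \<omega> = 0"
    using pd_nonneg[of Z] by (intro pd_eq_0) auto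
  then show ?thesis by eventually_elim (auto simp: Z_def max_def split: if_splits)
qed

end

section \<open>Riemann sums\<close>

text \<open>The integral of the indicator of \<open>J\<close> is additive over the division
  \<open>q\<close>. This is what allows the sets \<open>J \<inter> K\<close> to act as cells of a
  common refinement.\<close>

lemma content_eq_sum_Int:
  fixes a b :: real
  assumes q: "q tagged_division_of {a..b}" and J: "J = {c..d}" "J \<subseteq> {a..b}"
  shows "measure lborel J = (\<Sum>(y, K)\<in>q. measure lborel (J \<inter> K))"
proof -
  have int: "integral {u..v} (indicat_real J) = measure lborel (J \<inter> {u..v})" for u v
  proof -
    have "integral {u..v} (indicat_real J) = integral {u..v} (\<lambda>x. if x \<in> J then 1 else 0)"
      by (rule integral_cong) (simp add: indicator_def)
    also have "\<dots> = integral (J \<inter> {u..v}) (\<lambda>_. 1)"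
      by (rule Henstock_Kurzweil_Integration.integral_restrict_Int)
    also have "J \<inter> {u..v} = {max u c..min v d}" using J by auto
    also have "integral \<dots> (\<lambda>_. 1 :: real) = measure lborel {max u c..min v d}" by simp
    also have "{max u c..min v d} = J \<inter> {u..v}" using J by auto
    finally show ?thesis .
  qed
  have "indicat_real J integrable_on cbox a b"
    unfolding J(1)
    by (rule integrable_on_indicator[THEN iffD2]) auto
  with q have "integral {a..b} (indicat_real J) = (\<Sum>(y, K)\<in>q. integral K (indicat_real J))"
    using integral_combine_tagged_division_topdown[of "indicat_real J" a b q] by simp
  also have "\<dots> = (\<Sum>(y, K)\<in>q. measure lborel (J \<inter> K))"
  proof (intro sum.cong refl, clarsimp)
    fix y K assume "(y, K) \<in> q"
    then obtain u v where "K = {u..v}" using tagged_division_ofD(4)[OF q] by fastforce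
    then show "integral K (indicat_real J) = measure lborel (J \<inter> K)" by (simp add: int)
  qed
  finally show ?thesis unfolding int[of a b] Int_absorb2[OF J(2)] .
qed

lemma sum_content_tagged_division:
  fixes a b :: real
  assumes "p tagged_division_of {a..b}" "a \<le> b"
  shows "(\<Sum>(x, J)\<in>p. measure lborel J) = b - a"
proof -
  have "measure lborel {a..b} = (\<Sum>(x, J)\<in>p. measure lborel ({a..b} \<inter> J))"
    by (rule content_eq_sum_Int[OF assms(1)]) auto
  also have "\<dots> = (\<Sum>(x, J)\<in>p. measure lborel J)"
    using tagged_division_ofD(3)[OF assms(1)] by (intro sum.cong) (auto simp: Int_absorb1)
  finally show ?thesis using assms(2) by simp
qed

text \<open>Cell by cell comparison with the integral: a point \<open>t\<close> of a cell lies less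
  than 1 away from the tag \<open>x\<close>, so
  \<open>exp (- (c * x)) \<le> exp c * exp (- (c * t))\<close>. The mesh is independent of
  \<open>c\<close> on purpose: \<open>c\<close> will be random, while a partition cannot depend on
  \<open>\<omega>\<close>. The factor \<open>exp c\<close> is the price.\<close>

lemma exp_riemann_sum_le:
  fixes a b c :: real
  assumes p: "p tagged_division_of {a..b}" "(\<lambda>x. ball x 1) fine p" and "a \<le> b" "0 < c"
  shows "(\<Sum>(x, J)\<in>p. measure lborel J * exp (- (c * x))) \<le> exp c / c * exp (- (c * a))"
proof -
  have I: "((\<lambda>t. exp (- (c * t))) has_integral exp (- (c * u)) / c - exp (- (c * v)) / c) {u..v}"
    if "u \<le> v" for u v
  proof -
    have "((\<lambda>t. exp (- (c * t))) has_integral - exp (- (c * v)) / c - - exp (- (c * u)) / c) {u..v}"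
      using that \<open>0 < c\<close>
      by (intro fundamental_theorem_of_calculus)
        (auto intro!: derivative_eq_intros simp flip: has_real_derivative_iff_has_vector_derivative)
    then show ?thesis by simp
  qed
  have "(\<Sum>(x, J)\<in>p. measure lborel J * exp (- (c * x)))
      \<le> (\<Sum>(x, J)\<in>p. exp c * integral J (\<lambda>t. exp (- (c * t))))"
  proof (intro sum_mono, clarsimp)
    fix x J assume xJ: "(x, J) \<in> p"
    then obtain u v where J: "J = {u..v}" using tagged_division_ofD(4)[OF p(1)] by fastforce
    have "x \<in> J" using tagged_division_ofD(2)[OF p(1) xJ] .
    then have uv: "u \<le> v" using J by auto
    have "J \<subseteq> ball x 1" using p(2) xJ by auto
    have "measure lborel J * exp (- (c * x)) = integral J (\<lambda>_. exp (- (c * x)))"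
      by (simp add: J)
    also have "\<dots> \<le> integral J (\<lambda>t. exp c * exp (- (c * t)))"
    proof (rule integral_le)
      show "(\<lambda>_. exp (- (c * x))) integrable_on J" by (simp add: J integrable_const_ivl)
      show "(\<lambda>t. exp c * exp (- (c * t))) integrable_on J"
        unfolding J using I[OF uv] by (intro integrable_on_mult_right) auto
      fix t assume "t \<in> J"
      then have "t - x \<le> 1" using \<open>J \<subseteq> ball x 1\<close> by (auto simp: dist_real_def)
      then have "c * (t - x) \<le> c * 1" using \<open>0 < c\<close> by (intro mult_left_mono) auto
      then show "exp (- (c * x)) \<le> exp c * exp (- (c * t))"
        by (simp flip: exp_add add: algebra_simps)
    qed
    also have "\<dots> = exp c * integral J (\<lambda>t. exp (- (c * t)))" by simp
    finally show "measure lborel J * exp (- (c * x)) \<le> exp c * integral J (\<lambda>t. exp (- (c * t)))" .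
  qed
  also have "\<dots> = exp c * (\<Sum>(x, J)\<in>p. integral J (\<lambda>t. exp (- (c * t))))"
    by (simp add: sum_distrib_left case_prod_unfold)
  also have "(\<Sum>(x, J)\<in>p. integral J (\<lambda>t. exp (- (c * t)))) = integral {a..b} (\<lambda>t. exp (- (c * t)))"
    using integral_combine_tagged_division_topdown[of "\<lambda>t. exp (- (c * t))" a b p] p I[OF \<open>a \<le> b\<close>]
    by auto
  also have "\<dots> = exp (- (c * a)) / c - exp (- (c * b)) / c"
    using I[OF \<open>a \<le> b\<close>] by (rule integral_unique)
  also have "exp c * \<dots> \<le> exp c * (exp (- (c * a)) / c)"
    using \<open>0 < c\<close> by (intro mult_left_mono) auto
  finally show ?thesis by simp
qed

lemma fine_ball_mono:
  assumes "(\<lambda>x. ball x d) fine p" "d \<le> e"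
  shows "(\<lambda>x. ball x e) fine p"
  using assms unfolding fine_def by (fastforce simp: subset_iff)

lemma fine_division_sequence:
  obtains p where "\<And>n :: nat. p n tagged_division_of {a..b::real}"
    "\<And>n. (\<lambda>x. ball x (1 / real (Suc n))) fine p n"
proof -
  have "\<exists>q. q tagged_division_of {a..b} \<and> (\<lambda>x. ball x (1 / real (Suc n))) fine q" for n
    by (rule fine_division_exists_real[OF gauge_ball]) auto
  then show ?thesis using that by metis
qed

text \<open>The sets generating the filter are directed, since mesh \<open>min d e\<close> refines
  both meshes; so a single \<open>d\<close> describes each event.\<close>

lemma eventually_riemann_filter:
  "eventually Q (riemann_filter a b) \<longleftrightarrow>
     (\<exists>d>0. \<forall>p. p tagged_division_of {a..b} \<longrightarrow> (\<lambda>x. ball x d) fine p \<longrightarrow> Q p)"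
proof -
  have "\<exists>x\<in>{0<..}. principal {p. p tagged_division_of {a..b} \<and> (\<lambda>y. ball y x) fine p}
      \<le> inf (principal {p. p tagged_division_of {a..b} \<and> (\<lambda>x. ball x d) fine p})
        (principal {p. p tagged_division_of {a..b} \<and> (\<lambda>x. ball x e) fine p})"
    if "d \<in> {0<..}" "e \<in> {0<..}" for d e :: real
  proof (rule bexI[of _ "min d e"])
    have "(\<lambda>x. ball x d) fine p" "(\<lambda>x. ball x e) fine p" if "(\<lambda>x. ball x (min d e)) fine p"
      for p :: "(real \<times> real set) set"
      using that unfolding fine_def by (fastforce simp: subset_iff)+
    then show "principal {p. p tagged_division_of {a..b} \<and> (\<lambda>y. ball y (min d e)) fine p}
      \<le> inf (principal {p. p tagged_division_of {a..b} \<and> (\<lambda>x. ball x d) fine p})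
        (principal {p. p tagged_division_of {a..b} \<and> (\<lambda>x. ball x e) fine p})"
      by auto
  qed (use that in auto)
  then show ?thesis
    unfolding riemann_filter_def
    by (subst eventually_INF_base) (auto simp: eventually_principal intro: exI[of _ "1::real"])
qed

text \<open>Cousin's lemma: fine tagged divisions exist for every mesh. Uniqueness of the integral
  and the passage of bounds to the limit rest on this.\<close>

lemma riemann_filter_nontrivial: "riemann_filter a b \<noteq> bot"
proof -
  have "\<exists>p. p tagged_division_of {a..b} \<and> (\<lambda>x. ball x d) fine p" if "d > 0" for d
    by (rule fine_division_exists_real[OF gauge_ball[OF that]]) blast
  then show ?thesis
    unfolding trivial_limit_def eventually_riemann_filter by blast
qed

section \<open>Comparing two Riemann sums with values in the module\<close>

context random_normed_module
begin

lemma smult_class_closed [simp]: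
  "(\<zeta> :: 'w \<Rightarrow> 'k) \<in> borel_measurable P \<Longrightarrow> x \<in> carrier S \<Longrightarrow> L0_class P \<zeta> \<odot>\<^bsub>S\<^esub> x \<in> carrier S"
  by (simp add: L0_class_in)

lemma smult_sum_class:
  fixes c :: "'i \<Rightarrow> real"
  assumes "finite A" "v \<in> carrier S"
  shows "L0_class P (\<lambda>_. of_real (sum c A)) \<odot>\<^bsub>S\<^esub> v
    = finsum S (\<lambda>i. L0_class P (\<lambda>_. of_real (c i)) \<odot>\<^bsub>S\<^esub> v) A"
  using assms(1)
proof (induction A rule: finite_induct)
  case empty
  then show ?case using assms(2) by (simp add: L0_zero_class[symmetric])
next
  case (insert i A)
  have "L0_class P (\<lambda>_. of_real (sum c (insert i A)))
      = L0_class P (\<lambda>_. of_real (c i) :: 'k) \<oplus>\<^bsub>L0 P\<^esub> L0_class P (\<lambda>_. of_real (sum c A))"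
    using insert.hyps by (simp add: L0_add_class)
  with insert assms(2) show ?case
    by (simp add: smult_l_distr L0_class_in)
qed

lemma finsum_swap:
  assumes "finite A" "finite B" "\<And>i j. i \<in> A \<Longrightarrow> j \<in> B \<Longrightarrow> f i j \<in> carrier S"
  shows "finsum S (\<lambda>i. finsum S (f i) B) A = finsum S (\<lambda>j. finsum S (\<lambda>i. f i j) A) B"
  using assms(1,3)
proof (induction A rule: finite_induct)
  case empty
  then show ?case by simp
next
  case (insert i A)
  have "finsum S (\<lambda>i. finsum S (f i) B) (insert i A)
      = finsum S (f i) B \<oplus>\<^bsub>S\<^esub> finsum S (\<lambda>j. finsum S (\<lambda>i. f i j) A) B"
    using insert by (subst M.finsum_insert) (auto simp: Pi_def)
  also have "\<dots> = finsum S (\<lambda>j. f i j \<oplus>\<^bsub>S\<^esub> finsum S (\<lambda>i. f i j) A) B"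
    using insert.prems by (subst M.finsum_addf) (auto simp: Pi_def)
  also have "\<dots> = finsum S (\<lambda>j. finsum S (\<lambda>i. f i j) (insert i A)) B"
    using insert by (intro M.finsum_cong') (auto simp: Pi_def)
  finally show ?case .
qed

lemma add_diff_cancel_right:
  assumes "x \<in> carrier S" "y \<in> carrier S"
  shows "(x \<oplus>\<^bsub>S\<^esub> y) \<ominus>\<^bsub>S\<^esub> y = x"
  using assms by (simp add: a_minus_def M.a_assoc M.r_neg)

lemma finsum_diff:
  assumes "f \<in> A \<rightarrow> carrier S" "g \<in> A \<rightarrow> carrier S"
  shows "finsum S f A \<ominus>\<^bsub>S\<^esub> finsum S g A = finsum S (\<lambda>i. f i \<ominus>\<^bsub>S\<^esub> g i) A"
proof -
  have "finsum S (\<lambda>i. f i \<ominus>\<^bsub>S\<^esub> g i) A \<oplus>\<^bsub>S\<^esub> finsum S g A = finsum S (\<lambda>i. (f i \<ominus>\<^bsub>S\<^esub> g i) \<oplus>\<^bsub>S\<^esub> g i) A"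
    using assms by (subst M.finsum_addf) auto
  also have "\<dots> = finsum S f A"
    using assms by (intro M.finsum_cong') (auto intro!: diff_add_cancel)
  finally have "finsum S f A \<ominus>\<^bsub>S\<^esub> finsum S g A
      = (finsum S (\<lambda>i. f i \<ominus>\<^bsub>S\<^esub> g i) A \<oplus>\<^bsub>S\<^esub> finsum S g A) \<ominus>\<^bsub>S\<^esub> finsum S g A"
    by simp
  also have "\<dots> = finsum S (\<lambda>i. f i \<ominus>\<^bsub>S\<^esub> g i) A"
    by (rule add_diff_cancel_right) (use assms in \<open>auto intro!: M.finsum_closed\<close>)
  finally show ?thesis .
qed

lemma smult_diff:
  assumes "a \<in> carrier (L0 P)" "x \<in> carrier S" "y \<in> carrier S"
  shows "a \<odot>\<^bsub>S\<^esub> x \<ominus>\<^bsub>S\<^esub> a \<odot>\<^bsub>S\<^esub> y = a \<odot>\<^bsub>S\<^esub> (x \<ominus>\<^bsub>S\<^esub> y)"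
  using assms by (simp add: a_minus_def smult_r_distr smult_r_minus)

abbreviation "R \<equiv> riemann_sum P S"

lemma riemann_term_closed:
  assumes "p tagged_division_of {a..b}" "g \<in> {a..b} \<rightarrow> carrier S"
  shows "(\<lambda>(x, J). L0_class P (\<lambda>_. of_real (measure lborel J)) \<odot>\<^bsub>S\<^esub> g x) \<in> p \<rightarrow> carrier S"
proof clarify
  fix x J assume "(x, J) \<in> p"
  then have "x \<in> {a..b}" using tagged_division_ofD(2,3)[OF assms(1)] by blast
  then have "g x \<in> carrier S" using assms(2) by blast
  then show "L0_class P (\<lambda>_. of_real (measure lborel J)) \<odot>\<^bsub>S\<^esub> g x \<in> carrier S"
    by simp
qed

lemma riemann_sum_closed:
  assumes "p tagged_division_of {a..b}" "g \<in> {a..b} \<rightarrow> carrier S"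
  shows "R g p \<in> carrier S"
  unfolding riemann_sum_def using riemann_term_closed[OF assms] by (rule M.finsum_closed)

text \<open>Each weight is spread over the cells of \<open>q\<close>, the value at the tag of
  \<open>p\<close> being kept. Empty or degenerate intersections carry weight 0, so the double sum
  plays the part of the common refinement without needing new tags.\<close>

lemma riemann_sum_refine:
  assumes p: "p tagged_division_of {a..b}" and q: "q tagged_division_of {a..b}"
    and g: "g \<in> {a..b} \<rightarrow> carrier S"
  shows "R g p = finsum S (\<lambda>(x, J). finsum S (\<lambda>(y, K).
           L0_class P (\<lambda>_. of_real (measure lborel (J \<inter> K))) \<odot>\<^bsub>S\<^esub> g x) q) p"
  unfolding riemann_sum_def
proof (rule M.finsum_cong')
  show "(\<lambda>(x, J). finsum S (\<lambda>(y, K).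
           L0_class P (\<lambda>_. of_real (measure lborel (J \<inter> K))) \<odot>\<^bsub>S\<^esub> g x) q) \<in> p \<rightarrow> carrier S"
  proof clarify
    fix x J assume "(x, J) \<in> p"
    then have "g x \<in> carrier S" using tagged_division_ofD(2,3)[OF p] g by blast
    then show "finsum S (\<lambda>(y, K).
           L0_class P (\<lambda>_. of_real (measure lborel (J \<inter> K))) \<odot>\<^bsub>S\<^esub> g x) q \<in> carrier S"
      by (intro M.finsum_closed) auto
  qed
  fix i assume i: "i \<in> p"
  obtain x J where xJ: "i = (x, J)" by (cases i)
  have "g x \<in> carrier S" using tagged_division_ofD(2,3)[OF p, of x J] i g xJ by blast
  moreover obtain u v where "J = {u..v}" using tagged_division_ofD(4)[OF p, of x J] i xJ by fastforce
  then have "measure lborel J = (\<Sum>(y, K)\<in>q. measure lborel (J \<inter> K))"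
    using tagged_division_ofD(3)[OF p, of x J] i xJ by (intro content_eq_sum_Int[OF q]) auto
  ultimately show "(case i of (x, J) \<Rightarrow> L0_class P (\<lambda>_. of_real (measure lborel J)) \<odot>\<^bsub>S\<^esub> g x) =
      (case i of (x, J) \<Rightarrow> finsum S (\<lambda>(y, K).
           L0_class P (\<lambda>_. of_real (measure lborel (J \<inter> K))) \<odot>\<^bsub>S\<^esub> g x) q)"
    using smult_sum_class[of q "g x" "\<lambda>(y, K). measure lborel (J \<inter> K)"] tagged_division_ofD(1)[OF q]
    by (simp add: xJ case_prod_unfold)
qed simp

text \<open>Over the pairs of cells both sums carry the same deterministic weights, so they can be
  subtracted term by term and all randomness sits in the norms of differences of values of
  \<open>g\<close>.\<close>

lemma N_riemann_sum_diff:
  assumes p: "p tagged_division_of {a..b}" and q: "q tagged_division_of {a..b}"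
    and g: "g \<in> {a..b} \<rightarrow> carrier S"
  shows "AE \<omega> in P. N (R g p \<ominus>\<^bsub>S\<^esub> R g q) \<omega>
           \<le> (\<Sum>(x, J)\<in>p. \<Sum>(y, K)\<in>q. measure lborel (J \<inter> K) * N (g x \<ominus>\<^bsub>S\<^esub> g y) \<omega>)"
proof -
  define c :: "real set \<Rightarrow> ('w \<Rightarrow> 'k) set" where "c J = L0_class P (\<lambda>_. of_real (measure lborel J))" for J
  have c: "c J \<in> carrier (L0 P)" for J by (simp add: c_def L0_class_in)
  have fin: "finite p" "finite q" using p q by auto
  have gp: "g (fst i) \<in> carrier S" if "i \<in> p" for i
    using that tagged_division_ofD(2,3)[OF p, of "fst i" "snd i"] g by auto
  have gq: "g (fst i) \<in> carrier S" if "i \<in> q" for i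
    using that tagged_division_ofD(2,3)[OF q, of "fst i" "snd i"] g by auto
  \<comment> \<open>For \<open>q\<close> the refinement is applied with exchanged roles, and the
    order of summation is then swapped to align it with the sum for \<open>p\<close>.\<close>
  have "R g q = finsum S (\<lambda>j. finsum S (\<lambda>i. c (snd j \<inter> snd i) \<odot>\<^bsub>S\<^esub> g (fst j)) p) q"
    using riemann_sum_refine[OF q p g] by (simp add: case_prod_unfold c_def)
  also have "\<dots> = finsum S (\<lambda>i. finsum S (\<lambda>j. c (snd i \<inter> snd j) \<odot>\<^bsub>S\<^esub> g (fst j)) q) p"
    by (subst finsum_swap) (use fin c gq in \<open>auto simp: Int_commute\<close>)
  finally have Rq: "R g q = finsum S (\<lambda>i. finsum S (\<lambda>j. c (snd i \<inter> snd j) \<odot>\<^bsub>S\<^esub> g (fst j)) q) p" .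
  have Rp: "R g p = finsum S (\<lambda>i. finsum S (\<lambda>j. c (snd i \<inter> snd j) \<odot>\<^bsub>S\<^esub> g (fst i)) q) p"
    using riemann_sum_refine[OF p q g] by (simp add: case_prod_unfold c_def)
  define h where "h i j = c (snd i \<inter> snd j) \<odot>\<^bsub>S\<^esub> (g (fst i) \<ominus>\<^bsub>S\<^esub> g (fst j))" for i j :: "real \<times> real set"
  have h: "h i j \<in> carrier S" if "i \<in> p" "j \<in> q" for i j
    using that c gp gq by (simp add: h_def)
  have "R g p \<ominus>\<^bsub>S\<^esub> R g q = finsum S (\<lambda>i. finsum S (h i) q) p"
    unfolding Rp Rq
  proof (subst finsum_diff)
    show "finsum S (\<lambda>i. finsum S (\<lambda>j. c (snd i \<inter> snd j) \<odot>\<^bsub>S\<^esub> g (fst i)) q \<ominus>\<^bsub>S\<^esub>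
        finsum S (\<lambda>j. c (snd i \<inter> snd j) \<odot>\<^bsub>S\<^esub> g (fst j)) q) p = finsum S (\<lambda>i. finsum S (h i) q) p"
    proof (rule M.finsum_cong'[OF refl])
      fix i assume i: "i \<in> p"
      show "finsum S (\<lambda>j. c (snd i \<inter> snd j) \<odot>\<^bsub>S\<^esub> g (fst i)) q \<ominus>\<^bsub>S\<^esub>
        finsum S (\<lambda>j. c (snd i \<inter> snd j) \<odot>\<^bsub>S\<^esub> g (fst j)) q = finsum S (h i) q"
        using i c gp[OF i] gq
        by (subst finsum_diff) (auto simp: h_def smult_diff intro!: M.finsum_cong')
    qed (use h in \<open>auto intro!: M.finsum_closed\<close>)
  qed (use c gp gq in \<open>auto intro!: M.finsum_closed\<close>)
  then have "AE \<omega> in P. N (R g p \<ominus>\<^bsub>S\<^esub> R g q) \<omega> \<le> (\<Sum>i\<in>p. N (finsum S (h i) q) \<omega>)"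
    using h fin by (auto intro!: N_finsum M.finsum_closed)
  moreover have "AE \<omega> in P. \<forall>i\<in>p. N (finsum S (h i) q) \<omega> \<le> (\<Sum>j\<in>q. N (h i j) \<omega>)"
    using h fin by (intro AE_finite_allI N_finsum) auto
  moreover have "AE \<omega> in P. \<forall>i\<in>p. \<forall>j\<in>q. N (h i j) \<omega> =
      measure lborel (snd i \<inter> snd j) * N (g (fst i) \<ominus>\<^bsub>S\<^esub> g (fst j)) \<omega>"
  proof (intro AE_finite_allI fin)
    fix i j assume "i \<in> p" "j \<in> q"
    then show "AE \<omega> in P. N (h i j) \<omega> =
      measure lborel (snd i \<inter> snd j) * N (g (fst i) \<ominus>\<^bsub>S\<^esub> g (fst j)) \<omega>"
      using N_smult[of "\<lambda>_. of_real (measure lborel (snd i \<inter> snd j))" "g (fst i) \<ominus>\<^bsub>S\<^esub> g (fst j)"] gp gq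
      by (simp add: h_def c_def)
  qed
  ultimately show ?thesis
  proof eventually_elim
    case (elim \<omega>)
    have "N (R g p \<ominus>\<^bsub>S\<^esub> R g q) \<omega> \<le> (\<Sum>i\<in>p. \<Sum>j\<in>q. N (h i j) \<omega>)"
      using elim(1,2) by (meson order_trans sum_mono)
    also have "\<dots> = (\<Sum>i\<in>p. \<Sum>j\<in>q. measure lborel (snd i \<inter> snd j) * N (g (fst i) \<ominus>\<^bsub>S\<^esub> g (fst j)) \<omega>)"
      using elim(3) by (intro sum.cong) auto
    finally show ?case by (simp add: case_prod_unfold)
  qed
qed

section \<open>Uniform continuity and existence of the Riemann integral\<close>

definition pcontinuous_on :: "real set \<Rightarrow> (real \<Rightarrow> 's) \<Rightarrow> bool" where
  "pcontinuous_on A g \<longleftrightarrow> (\<forall>s\<in>A. ((\<lambda>t. pdist (g t) (g s)) \<longlongrightarrow> 0) (at s within A))"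

lemma pcontinuous_on_subset:
  "pcontinuous_on A g \<Longrightarrow> B \<subseteq> A \<Longrightarrow> pcontinuous_on B g"
  unfolding pcontinuous_on_def by (meson subsetD tendsto_within_subset)

text \<open>Heine-Cantor: \<open>\<delta>\<close> is a Lebesgue number of the cover by balls on each
  of which \<open>g\<close> stays within \<open>e / 2\<close> of its value at the centre.\<close>

lemma pcontinuous_on_uniform:
  assumes "pcontinuous_on {a..b} g" and g: "g \<in> {a..b} \<rightarrow> carrier S" and "0 < e"
  obtains \<delta> where "\<delta> > 0"
    "\<And>s t. s \<in> {a..b} \<Longrightarrow> t \<in> {a..b} \<Longrightarrow> \<bar>s - t\<bar> < \<delta> \<Longrightarrow> pdist (g s) (g t) < e"
proof -
  have "\<exists>d>0. \<forall>t\<in>{a..b}. dist t s < d \<longrightarrow> pdist (g t) (g s) < e / 2" if s: "s \<in> {a..b}" for s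
  proof -
    have "((\<lambda>t. pdist (g t) (g s)) \<longlongrightarrow> 0) (at s within {a..b})"
      using assms(1) s by (simp add: pcontinuous_on_def)
    then have "\<forall>\<^sub>F t in at s within {a..b}. pdist (g t) (g s) < e / 2"
      using \<open>0 < e\<close> by (intro order_tendstoD(2)) auto
    then obtain d where d: "d > 0" "\<And>t. t \<in> {a..b} \<Longrightarrow> t \<noteq> s \<Longrightarrow> dist t s < d \<Longrightarrow> pdist (g t) (g s) < e / 2"
      by (auto simp: eventually_at)
    have "pdist (g s) (g s) < e / 2" using s g \<open>0 < e\<close> by (subst pdist_self) auto
    with d(2) have "pdist (g t) (g s) < e / 2" if "t \<in> {a..b}" "dist t s < d" for t
      using that by (cases "t = s") auto
    with d(1) show ?thesis by blast
  qed
  then obtain d where d: "\<And>s. s \<in> {a..b} \<Longrightarrow> d s > 0"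
    "\<And>s t. s \<in> {a..b} \<Longrightarrow> t \<in> {a..b} \<Longrightarrow> dist t s < d s \<Longrightarrow> pdist (g t) (g s) < e / 2"
    by metis
  obtain \<delta> where \<delta>: "0 < \<delta>" "\<And>x. x \<in> {a..b} \<Longrightarrow> \<exists>G\<in>(\<lambda>s. ball s (d s)) ` {a..b}. ball x \<delta> \<subseteq> G"
  proof (rule Heine_Borel_lemma)
    show "compact {a..b}" by simp
    show "{a..b} \<subseteq> \<Union> ((\<lambda>s. ball s (d s)) ` {a..b})" using d(1) by force
  qed auto
  show ?thesis
  proof (rule that[OF \<delta>(1)])
    fix s t assume st: "s \<in> {a..b}" "t \<in> {a..b}" "\<bar>s - t\<bar> < \<delta>"
    then obtain u where u: "u \<in> {a..b}" "ball s \<delta> \<subseteq> ball u (d u)" using \<delta>(2)[of s] by auto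
    have "s \<in> ball s \<delta>" "t \<in> ball s \<delta>" using st \<delta>(1) by (auto simp: dist_real_def)
    with u(2) have "s \<in> ball u (d u)" "t \<in> ball u (d u)" by blast+
    then have "dist s u < d u" "dist t u < d u" by (simp_all add: dist_commute)
    then have "pdist (g s) (g u) < e / 2" "pdist (g t) (g u) < e / 2"
      using d(2) st u by auto
    moreover have c: "g s \<in> carrier S" "g t \<in> carrier S" "g u \<in> carrier S" using st u g by auto
    have "pdist (g s) (g t) \<le> pdist (g s) (g u) + pdist (g t) (g u)"
      using pdist_triangle[OF c(1,3,2)] pdist_commute[OF c(3,2)] by simp
    ultimately show "pdist (g s) (g t) < e" by simp
  qed
qed

text \<open>
  Truncating by \<open>min 1\<close> and restoring the size with the dominating function turns smallness in
  probability into smallness in mean, which is compatible with weighted sums.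
\<close>

lemma riemann_sum_Cauchy:
  assumes "a \<le> b" and g: "g \<in> {a..b} \<rightarrow> carrier S" and Q[measurable]: "Q \<in> borel_measurable P"
    and dom: "\<And>s. s \<in> {a..b} \<Longrightarrow> AE \<omega> in P. N (g s) \<omega> \<le> Q \<omega>"
    and cont: "pcontinuous_on {a..b} g" and "0 < e"
  shows "\<exists>d>0. \<forall>p q. p tagged_division_of {a..b} \<longrightarrow> q tagged_division_of {a..b} \<longrightarrow>
     (\<lambda>x. ball x d) fine p \<longrightarrow> (\<lambda>x. ball x d) fine q \<longrightarrow> pdist (R g p) (R g q) < e"
proof -
  \<comment> \<open>Chosen so that \<open>n \<le> A * min 1 n\<close> for the norm \<open>n\<close>
    of a difference of two values: the summand 1 covers \<open>n \<le> 1\<close>, and otherwise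
    \<open>n \<le> 2 * Q\<close>, as \<open>Q\<close> dominates both values.\<close>
  define A where "A \<omega> = 1 + 2 * Q \<omega>" for \<omega>
  have A[measurable]: "A \<in> borel_measurable P" unfolding A_def by measurable
  obtain \<delta> where \<delta>: "\<delta> > 0"
    "\<And>X Y. X \<in> borel_measurable P \<Longrightarrow> Y \<in> borel_measurable P \<Longrightarrow>
       AE \<omega> in P. \<bar>Y \<omega>\<bar> \<le> A \<omega> * \<bar>X \<omega>\<bar> \<Longrightarrow> pd X < \<delta> \<Longrightarrow> pd Y < e"
    using pd_mult_small[OF A \<open>0 < e\<close>] by metis
  \<comment> \<open>The weights add up to \<open>b - a\<close>; the summand 1 keeps the division
    valid when \<open>a = b\<close>.\<close>
  define e' where "e' = \<delta> / (b - a + 1)"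
  have e': "e' > 0" "(b - a) * e' < \<delta>" 
    using \<delta>(1) \<open>a \<le> b\<close> by (auto simp: e'_def field_simps)
  obtain d where d: "d > 0"
    "\<And>s t. s \<in> {a..b} \<Longrightarrow> t \<in> {a..b} \<Longrightarrow> \<bar>s - t\<bar> < d \<Longrightarrow> pdist (g s) (g t) < e'"
    using pcontinuous_on_uniform[OF cont g e'(1)] by metis
  show ?thesis
  \<comment> \<open>The tags of two cells with a common point are each closer than
    \<open>d / 2\<close> to it, hence at distance less than \<open>d\<close> from each
    other.\<close>
  proof (intro exI[of _ "d / 2"] conjI allI impI)
    fix p q assume p: "p tagged_division_of {a..b}" and q: "q tagged_division_of {a..b}"
      and pf: "(\<lambda>x. ball x (d / 2)) fine p" and qf: "(\<lambda>x. ball x (d / 2)) fine q"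
    have fin: "finite p" "finite q" using p q by auto
    have tp: "fst i \<in> {a..b}" "g (fst i) \<in> carrier S" if "i \<in> p" for i
      using that tagged_division_ofD(2,3)[OF p, of "fst i" "snd i"] g by auto
    have tq: "fst i \<in> {a..b}" "g (fst i) \<in> carrier S" if "i \<in> q" for i
      using that tagged_division_ofD(2,3)[OF q, of "fst i" "snd i"] g by auto
    define m where "m i j = measure lborel (snd i \<inter> snd j)" for i j :: "real \<times> real set"
    have m0: "m i j \<ge> 0" for i j by (simp add: m_def)
    define n where "n i j = N (g (fst i) \<ominus>\<^bsub>S\<^esub> g (fst j))" for i j :: "real \<times> real set"
    have nm: "n i j \<in> borel_measurable P" if "i \<in> p" "j \<in> q" for i j
      using that tp tq by (simp add: n_def)
    define X where "X \<omega> = (\<Sum>i\<in>p. \<Sum>j\<in>q. m i j * min 1 \<bar>n i j \<omega>\<bar>)" for \<omega>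
    have iX: "integrable P X"
      unfolding X_def using nm
      by (intro Bochner_Integration.integrable_sum integrable_mult_right integrable_min_1)
    have X0: "X \<omega> \<ge> 0" for \<omega> unfolding X_def by (intro sum_nonneg mult_nonneg_nonneg m0) auto
    have An: "AE \<omega> in P. \<forall>i\<in>p. \<forall>j\<in>q. n i j \<omega> \<le> A \<omega> * min 1 \<bar>n i j \<omega>\<bar>"
    proof (intro AE_finite_allI fin)
      fix i j assume ij: "i \<in> p" "j \<in> q"
      have "AE \<omega> in P. 0 \<le> n i j \<omega>" unfolding n_def using ij tp tq by (intro N_nonneg) auto
      moreover have "AE \<omega> in P. n i j \<omega> \<le> N (g (fst i)) \<omega> + N (g (fst j)) \<omega>"
        unfolding n_def using ij tp tq by (intro N_diff) auto
      moreover have "AE \<omega> in P. 0 \<le> N (g (fst i)) \<omega>" using ij tp by (intro N_nonneg) auto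
      moreover have "AE \<omega> in P. N (g (fst i)) \<omega> \<le> Q \<omega>" using ij tp by (intro dom) auto
      moreover have "AE \<omega> in P. N (g (fst j)) \<omega> \<le> Q \<omega>" using ij tq by (intro dom) auto
      ultimately show "AE \<omega> in P. n i j \<omega> \<le> A \<omega> * min 1 \<bar>n i j \<omega>\<bar>"
      proof eventually_elim
        case (elim \<omega>)
        then have "0 \<le> Q \<omega>" "n i j \<omega> \<le> 2 * Q \<omega>" by auto
        then show ?case
          using elim(1) mult_right_mono[of 1 "A \<omega>" "n i j \<omega>"] by (auto simp: A_def min_def)
      qed
    qed
    have Rc: "R g p \<in> carrier S" "R g q \<in> carrier S"
      by (intro riemann_sum_closed[OF p g] riemann_sum_closed[OF q g])+
    have "AE \<omega> in P. 0 \<le> N (R g p \<ominus>\<^bsub>S\<^esub> R g q) \<omega>"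
      using Rc by (intro N_nonneg) auto
    with An N_riemann_sum_diff[OF p q g]
    have AX: "AE \<omega> in P. \<bar>N (R g p \<ominus>\<^bsub>S\<^esub> R g q) \<omega>\<bar> \<le> A \<omega> * \<bar>X \<omega>\<bar>"
    proof eventually_elim
      case (elim \<omega>)
      have "N (R g p \<ominus>\<^bsub>S\<^esub> R g q) \<omega> \<le> (\<Sum>i\<in>p. \<Sum>j\<in>q. m i j * n i j \<omega>)"
        using elim(2) by (simp add: case_prod_unfold m_def n_def)
      also have "\<dots> \<le> (\<Sum>i\<in>p. \<Sum>j\<in>q. m i j * (A \<omega> * min 1 \<bar>n i j \<omega>\<bar>))"
        using elim(1) m0 by (intro sum_mono mult_left_mono) auto
      also have "\<dots> = A \<omega> * X \<omega>"
        by (simp add: X_def sum_distrib_left mult.left_commute)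
      finally show ?case using elim(3) X0[of \<omega>] by simp
    qed
    \<comment> \<open>The mean, unlike \<open>pd\<close>, is linear, so the weights can be pulled
      out; the truncation inside \<open>X\<close> makes it finite.\<close>
    have "pd X \<le> expectation X" using iX X0 by (intro pd_le_expectation) auto
    also have "\<dots> = (\<Sum>i\<in>p. \<Sum>j\<in>q. m i j * pd (n i j))"
    proof -
      have 1: "integrable P (\<lambda>\<omega>. m i j * min 1 \<bar>n i j \<omega>\<bar>)" if "i \<in> p" "j \<in> q" for i j
        using nm[OF that] by (intro integrable_mult_right integrable_min_1)
      have "expectation X = (\<Sum>i\<in>p. expectation (\<lambda>\<omega>. \<Sum>j\<in>q. m i j * min 1 \<bar>n i j \<omega>\<bar>))"
        unfolding X_def using 1
        by (intro Bochner_Integration.integral_sum Bochner_Integration.integrable_sum)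
      also have "\<dots> = (\<Sum>i\<in>p. \<Sum>j\<in>q. expectation (\<lambda>\<omega>. m i j * min 1 \<bar>n i j \<omega>\<bar>))"
        using 1 by (intro sum.cong refl Bochner_Integration.integral_sum)
      finally show ?thesis by (simp add: pd_def)
    qed
    also have "\<dots> \<le> (\<Sum>i\<in>p. \<Sum>j\<in>q. m i j * e')"
    proof (intro sum_mono)
      fix i j assume ij: "i \<in> p" "j \<in> q"
      show "m i j * pd (n i j) \<le> m i j * e'"
      \<comment> \<open>Disjoint cells may have distant tags, but then their weight is 0.\<close>
      proof (cases "snd i \<inter> snd j = {}")
        case True
        then show ?thesis by (simp add: m_def)
      next
        case False
        then obtain z where z: "z \<in> snd i" "z \<in> snd j" by auto
        have "snd i \<subseteq> ball (fst i) (d / 2)" "snd j \<subseteq> ball (fst j) (d / 2)"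
          using fineD[OF pf, of "fst i" "snd i"] fineD[OF qf, of "fst j" "snd j"] ij by auto
        with z have "z \<in> ball (fst i) (d / 2)" "z \<in> ball (fst j) (d / 2)" by auto
        then have "\<bar>fst i - z\<bar> < d / 2" "\<bar>fst j - z\<bar> < d / 2"
          by (simp_all add: dist_real_def)
        then have "\<bar>fst i - fst j\<bar> < d" by linarith
        then have "pd (n i j) < e'"
          using d(2) ij tp tq unfolding n_def pdist_def by blast
        then show ?thesis using m0 by (intro mult_left_mono) auto
      qed
    qed
    also have "\<dots> = (b - a) * e'"
    proof -
      have "(\<Sum>j\<in>q. m i j) = measure lborel (snd i)" if i: "i \<in> p" for i
      proof -
        have i': "(fst i, snd i) \<in> p" using i by simp
        obtain u v where "snd i = {u..v}"
          using tagged_division_ofD(4)[OF p i'] by (metis box_real(2))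
        then show ?thesis
          using content_eq_sum_Int[OF q _ tagged_division_ofD(3)[OF p i']]
          by (simp only: m_def case_prod_unfold)
      qed
      then show ?thesis
        using sum_content_tagged_division[OF p \<open>a \<le> b\<close>]
        by (simp add: sum_distrib_right[symmetric] case_prod_unfold)
    qed
    finally have "pd X < \<delta>" using e' by simp
    then show "pdist (R g p) (R g q) < e"
      unfolding pdist_def using iX AX Rc
      by (intro \<delta>(2)[of X]) auto
  qed (use d in auto)
qed

text \<open>\<open>el_complete\<close> speaks of sequences, the integral of a filter. A sequence of
  partitions of mesh \<open>1 / Suc n\<close> provides the candidate, and the Cauchy estimate
  compares every fine enough partition with a member of it.\<close>

lemma riemann_integral_exists:
  assumes "el_complete P S nrm" "a \<le> b" and g: "g \<in> {a..b} \<rightarrow> carrier S"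
    and Q: "Q \<in> borel_measurable P"
    and dom: "\<And>s. s \<in> {a..b} \<Longrightarrow> AE \<omega> in P. N (g s) \<omega> \<le> Q \<omega>"
    and cont: "pcontinuous_on {a..b} g"
  shows "\<exists>I. has_riemann_integral P S nrm g a b I"
proof -
  obtain p where p: "\<And>n :: nat. p n tagged_division_of {a..b}"
    "\<And>n. (\<lambda>x. ball x (1 / real (Suc n))) fine p n"
    using fine_division_sequence by blast
  have fine: "\<exists>n0. \<forall>n\<ge>n0. (\<lambda>x. ball x d) fine p n" if d: "d > 0" for d
  proof -
    obtain n0 where n0: "1 / real (Suc n0) < d" using nat_approx_posE[OF d] by blast
    have "(\<lambda>x. ball x d) fine p n" if "n \<ge> n0" for n
    proof (rule fine_ball_mono[OF p(2)])
      have "1 / real (Suc n) \<le> 1 / real (Suc n0)" using that by (simp add: frac_le)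
      with n0 show "1 / real (Suc n) \<le> d" by simp
    qed
    then show ?thesis by blast
  qed
  have c: "R g (p n) \<in> carrier S" for n by (rule riemann_sum_closed[OF p(1) g])
  have C: "\<exists>n0. \<forall>m\<ge>n0. \<forall>n\<ge>n0. pdist (R g (p m)) (R g (p n)) < e" if e: "e > 0" for e
  proof -
    obtain d where d: "d > 0" "\<And>p q. p tagged_division_of {a..b} \<Longrightarrow> q tagged_division_of {a..b} \<Longrightarrow>
       (\<lambda>x. ball x d) fine p \<Longrightarrow> (\<lambda>x. ball x d) fine q \<Longrightarrow> pdist (R g p) (R g q) < e"
      using riemann_sum_Cauchy[OF \<open>a \<le> b\<close> g Q dom cont e] by auto
    obtain n0 where n0: "\<And>n. n \<ge> n0 \<Longrightarrow> (\<lambda>x. ball x d) fine p n" using fine[OF d(1)] by blast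
    have "pdist (R g (p m)) (R g (p n)) < e" if "m \<ge> n0" "n \<ge> n0" for m n
      using d(2)[OF p(1) p(1) n0[OF that(1)] n0[OF that(2)]] .
    then show ?thesis by blast
  qed
  obtain I where I: "I \<in> carrier S" "(\<lambda>n. pdist (R g (p n)) I) \<longlonglongrightarrow> 0"
    by (rule el_complete_pdist[OF assms(1), of "\<lambda>n. R g (p n)", OF c C])
  have "((\<lambda>q. pdist (R g q) I) \<longlongrightarrow> 0) (riemann_filter a b)"
  proof (rule order_tendstoI)
    fix e :: real assume e: "0 < e"
    then have e2: "0 < e / 2" by simp
    obtain d where d: "d > 0" "\<And>p q. p tagged_division_of {a..b} \<Longrightarrow> q tagged_division_of {a..b} \<Longrightarrow>
       (\<lambda>x. ball x d) fine p \<Longrightarrow> (\<lambda>x. ball x d) fine q \<Longrightarrow> pdist (R g p) (R g q) < e / 2"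
      using riemann_sum_Cauchy[OF \<open>a \<le> b\<close> g Q dom cont e2] by auto
    obtain n0 where n0: "\<And>n. n \<ge> n0 \<Longrightarrow> (\<lambda>x. ball x d) fine p n" using fine[OF d(1)] by blast
    have "\<forall>\<^sub>F n in sequentially. pdist (R g (p n)) I < e / 2"
      using I(2) e by (intro order_tendstoD(2)) auto
    then have "\<forall>\<^sub>F n in sequentially. n0 \<le> n \<and> pdist (R g (p n)) I < e / 2"
      using eventually_ge_at_top by (intro eventually_conj)
    then obtain n where n: "n \<ge> n0" "pdist (R g (p n)) I < e / 2"
      by (auto simp: eventually_sequentially)
    show "\<forall>\<^sub>F q in riemann_filter a b. pdist (R g q) I < e"
      unfolding eventually_riemann_filter
    proof (intro exI[of _ d] conjI allI impI d(1))
      fix q assume q: "q tagged_division_of {a..b}" "(\<lambda>x. ball x d) fine q"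
      have "pdist (R g q) (R g (p n)) < e / 2" using d(2)[OF q(1) p(1) q(2) n0[OF n(1)]] .
      moreover have "pdist (R g q) I \<le> pdist (R g q) (R g (p n)) + pdist (R g (p n)) I"
        using riemann_sum_closed[OF q(1) g] c I by (intro pdist_triangle)
      ultimately show "pdist (R g q) I < e" using n by simp
    qed
  next
    fix e :: real assume "e < 0"
    then show "\<forall>\<^sub>F q in riemann_filter a b. e < pdist (R g q) I"
      by (intro always_eventually allI) (use pdist_nonneg less_le_trans in blast)
  qed
  moreover have "\<forall>\<^sub>F q in riemann_filter a b. R g q \<in> carrier S"
    unfolding eventually_riemann_filter using riemann_sum_closed[OF _ g] by (auto intro: exI[of _ "1::real"])
  ultimately show ?thesis
    unfolding has_riemann_integral_def limitin_el_iff using I(1) by blast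
qed

end

section \<open>Improper integrals\<close>

context random_normed_module
begin

lemma has_riemann_integral_iff:
  assumes "g \<in> {a..b} \<rightarrow> carrier S"
  shows "has_riemann_integral P S nrm g a b I \<longleftrightarrow>
    I \<in> carrier S \<and> ((\<lambda>p. pdist (R g p) I) \<longlongrightarrow> 0) (riemann_filter a b)"
proof -
  have "\<forall>\<^sub>F q in riemann_filter a b. R g q \<in> carrier S"
    unfolding eventually_riemann_filter using riemann_sum_closed[OF _ assms]
    by (auto intro: exI[of _ "1::real"])
  then show ?thesis by (simp add: has_riemann_integral_def limitin_el_iff)
qed

lemma has_riemann_integral_unique:
  assumes "g \<in> {a..b} \<rightarrow> carrier S"
    and "has_riemann_integral P S nrm g a b I" "has_riemann_integral P S nrm g a b J"
  shows "I = J"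
proof (rule tendsto_unique_pdist[OF riemann_filter_nontrivial])
  show "\<forall>\<^sub>F q in riemann_filter a b. R g q \<in> carrier S"
    unfolding eventually_riemann_filter using riemann_sum_closed[OF _ assms(1)]
    by (auto intro: exI[of _ "1::real"])
qed (use assms in \<open>simp_all add: has_riemann_integral_iff\<close>)

lemma has_integral_0_inf_closed:
  "has_integral_0_inf P S nrm g I \<Longrightarrow> I \<in> carrier S"
  by (auto simp: has_integral_0_inf_def limitin_el_iff)

text \<open>The partial integrals agree for \<open>L \<ge> 0\<close>; what the two witnesses do at
  negative \<open>L\<close> is invisible in the limit.\<close>

lemma has_integral_0_inf_unique:
  assumes g: "g \<in> {0..} \<rightarrow> carrier S"
    and "has_integral_0_inf P S nrm g I" "has_integral_0_inf P S nrm g I'"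
  shows "I = I'"
proof -
  obtain J where J: "\<And>L. L \<ge> 0 \<Longrightarrow> has_riemann_integral P S nrm g 0 L (J L)"
      "limitin (el_topology P S nrm) J I at_top"
    using assms(2) by (auto simp: has_integral_0_inf_def)
  obtain J' where J': "\<And>L. L \<ge> 0 \<Longrightarrow> has_riemann_integral P S nrm g 0 L (J' L)"
      "limitin (el_topology P S nrm) J' I' at_top"
    using assms(3) by (auto simp: has_integral_0_inf_def)
  have eq: "J L = J' L" if "L \<ge> 0" for L
    using g that by (intro has_riemann_integral_unique[OF _ J(1) J'(1)]) auto
  have ev: "\<forall>\<^sub>F L in at_top. pdist (J' L) I' = pdist (J L) I'"
    using eventually_ge_at_top[of "0::real"] by eventually_elim (simp add: eq)
  show ?thesis
  proof (rule tendsto_unique_pdist)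
    show "((\<lambda>L. pdist (J L) I') \<longlongrightarrow> 0) at_top"
      using J'(2) tendsto_cong[OF ev] by (simp add: limitin_el_iff)
  qed (use J(2) J'(2) in \<open>auto simp: limitin_el_iff\<close>)
qed

lemma add_diff_add:
  assumes "x \<in> carrier S" "y \<in> carrier S" "x' \<in> carrier S" "y' \<in> carrier S"
  shows "(x \<oplus>\<^bsub>S\<^esub> y) \<ominus>\<^bsub>S\<^esub> (x' \<oplus>\<^bsub>S\<^esub> y') = (x \<ominus>\<^bsub>S\<^esub> x') \<oplus>\<^bsub>S\<^esub> (y \<ominus>\<^bsub>S\<^esub> y')"
  using assms by (simp add: a_minus_def M.minus_add M.a_ac)

text \<open>The factor \<open>norm (u \<omega>)\<close> may be unbounded, which is the case that
  \<open>tendsto_pd_mult\<close> covers.\<close>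

lemma tendsto_pdist_smult:
  fixes u :: "'w \<Rightarrow> 'k"
  assumes u: "u \<in> borel_measurable P" and x: "x \<in> carrier S"
    and X: "\<forall>\<^sub>F i in F. X i \<in> carrier S" and lim: "((\<lambda>i. pdist (X i) x) \<longlongrightarrow> 0) F"
  shows "((\<lambda>i. pdist (L0_class P u \<odot>\<^bsub>S\<^esub> X i) (L0_class P u \<odot>\<^bsub>S\<^esub> x)) \<longlongrightarrow> 0) F"
  unfolding pdist_def
proof (rule tendsto_pd_mult[where A = "\<lambda>\<omega>. norm (u \<omega>)"])
  show "((\<lambda>i. pd (N (X i \<ominus>\<^bsub>S\<^esub> x))) \<longlongrightarrow> 0) F" using lim by (simp add: pdist_def)
  show "(\<lambda>\<omega>. norm (u \<omega>)) \<in> borel_measurable P" using u by simp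
  show "\<forall>\<^sub>F i in F. N (X i \<ominus>\<^bsub>S\<^esub> x) \<in> borel_measurable P \<and>
      N (L0_class P u \<odot>\<^bsub>S\<^esub> X i \<ominus>\<^bsub>S\<^esub> L0_class P u \<odot>\<^bsub>S\<^esub> x) \<in> borel_measurable P \<and>
      (AE \<omega> in P. \<bar>N (L0_class P u \<odot>\<^bsub>S\<^esub> X i \<ominus>\<^bsub>S\<^esub> L0_class P u \<odot>\<^bsub>S\<^esub> x) \<omega>\<bar>
        \<le> norm (u \<omega>) * \<bar>N (X i \<ominus>\<^bsub>S\<^esub> x) \<omega>\<bar>)"
    using X
  proof (eventually_elim, intro conjI)
    fix i assume Xi: "X i \<in> carrier S"
    show "N (X i \<ominus>\<^bsub>S\<^esub> x) \<in> borel_measurable P" using Xi x by simp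
    show "N (L0_class P u \<odot>\<^bsub>S\<^esub> X i \<ominus>\<^bsub>S\<^esub> L0_class P u \<odot>\<^bsub>S\<^esub> x) \<in> borel_measurable P"
      using Xi x u by simp
    have "AE \<omega> in P. N (L0_class P u \<odot>\<^bsub>S\<^esub> (X i \<ominus>\<^bsub>S\<^esub> x)) \<omega> = norm (u \<omega>) * N (X i \<ominus>\<^bsub>S\<^esub> x) \<omega>"
      using u x Xi by (intro N_smult) auto
    then show "AE \<omega> in P. \<bar>N (L0_class P u \<odot>\<^bsub>S\<^esub> X i \<ominus>\<^bsub>S\<^esub> L0_class P u \<odot>\<^bsub>S\<^esub> x) \<omega>\<bar>
        \<le> norm (u \<omega>) * \<bar>N (X i \<ominus>\<^bsub>S\<^esub> x) \<omega>\<bar>"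
      unfolding smult_diff[OF L0_class_in[OF u] Xi x] by eventually_elim (simp add: abs_mult)
  qed
qed

lemma tendsto_pdist_add:
  assumes x: "x \<in> carrier S" "y \<in> carrier S"
    and X: "\<forall>\<^sub>F i in F. X i \<in> carrier S" "\<forall>\<^sub>F i in F. Y i \<in> carrier S"
    and lim: "((\<lambda>i. pdist (X i) x) \<longlongrightarrow> 0) F" "((\<lambda>i. pdist (Y i) y) \<longlongrightarrow> 0) F"
  shows "((\<lambda>i. pdist (X i \<oplus>\<^bsub>S\<^esub> Y i) (x \<oplus>\<^bsub>S\<^esub> y)) \<longlongrightarrow> 0) F"
proof (rule tendsto_sandwich[where f = "\<lambda>_. 0" and h = "\<lambda>i. pdist (X i) x + pdist (Y i) y"])
  show "((\<lambda>i. pdist (X i) x + pdist (Y i) y) \<longlongrightarrow> 0) F" using tendsto_add[OF lim] by simp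
  show "\<forall>\<^sub>F i in F. pdist (X i \<oplus>\<^bsub>S\<^esub> Y i) (x \<oplus>\<^bsub>S\<^esub> y) \<le> pdist (X i) x + pdist (Y i) y"
    using X
  proof eventually_elim
    case (elim i)
    then show ?case
      unfolding pdist_def add_diff_add[OF elim x]
      using x by (intro pd_N_triangle N_add) auto
  qed
qed (auto simp: pdist_nonneg)

text \<open>Random coefficients and the content weights can be interchanged because
  \<open>L0 P\<close> is commutative.\<close>

lemma riemann_sum_lincomb:
  fixes u v :: "'w \<Rightarrow> 'k"
  assumes u: "u \<in> borel_measurable P" "v \<in> borel_measurable P"
    and p: "p tagged_division_of {a..b}"
    and g: "g \<in> {a..b} \<rightarrow> carrier S" "h \<in> {a..b} \<rightarrow> carrier S"
  shows "R (\<lambda>s. L0_class P u \<odot>\<^bsub>S\<^esub> g s \<oplus>\<^bsub>S\<^esub> L0_class P v \<odot>\<^bsub>S\<^esub> h s) p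
    = L0_class P u \<odot>\<^bsub>S\<^esub> R g p \<oplus>\<^bsub>S\<^esub> L0_class P v \<odot>\<^bsub>S\<^esub> R h p"
proof -
  define U V where "U = L0_class P u" and "V = L0_class P v"
  have UV: "U \<in> carrier (L0 P)" "V \<in> carrier (L0 P)" using u by (simp_all add: U_def V_def L0_class_in)
  define T where "T g = (\<lambda>(x, J :: real set). L0_class P (\<lambda>_. of_real (measure lborel J) :: 'k) \<odot>\<^bsub>S\<^esub> g x)" for g :: "real \<Rightarrow> 's"
  have T: "T g \<in> p \<rightarrow> carrier S" "T h \<in> p \<rightarrow> carrier S"
    unfolding T_def using riemann_term_closed[OF p] g by auto
  have fin: "finite p" using p by auto
  have "U \<odot>\<^bsub>S\<^esub> R g p \<oplus>\<^bsub>S\<^esub> V \<odot>\<^bsub>S\<^esub> R h p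
      = finsum S (\<lambda>i. U \<odot>\<^bsub>S\<^esub> T g i) p \<oplus>\<^bsub>S\<^esub> finsum S (\<lambda>i. V \<odot>\<^bsub>S\<^esub> T h i) p"
    unfolding riemann_sum_def T_def[symmetric]
    by (simp only: finsum_smult_ldistr[OF fin UV(1) T(1)] finsum_smult_ldistr[OF fin UV(2) T(2)])
  also have "\<dots> = finsum S (\<lambda>i. U \<odot>\<^bsub>S\<^esub> T g i \<oplus>\<^bsub>S\<^esub> V \<odot>\<^bsub>S\<^esub> T h i) p"
    using T UV by (intro M.finsum_addf[symmetric]) auto
  also have "\<dots> = finsum S (T (\<lambda>s. U \<odot>\<^bsub>S\<^esub> g s \<oplus>\<^bsub>S\<^esub> V \<odot>\<^bsub>S\<^esub> h s)) p"
  proof (rule M.finsum_cong'[OF refl])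
    show "T (\<lambda>s. U \<odot>\<^bsub>S\<^esub> g s \<oplus>\<^bsub>S\<^esub> V \<odot>\<^bsub>S\<^esub> h s) \<in> p \<rightarrow> carrier S"
      unfolding T_def using g UV by (intro riemann_term_closed[OF p]) auto
    fix i assume i: "i \<in> p"
    obtain x J where xJ: "i = (x, J)" by (cases i)
    have "x \<in> {a..b}" using tagged_division_ofD(2,3)[OF p, of x J] i xJ by auto
    then have gh: "g x \<in> carrier S" "h x \<in> carrier S" using g by auto
    define c where "c = L0_class P (\<lambda>_. of_real (measure lborel J) :: 'k)"
    have c: "c \<in> carrier (L0 P)" by (simp add: c_def L0_class_in)
    have *: "W \<odot>\<^bsub>S\<^esub> (c \<odot>\<^bsub>S\<^esub> z) = c \<odot>\<^bsub>S\<^esub> (W \<odot>\<^bsub>S\<^esub> z)" if "W \<in> carrier (L0 P)" "z \<in> carrier S" for W z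
      using that c by (simp add: smult_assoc1[symmetric] m_comm)
    show "U \<odot>\<^bsub>S\<^esub> T g i \<oplus>\<^bsub>S\<^esub> V \<odot>\<^bsub>S\<^esub> T h i = T (\<lambda>s. U \<odot>\<^bsub>S\<^esub> g s \<oplus>\<^bsub>S\<^esub> V \<odot>\<^bsub>S\<^esub> h s) i"
      using gh UV c by (simp add: T_def xJ c_def[symmetric] * smult_r_distr)
  qed
  finally show ?thesis unfolding riemann_sum_def T_def U_def V_def by simp
qed

lemma has_riemann_integral_lincomb:
  fixes u v :: "'w \<Rightarrow> 'k"
  assumes u: "u \<in> borel_measurable P" "v \<in> borel_measurable P"
    and g: "g \<in> {a..b} \<rightarrow> carrier S" "h \<in> {a..b} \<rightarrow> carrier S"
    and I: "has_riemann_integral P S nrm g a b I" and J: "has_riemann_integral P S nrm h a b J"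
  shows "has_riemann_integral P S nrm (\<lambda>s. L0_class P u \<odot>\<^bsub>S\<^esub> g s \<oplus>\<^bsub>S\<^esub> L0_class P v \<odot>\<^bsub>S\<^esub> h s) a b
    (L0_class P u \<odot>\<^bsub>S\<^esub> I \<oplus>\<^bsub>S\<^esub> L0_class P v \<odot>\<^bsub>S\<^esub> J)"
proof -
  let ?F = "riemann_filter a b"
  have I': "I \<in> carrier S" "((\<lambda>p. pdist (R g p) I) \<longlongrightarrow> 0) ?F"
    using I g by (simp_all add: has_riemann_integral_iff)
  have J': "J \<in> carrier S" "((\<lambda>p. pdist (R h p) J) \<longlongrightarrow> 0) ?F"
    using J g by (simp_all add: has_riemann_integral_iff)
  have td: "\<forall>\<^sub>F p in ?F. p tagged_division_of {a..b}"
    unfolding eventually_riemann_filter by (auto intro: exI[of _ "1::real"])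
  have c: "\<forall>\<^sub>F p in ?F. R g p \<in> carrier S" "\<forall>\<^sub>F p in ?F. R h p \<in> carrier S"
    using td g by (auto elim!: eventually_mono intro: riemann_sum_closed)
  have cu: "\<forall>\<^sub>F p in ?F. L0_class P u \<odot>\<^bsub>S\<^esub> R g p \<in> carrier S"
      "\<forall>\<^sub>F p in ?F. L0_class P v \<odot>\<^bsub>S\<^esub> R h p \<in> carrier S"
    using eventually_mono[OF c(1) smult_class_closed[OF u(1)]]
      eventually_mono[OF c(2) smult_class_closed[OF u(2)]] by auto
  have "((\<lambda>p. pdist (L0_class P u \<odot>\<^bsub>S\<^esub> R g p \<oplus>\<^bsub>S\<^esub> L0_class P v \<odot>\<^bsub>S\<^esub> R h p)
      (L0_class P u \<odot>\<^bsub>S\<^esub> I \<oplus>\<^bsub>S\<^esub> L0_class P v \<odot>\<^bsub>S\<^esub> J)) \<longlongrightarrow> 0) ?F"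
    using u I' J' c cu by (intro tendsto_pdist_add tendsto_pdist_smult) auto
  moreover have "\<forall>\<^sub>F p in ?F. pdist (L0_class P u \<odot>\<^bsub>S\<^esub> R g p \<oplus>\<^bsub>S\<^esub> L0_class P v \<odot>\<^bsub>S\<^esub> R h p)
      (L0_class P u \<odot>\<^bsub>S\<^esub> I \<oplus>\<^bsub>S\<^esub> L0_class P v \<odot>\<^bsub>S\<^esub> J)
    = pdist (R (\<lambda>s. L0_class P u \<odot>\<^bsub>S\<^esub> g s \<oplus>\<^bsub>S\<^esub> L0_class P v \<odot>\<^bsub>S\<^esub> h s) p)
      (L0_class P u \<odot>\<^bsub>S\<^esub> I \<oplus>\<^bsub>S\<^esub> L0_class P v \<odot>\<^bsub>S\<^esub> J)"
    using td by eventually_elim (simp add: riemann_sum_lincomb[OF u _ g])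
  ultimately have "((\<lambda>p. pdist (R (\<lambda>s. L0_class P u \<odot>\<^bsub>S\<^esub> g s \<oplus>\<^bsub>S\<^esub> L0_class P v \<odot>\<^bsub>S\<^esub> h s) p)
      (L0_class P u \<odot>\<^bsub>S\<^esub> I \<oplus>\<^bsub>S\<^esub> L0_class P v \<odot>\<^bsub>S\<^esub> J)) \<longlongrightarrow> 0) ?F"
    by (rule Lim_transform_eventually)
  then show ?thesis
    using u g I' J' by (subst has_riemann_integral_iff) (auto simp: Pi_iff)
qed

lemma has_integral_0_inf_lincomb:
  fixes u v :: "'w \<Rightarrow> 'k"
  assumes u: "u \<in> borel_measurable P" "v \<in> borel_measurable P"
    and g: "g \<in> {0..} \<rightarrow> carrier S" "h \<in> {0..} \<rightarrow> carrier S"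
    and "has_integral_0_inf P S nrm g I" and "has_integral_0_inf P S nrm h I'"
  shows "has_integral_0_inf P S nrm (\<lambda>s. L0_class P u \<odot>\<^bsub>S\<^esub> g s \<oplus>\<^bsub>S\<^esub> L0_class P v \<odot>\<^bsub>S\<^esub> h s)
    (L0_class P u \<odot>\<^bsub>S\<^esub> I \<oplus>\<^bsub>S\<^esub> L0_class P v \<odot>\<^bsub>S\<^esub> I')"
proof -
  obtain J where J: "\<And>L. L \<ge> 0 \<Longrightarrow> has_riemann_integral P S nrm g 0 L (J L)"
      "limitin (el_topology P S nrm) J I at_top"
    using assms(5) by (auto simp: has_integral_0_inf_def)
  obtain J' where J': "\<And>L. L \<ge> 0 \<Longrightarrow> has_riemann_integral P S nrm h 0 L (J' L)"
      "limitin (el_topology P S nrm) J' I' at_top"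
    using assms(6) by (auto simp: has_integral_0_inf_def)
  have c: "\<forall>\<^sub>F L in at_top. J L \<in> carrier S" "\<forall>\<^sub>F L in at_top. J' L \<in> carrier S"
    using J(2) J'(2) by (auto simp: limitin_el_iff)
  have cu: "\<forall>\<^sub>F L in at_top. L0_class P u \<odot>\<^bsub>S\<^esub> J L \<in> carrier S"
      "\<forall>\<^sub>F L in at_top. L0_class P v \<odot>\<^bsub>S\<^esub> J' L \<in> carrier S"
    using eventually_mono[OF c(1) smult_class_closed[OF u(1)]]
      eventually_mono[OF c(2) smult_class_closed[OF u(2)]] by auto
  show ?thesis unfolding has_integral_0_inf_def
  proof (intro exI[of _ "\<lambda>L. L0_class P u \<odot>\<^bsub>S\<^esub> J L \<oplus>\<^bsub>S\<^esub> L0_class P v \<odot>\<^bsub>S\<^esub> J' L"] conjI allI impI)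
    fix L :: real assume "0 \<le> L"
    then show "has_riemann_integral P S nrm (\<lambda>s. L0_class P u \<odot>\<^bsub>S\<^esub> g s \<oplus>\<^bsub>S\<^esub> L0_class P v \<odot>\<^bsub>S\<^esub> h s) 0 L
      (L0_class P u \<odot>\<^bsub>S\<^esub> J L \<oplus>\<^bsub>S\<^esub> L0_class P v \<odot>\<^bsub>S\<^esub> J' L)"
      using u g J(1) J'(1) by (intro has_riemann_integral_lincomb) auto
  next
    have "((\<lambda>L. pdist (L0_class P u \<odot>\<^bsub>S\<^esub> J L \<oplus>\<^bsub>S\<^esub> L0_class P v \<odot>\<^bsub>S\<^esub> J' L)
      (L0_class P u \<odot>\<^bsub>S\<^esub> I \<oplus>\<^bsub>S\<^esub> L0_class P v \<odot>\<^bsub>S\<^esub> I')) \<longlongrightarrow> 0) at_top"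
      using u J(2) J'(2) c cu
      by (intro tendsto_pdist_add tendsto_pdist_smult) (auto simp: limitin_el_iff)
    moreover have "\<forall>\<^sub>F L in at_top. L0_class P u \<odot>\<^bsub>S\<^esub> J L \<oplus>\<^bsub>S\<^esub> L0_class P v \<odot>\<^bsub>S\<^esub> J' L \<in> carrier S"
      using cu by eventually_elim simp
    ultimately show "limitin (el_topology P S nrm)
      (\<lambda>L. L0_class P u \<odot>\<^bsub>S\<^esub> J L \<oplus>\<^bsub>S\<^esub> L0_class P v \<odot>\<^bsub>S\<^esub> J' L)
      (L0_class P u \<odot>\<^bsub>S\<^esub> I \<oplus>\<^bsub>S\<^esub> L0_class P v \<odot>\<^bsub>S\<^esub> I') at_top"
      using u J(2) J'(2) by (simp add: limitin_el_iff)
  qed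
qed

end

text \<open>Lets limits over the filter be evaluated on specially chosen partitions, such as those
  that break at a prescribed point.\<close>

lemma filterlim_riemann_filter:
  assumes p: "\<And>n. p n tagged_division_of {a..b}"
    "\<And>n. (\<lambda>x. ball x (1 / real (Suc n))) fine p n"
  shows "filterlim p (riemann_filter a b) sequentially"
  unfolding filterlim_iff eventually_riemann_filter
proof (intro allI impI, elim exE conjE)
  fix Q and d :: real
  assume d: "0 < d" and Q: "\<forall>p. p tagged_division_of {a..b} \<longrightarrow> (\<lambda>x. ball x d) fine p \<longrightarrow> Q p"
  obtain n0 where n0: "1 / real (Suc n0) < d" using nat_approx_posE[OF d] by blast
  have "Q (p n)" if "n \<ge> n0" for n
  proof -
    have "1 / real (Suc n) \<le> 1 / real (Suc n0)" using that by (simp add: frac_le)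
    with n0 have "(\<lambda>x. ball x d) fine p n" using p(2)[of n] by (intro fine_ball_mono[OF p(2)[of n]]) simp
    with p(1) Q show ?thesis by blast
  qed
  then show "\<forall>\<^sub>F n in sequentially. Q (p n)" by (auto simp: eventually_sequentially)
qed

section \<open>Exponentially dominated integrands\<close>

context random_normed_module
begin

text \<open>The quantifier over \<open>s\<close> stands outside \<open>AE\<close>: the exceptional
  null set may depend on \<open>s\<close>. This suffices because a Riemann sum has finitely many
  tags.\<close>

definition exp_bounded :: "(real \<Rightarrow> 's) \<Rightarrow> ('w \<Rightarrow> real) \<Rightarrow> ('w \<Rightarrow> real) \<Rightarrow> bool" where
  "exp_bounded g C c \<longleftrightarrow> C \<in> borel_measurable P \<and> c \<in> borel_measurable P \<and>
     (AE \<omega> in P. 0 \<le> C \<omega>) \<and> (AE \<omega> in P. 0 < c \<omega>) \<and>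
     (\<forall>s\<ge>0. AE \<omega> in P. N (g s) \<omega> \<le> C \<omega> * exp (- (c \<omega> * s)))"

lemma exp_boundedD:
  assumes "exp_bounded g C c"
  shows "C \<in> borel_measurable P" "c \<in> borel_measurable P"
    "AE \<omega> in P. 0 \<le> C \<omega>" "AE \<omega> in P. 0 < c \<omega>"
    "\<And>s. s \<ge> 0 \<Longrightarrow> AE \<omega> in P. N (g s) \<omega> \<le> C \<omega> * exp (- (c \<omega> * s))"
  using assms by (auto simp: exp_bounded_def)

text \<open>Stated for a subset \<open>q\<close> of a division so that it also serves the tail
  estimate, where a few cells of a division of \<open>{L..L'}\<close> may be missing. The terms
  added in passing from \<open>q\<close> to \<open>p\<close> are nonnegative.\<close>

lemma N_riemann_sum_le:
  assumes g: "g \<in> {0..} \<rightarrow> carrier S" and "exp_bounded g C c" and "0 \<le> a" "a \<le> b"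
    and p: "p tagged_division_of {a..b}" "(\<lambda>x. ball x 1) fine p" and "q \<subseteq> p"
  shows "AE \<omega> in P. N (finsum S (\<lambda>(x, J). L0_class P (\<lambda>_. of_real (measure lborel J)) \<odot>\<^bsub>S\<^esub> g x) q) \<omega>
    \<le> C \<omega> * exp (c \<omega>) / c \<omega> * exp (- (c \<omega> * a))"
proof -
  define T where "T = (\<lambda>(x, J :: real set). L0_class P (\<lambda>_. of_real (measure lborel J) :: 'k) \<odot>\<^bsub>S\<^esub> g x)"
  note B = exp_boundedD[OF assms(2)]
  have fin: "finite p" "finite q" using p \<open>q \<subseteq> p\<close> by (auto intro: finite_subset)
  have gp: "fst i \<ge> 0" "g (fst i) \<in> carrier S" if "i \<in> p" for i
  proof -
    have "fst i \<in> {a..b}" using that tagged_division_ofD(2,3)[OF p(1), of "fst i" "snd i"] by auto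
    then show "fst i \<ge> 0" using \<open>0 \<le> a\<close> by simp
    with g show "g (fst i) \<in> carrier S" by auto
  qed
  have "g \<in> {a..b} \<rightarrow> carrier S" using g \<open>0 \<le> a\<close> by auto
  then have "T \<in> p \<rightarrow> carrier S" unfolding T_def by (rule riemann_term_closed[OF p(1)])
  then have T: "T \<in> q \<rightarrow> carrier S" using \<open>q \<subseteq> p\<close> by auto
  have "AE \<omega> in P. \<forall>i\<in>p. N (T i) \<omega> \<le> measure lborel (snd i) * (C \<omega> * exp (- (c \<omega> * fst i)))"
  proof (intro AE_finite_allI fin)
    fix i assume i: "i \<in> p"
    have "AE \<omega> in P. N (T i) \<omega> = measure lborel (snd i) * N (g (fst i)) \<omega>"
      using N_smult[of "\<lambda>_. of_real (measure lborel (snd i))" "g (fst i)"] gp[OF i]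
      by (simp add: T_def case_prod_unfold)
    with B(5)[OF gp(1)[OF i]]
    show "AE \<omega> in P. N (T i) \<omega> \<le> measure lborel (snd i) * (C \<omega> * exp (- (c \<omega> * fst i)))"
      by eventually_elim (auto intro!: mult_left_mono)
  qed
  with N_finsum[OF fin(2) T] B(3,4)
  have "AE \<omega> in P. N (finsum S T q) \<omega> \<le> C \<omega> * exp (c \<omega>) / c \<omega> * exp (- (c \<omega> * a))"
  proof eventually_elim
    case (elim \<omega>)
    have "N (finsum S T q) \<omega> \<le> (\<Sum>i\<in>q. N (T i) \<omega>)" using elim by simp
    also have "\<dots> \<le> (\<Sum>i\<in>q. measure lborel (snd i) * (C \<omega> * exp (- (c \<omega> * fst i))))"
      using elim \<open>q \<subseteq> p\<close> by (intro sum_mono) auto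
    also have "\<dots> \<le> (\<Sum>i\<in>p. measure lborel (snd i) * (C \<omega> * exp (- (c \<omega> * fst i))))"
      using elim \<open>q \<subseteq> p\<close> fin by (intro sum_mono2) auto
    also have "\<dots> = C \<omega> * (\<Sum>(x, J)\<in>p. measure lborel J * exp (- (c \<omega> * x)))"
      by (simp add: sum_distrib_left case_prod_unfold mult.left_commute)
    also have "\<dots> \<le> C \<omega> * (exp (c \<omega>) / c \<omega> * exp (- (c \<omega> * a)))"
      using elim by (intro mult_left_mono exp_riemann_sum_le[OF p \<open>a \<le> b\<close>])
    finally show ?case by simp
  qed
  then show ?thesis by (simp add: T_def)
qed

lemma N_riemann_integral_le:
  assumes g: "g \<in> {0..} \<rightarrow> carrier S" and b: "exp_bounded g C c" and "0 \<le> L"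
    and I: "has_riemann_integral P S nrm g 0 L I"
  shows "AE \<omega> in P. N I \<omega> \<le> C \<omega> * exp (c \<omega>) / c \<omega>"
proof (rule N_le_limit[OF riemann_filter_nontrivial])
  note [measurable] = exp_boundedD(1,2)[OF b]
  have g': "g \<in> {0..L} \<rightarrow> carrier S" using g by auto
  show "I \<in> carrier S" "((\<lambda>p. pdist (R g p) I) \<longlongrightarrow> 0) (riemann_filter 0 L)"
    using I g' by (auto simp: has_riemann_integral_iff)
  show "(\<lambda>\<omega>. C \<omega> * exp (c \<omega>) / c \<omega>) \<in> borel_measurable P" by measurable
  have "AE \<omega> in P. N (R g p) \<omega> \<le> C \<omega> * exp (c \<omega>) / c \<omega>"
    if "p tagged_division_of {0..L}" "(\<lambda>x. ball x 1) fine p" for p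
    using N_riemann_sum_le[OF g b order.refl \<open>0 \<le> L\<close> that order.refl] by (simp add: riemann_sum_def)
  then show "\<forall>\<^sub>F p in riemann_filter 0 L. R g p \<in> carrier S \<and>
      (AE \<omega> in P. N (R g p) \<omega> \<le> C \<omega> * exp (c \<omega>) / c \<omega>)"
    unfolding eventually_riemann_filter using riemann_sum_closed[OF _ g']
    by (intro exI[of _ "1::real"]) auto
qed

lemma N_integral_0_inf_le:
  assumes g: "g \<in> {0..} \<rightarrow> carrier S" and b: "exp_bounded g C c"
    and I: "has_integral_0_inf P S nrm g I"
  shows "AE \<omega> in P. N I \<omega> \<le> C \<omega> * exp (c \<omega>) / c \<omega>"
proof -
  note [measurable] = exp_boundedD(1,2)[OF b]
  obtain J where J: "\<And>L. L \<ge> 0 \<Longrightarrow> has_riemann_integral P S nrm g 0 L (J L)"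
      "limitin (el_topology P S nrm) J I at_top"
    using I by (auto simp: has_integral_0_inf_def)
  have J': "I \<in> carrier S" "\<forall>\<^sub>F L in at_top. J L \<in> carrier S" "((\<lambda>L. pdist (J L) I) \<longlongrightarrow> 0) at_top"
    using J(2) by (auto simp: limitin_el_iff)
  show ?thesis
  proof (rule N_le_limit[OF _ J'(1,3)])
    show "\<forall>\<^sub>F L in at_top. J L \<in> carrier S \<and> (AE \<omega> in P. N (J L) \<omega> \<le> C \<omega> * exp (c \<omega>) / c \<omega>)"
      using J'(2) eventually_ge_at_top[of 0]
      by eventually_elim (auto intro: N_riemann_integral_le[OF g b _ J(1)])
  qed auto
qed

lemma pdist_diff_le:
  assumes "x \<in> carrier S" "y \<in> carrier S" "x' \<in> carrier S" "y' \<in> carrier S"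
  shows "pdist (x \<ominus>\<^bsub>S\<^esub> y) (x' \<ominus>\<^bsub>S\<^esub> y') \<le> pdist x x' + pdist y y'"
proof -
  have "(x \<ominus>\<^bsub>S\<^esub> y) \<ominus>\<^bsub>S\<^esub> (x' \<ominus>\<^bsub>S\<^esub> y') = (x \<ominus>\<^bsub>S\<^esub> x') \<ominus>\<^bsub>S\<^esub> (y \<ominus>\<^bsub>S\<^esub> y')"
    using assms by (simp add: a_minus_def M.minus_add M.a_ac)
  then show ?thesis
    unfolding pdist_def using assms by (simp only:) (intro pd_N_triangle N_diff, auto)
qed

text \<open>The approximating partitions of \<open>{0..L'}\<close> are made to break at
  \<open>L\<close>, so the difference of the two Riemann sums lives on \<open>{L..L'}\<close>, and
  \<open>N_riemann_sum_le\<close> with left end \<open>L\<close> yields the decay.\<close>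

lemma N_riemann_integral_tail_le:
  assumes g: "g \<in> {0..} \<rightarrow> carrier S" and b: "exp_bounded g C c" and L: "0 \<le> L" "L \<le> L'"
    and I: "has_riemann_integral P S nrm g 0 L I" and I': "has_riemann_integral P S nrm g 0 L' I'"
  shows "AE \<omega> in P. N (I' \<ominus>\<^bsub>S\<^esub> I) \<omega> \<le> C \<omega> * exp (c \<omega>) / c \<omega> * exp (- (c \<omega> * L))"
proof -
  note [measurable] = exp_boundedD(1,2)[OF b]
  have g': "g \<in> {0..L} \<rightarrow> carrier S" "g \<in> {0..L'} \<rightarrow> carrier S" "g \<in> {L..L'} \<rightarrow> carrier S"
    using g L by auto
  obtain p where p: "\<And>n :: nat. p n tagged_division_of {0..L}"
    "\<And>n. (\<lambda>x. ball x (1 / real (Suc n))) fine p n"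
    using fine_division_sequence by blast
  obtain q where q: "\<And>n :: nat. q n tagged_division_of {L..L'}"
    "\<And>n. (\<lambda>x. ball x (1 / real (Suc n))) fine q n"
    using fine_division_sequence by blast
  have pq: "p n \<union> q n tagged_division_of {0..L'}" for n
  proof -
    have "interior {0..L} \<inter> interior {L..L'} = {}" by (simp add: interior_atLeastAtMost_real)
    from tagged_division_Un[OF p(1) q(1) this] L show ?thesis
      by (simp add: ivl_disj_un_two_touch)
  qed
  have I_c: "I \<in> carrier S" "I' \<in> carrier S"
    using I I' g' by (auto simp: has_riemann_integral_iff)
  have lim: "(\<lambda>n. pdist (R g (p n)) I) \<longlonglongrightarrow> 0"
    using I g' filterlim_riemann_filter[OF p] by (auto simp: has_riemann_integral_iff intro: filterlim_compose)
  have lim': "(\<lambda>n. pdist (R g (p n \<union> q n)) I') \<longlonglongrightarrow> 0"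
    using I' g' filterlim_riemann_filter[OF pq fine_Un[OF p(2) q(2)]]
    by (auto simp: has_riemann_integral_iff intro: filterlim_compose)
  have c: "R g (p n) \<in> carrier S" "R g (p n \<union> q n) \<in> carrier S" for n
    using riemann_sum_closed[OF p(1) g'(1)] riemann_sum_closed[OF pq g'(2)] by auto
  show ?thesis
  proof (rule N_le_limit)
    show "I' \<ominus>\<^bsub>S\<^esub> I \<in> carrier S" using I_c by simp
    show "(\<lambda>n. pdist (R g (p n \<union> q n) \<ominus>\<^bsub>S\<^esub> R g (p n)) (I' \<ominus>\<^bsub>S\<^esub> I)) \<longlonglongrightarrow> 0"
    proof (rule tendsto_sandwich[where f = "\<lambda>_. 0"])
      show "(\<lambda>n. pdist (R g (p n \<union> q n)) I' + pdist (R g (p n)) I) \<longlonglongrightarrow> 0"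
        using tendsto_add[OF lim' lim] by simp
      show "\<forall>\<^sub>F n in sequentially. pdist (R g (p n \<union> q n) \<ominus>\<^bsub>S\<^esub> R g (p n)) (I' \<ominus>\<^bsub>S\<^esub> I)
          \<le> pdist (R g (p n \<union> q n)) I' + pdist (R g (p n)) I"
        using c I_c by (intro always_eventually allI pdist_diff_le) auto
    qed (auto simp: pdist_nonneg)
    show "\<forall>\<^sub>F n in sequentially. R g (p n \<union> q n) \<ominus>\<^bsub>S\<^esub> R g (p n) \<in> carrier S \<and>
      (AE \<omega> in P. N (R g (p n \<union> q n) \<ominus>\<^bsub>S\<^esub> R g (p n)) \<omega>
        \<le> C \<omega> * exp (c \<omega>) / c \<omega> * exp (- (c \<omega> * L)))"
    proof (intro always_eventually allI, intro conjI)
      fix n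
      show "R g (p n \<union> q n) \<ominus>\<^bsub>S\<^esub> R g (p n) \<in> carrier S" using c by simp
      define T where "T = (\<lambda>(x, J :: real set). L0_class P (\<lambda>_. of_real (measure lborel J) :: 'k) \<odot>\<^bsub>S\<^esub> g x)"
      have T: "T \<in> p n \<rightarrow> carrier S" "T \<in> q n \<rightarrow> carrier S"
        unfolding T_def using riemann_term_closed[OF p(1) g'(1)] riemann_term_closed[OF q(1) g'(3)] by auto
      \<comment> \<open>A degenerate cell at \<open>L\<close> may belong to both divisions; the set
        difference makes the union disjoint.\<close>
      then have T: "T \<in> p n \<rightarrow> carrier S" "T \<in> q n - p n \<rightarrow> carrier S" by auto
      have "finite (p n)" "finite (q n)" using p(1) q(1) by auto
      then have "finsum S T (p n \<union> (q n - p n)) = finsum S T (p n) \<oplus>\<^bsub>S\<^esub> finsum S T (q n - p n)"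
        using T by (intro M.finsum_Un_disjoint) auto
      then have "R g (p n \<union> q n) = finsum S T (q n - p n) \<oplus>\<^bsub>S\<^esub> R g (p n)"
        using T by (simp add: riemann_sum_def T_def[symmetric] M.a_comm M.finsum_closed)
      then have "R g (p n \<union> q n) \<ominus>\<^bsub>S\<^esub> R g (p n) = finsum S T (q n - p n)"
        using T c by (simp add: add_diff_cancel_right M.finsum_closed)
      moreover have "(\<lambda>x. ball x 1) fine q n" by (rule fine_ball_mono[OF q(2)]) simp
      ultimately show "AE \<omega> in P. N (R g (p n \<union> q n) \<ominus>\<^bsub>S\<^esub> R g (p n)) \<omega>
        \<le> C \<omega> * exp (c \<omega>) / c \<omega> * exp (- (c \<omega> * L))"
        using N_riemann_sum_le[OF g b L q(1), of n "q n - p n"] by (simp add: T_def)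
    qed
  qed auto
qed

text \<open>Dominated convergence: pointwise decay comes from \<open>0 < c \<omega>\<close>, the
  majorant 1 from the truncation. The random rate \<open>c\<close> may come arbitrarily close to
  0.\<close>

lemma tendsto_pd_exp:
  assumes K[measurable]: "K \<in> borel_measurable P" and c[measurable]: "c \<in> borel_measurable P"
    and "AE \<omega> in P. 0 < c \<omega>"
  shows "((\<lambda>L. pd (\<lambda>\<omega>. K \<omega> * exp (- (c \<omega> * L)))) \<longlongrightarrow> 0) at_top"
proof -
  have "((\<lambda>L. \<integral>\<omega>. min 1 \<bar>K \<omega> * exp (- (c \<omega> * L))\<bar> \<partial>P) \<longlongrightarrow> (\<integral>\<omega>. 0 \<partial>P)) at_top"
  proof (rule integral_dominated_convergence_at_top[where w = "\<lambda>_. 1"])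
    show "AE \<omega> in P. ((\<lambda>L. min 1 \<bar>K \<omega> * exp (- (c \<omega> * L))\<bar>) \<longlongrightarrow> 0) at_top"
      using assms(3)
    proof eventually_elim
      case (elim \<omega>)
      have "((\<lambda>L. exp (- (c \<omega> * L))) \<longlongrightarrow> 0) at_top"
        using elim by (intro filterlim_compose[OF exp_at_bot])
          (auto intro!: filterlim_tendsto_pos_mult_at_top[OF tendsto_const] filterlim_ident
            simp: filterlim_uminus_at_bot)
      from tendsto_mult_left[OF this, of "K \<omega>"]
      have "((\<lambda>L. K \<omega> * exp (- (c \<omega> * L))) \<longlongrightarrow> 0) at_top" by simp
      then have "((\<lambda>L. min 1 \<bar>K \<omega> * exp (- (c \<omega> * L))\<bar>) \<longlongrightarrow> min 1 \<bar>0\<bar>) at_top"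
        by (intro tendsto_min tendsto_const tendsto_rabs)
      then show ?case by simp
    qed
  qed auto
  then show ?thesis by (simp add: pd_def)
qed

text \<open>The tail estimate gives one function \<open>h\<close>, tending to 0, with
  \<open>pdist (J L) (J L') \<le> h L\<close> for all later \<open>L'\<close>; this is the Cauchy
  property of the partial integrals.\<close>

lemma integral_0_inf_exists:
  assumes "el_complete P S nrm" and g: "g \<in> {0..} \<rightarrow> carrier S" and b: "exp_bounded g C c"
    and cont: "pcontinuous_on {0..} g"
  shows "\<exists>I. has_integral_0_inf P S nrm g I"
proof -
  note B = exp_boundedD[OF b]
  note [measurable] = B(1,2)
  have "\<exists>I. has_riemann_integral P S nrm g 0 L I" if "L \<ge> 0" for L
  proof (rule riemann_integral_exists[OF assms(1) that])
    show "g \<in> {0..L} \<rightarrow> carrier S" using g by auto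
    show "pcontinuous_on {0..L} g" using cont by (rule pcontinuous_on_subset) auto
    fix s assume "s \<in> {0..L}"
    then have s: "s \<ge> 0" by simp
    show "AE \<omega> in P. N (g s) \<omega> \<le> C \<omega>"
      using B(3,4) B(5)[OF s]
    proof eventually_elim
      case (elim \<omega>)
      have "exp (- (c \<omega> * s)) \<le> 1" using elim s by simp
      then have "C \<omega> * exp (- (c \<omega> * s)) \<le> C \<omega> * 1" using elim by (intro mult_left_mono) auto
      then show ?case using elim by simp
    qed
  qed fact
  then obtain J where J: "\<And>L. L \<ge> 0 \<Longrightarrow> has_riemann_integral P S nrm g 0 L (J L)"
    by metis
  have Jc: "J L \<in> carrier S" if "L \<ge> 0" for L
  proof -
    have "g \<in> {0..L} \<rightarrow> carrier S" using g by auto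
    then show ?thesis using J[OF that] by (simp add: has_riemann_integral_iff)
  qed
  define h where "h L = pd (\<lambda>\<omega>. C \<omega> * exp (c \<omega>) / c \<omega> * exp (- (c \<omega> * L)))" for L
  have h: "(h \<longlongrightarrow> 0) at_top"
    unfolding h_def using B(4) by (intro tendsto_pd_exp) auto
  have Jh: "pdist (J L) (J L') \<le> h L" if "0 \<le> L" "L \<le> L'" for L L'
  proof -
    have L': "0 \<le> L'" using that by simp
    have "pdist (J L') (J L) \<le> h L" unfolding pdist_def h_def
    proof (rule pd_mono)
      have "AE \<omega> in P. 0 \<le> N (J L' \<ominus>\<^bsub>S\<^esub> J L) \<omega>" using Jc that L' by (intro N_nonneg) auto
      with N_riemann_integral_tail_le[OF g b that J[OF that(1)] J[OF L']]
      show "AE \<omega> in P. \<bar>N (J L' \<ominus>\<^bsub>S\<^esub> J L) \<omega>\<bar> \<le> \<bar>C \<omega> * exp (c \<omega>) / c \<omega> * exp (- (c \<omega> * L))\<bar>"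
        by eventually_elim linarith
    qed (use Jc that L' in auto)
    then show ?thesis using pdist_commute[OF Jc[OF that(1)] Jc[OF L']] by simp
  qed
  have C: "\<exists>n0. \<forall>m\<ge>n0. \<forall>n\<ge>n0. pdist (J (real m)) (J (real n)) < e" if e: "e > 0" for e
  proof -
    have "\<forall>\<^sub>F L in at_top. h L < e" using h e by (rule order_tendstoD(2))
    then obtain L0 where L0: "\<And>L. L \<ge> L0 \<Longrightarrow> h L < e" by (auto simp: eventually_at_top_linorder)
    define n0 where "n0 = nat \<lceil>L0\<rceil>"
    have "h (real n) < e" if "n \<ge> n0" for n
      using that by (intro L0) (simp add: n0_def nat_le_iff ceiling_le_iff)
    then have le: "pdist (J (real m)) (J (real n)) < e" if "n0 \<le> m" "m \<le> n" for m n
      using Jh[of "real m" "real n"] that by fastforce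
    have "pdist (J (real m)) (J (real n)) < e" if "n0 \<le> m" "n0 \<le> n" for m n
      using le[of m n] le[of n m] pdist_commute[of "J (real m)" "J (real n)"] Jc that by (cases "m \<le> n") auto
    then show ?thesis by blast
  qed
  have Jc': "J (real n) \<in> carrier S" for n by (rule Jc) simp
  obtain I where I: "I \<in> carrier S" "(\<lambda>n. pdist (J (real n)) I) \<longlonglongrightarrow> 0"
    by (rule el_complete_pdist[OF assms(1), of "\<lambda>n. J (real n)", OF Jc' C])
  \<comment> \<open>Completeness was applied along the integers; letting \<open>n\<close> tend to
    infinity in the bound for \<open>J L\<close> against \<open>J (real n)\<close> reaches every
    real \<open>L\<close>.\<close>
  have le: "pdist (J L) I \<le> h L" if "L \<ge> 0" for L
  proof (rule tendsto_lowerbound)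
    show "(\<lambda>n. h L + pdist (J (real n)) I) \<longlonglongrightarrow> h L" using tendsto_add[OF tendsto_const I(2)] by simp
    have "\<forall>\<^sub>F n in sequentially. L \<le> real n"
      using filterlim_real_sequentially by (simp add: filterlim_at_top)
    then show "\<forall>\<^sub>F n in sequentially. pdist (J L) I \<le> h L + pdist (J (real n)) I"
    proof eventually_elim
      case (elim n)
      then show ?case
        using pdist_triangle[OF Jc[OF that] Jc' I(1), of n] Jh[OF that elim] by simp
    qed
  qed simp
  have "((\<lambda>L. pdist (J L) I) \<longlongrightarrow> 0) at_top"
  proof (rule tendsto_sandwich[OF _ _ tendsto_const h])
    show "\<forall>\<^sub>F L in at_top. pdist (J L) I \<le> h L"
      using eventually_ge_at_top[of "0::real"] by eventually_elim (rule le)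
  qed (simp add: pdist_nonneg)
  moreover have "\<forall>\<^sub>F L in at_top. J L \<in> carrier S"
    using eventually_ge_at_top[of "0::real"] by eventually_elim (rule Jc)
  ultimately have "limitin (el_topology P S nrm) J I at_top"
    using I(1) by (simp add: limitin_el_iff)
  with J show ?thesis unfolding has_integral_0_inf_def by blast
qed

end

section \<open>The Laplace transform\<close>

text \<open>A single term of the exponential series at \<open>c * s\<close> is at most
  \<open>exp (c * s)\<close>. Half of the decay rate is spent on the power of \<open>s\<close>, the
  other half is kept.\<close>

lemma power_mult_exp_le:
  fixes s c :: real
  assumes "0 \<le> s" "0 < c"
  shows "s ^ k * exp (- (2 * c * s)) \<le> fact k / c ^ k * exp (- (c * s))"
proof -
  have "(c * s) ^ k / fact k \<le> exp (c * s)"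
  proof -
    have "(\<Sum>n\<in>{k}. (c * s) ^ n /\<^sub>R fact n) \<le> (\<Sum>n. (c * s) ^ n /\<^sub>R fact n)"
      using assms summable_exp_generic[of "c * s"] by (intro sum_le_suminf) auto
    then show ?thesis by (simp add: exp_def divide_inverse mult.commute)
  qed
  then have "s ^ k \<le> fact k / c ^ k * exp (c * s)"
    using assms by (simp add: field_simps power_mult_distrib)
  then have "s ^ k * exp (- (2 * c * s)) \<le> (fact k / c ^ k * exp (c * s)) * exp (- (2 * c * s))"
    by (rule mult_right_mono) simp
  also have "\<dots> = fact k / c ^ k * exp (- (c * s))"
    by (simp flip: exp_add)
  finally show ?thesis .
qed

text \<open>The quantity inside is nonnegative, as \<open>1 + u \<le> exp u\<close>, and at most
  \<open>u * (exp u - 1)\<close>, which is a rewriting of \<open>(1 - u) * exp u \<le> 1\<close>.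
  The bound \<open>\<bar>u\<bar> * exp \<bar>u\<bar>\<close> on \<open>\<bar>exp u - 1\<bar>\<close>
  then gives the square.\<close>

lemma abs_exp_minus_one_minus_le:
  fixes u :: real
  shows "\<bar>exp u - 1 - u\<bar> \<le> u\<^sup>2 * exp \<bar>u\<bar>"
proof -
  have *: "exp v - 1 \<le> v * exp v" for v :: real
  proof -
    have "(1 - v) * exp v \<le> exp (- v) * exp v"
      using exp_ge_add_one_self[of "- v"] by (intro mult_right_mono) auto
    then show ?thesis by (simp add: algebra_simps flip: exp_add)
  qed
  have "\<bar>exp u - 1\<bar> \<le> \<bar>u\<bar> * exp \<bar>u\<bar>"
  proof (cases "u \<ge> 0")
    case True
    then show ?thesis using *[of u] by simp
  next
    case False
    then have "1 - exp u \<le> - u" using exp_ge_add_one_self[of u] by linarith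
    also have "\<dots> \<le> - u * exp (- u)" using False mult_left_mono[of 1 "exp (- u)" "- u"] by simp
    finally show ?thesis using False by simp
  qed
  then have "\<bar>u\<bar> * \<bar>exp u - 1\<bar> \<le> \<bar>u\<bar> * (\<bar>u\<bar> * exp \<bar>u\<bar>)" by (rule mult_left_mono) simp
  moreover have "exp u - 1 - u \<le> u * (exp u - 1)" using *[of u] by (simp add: algebra_simps)
  moreover have "0 \<le> exp u - 1 - u" using exp_ge_add_one_self[of u] by linarith
  ultimately show ?thesis
    by (simp add: power2_eq_square abs_mult[symmetric] mult.assoc[symmetric])
qed

text \<open>Factoring out the kernel leaves the second-order remainder of \<open>exp\<close> at
  \<open>u = - r * s\<close>. Division of \<open>u\<^sup>2\<close> by \<open>\<bar>r\<bar>\<close>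
  produces \<open>\<bar>r\<bar> * s\<^sup>2\<close>, which explains the exponent
  \<open>k + 2\<close>, and the growth \<open>exp (\<bar>r\<bar> * s)\<close> is moved into the rate
  \<open>y - \<bar>r\<bar>\<close>.\<close>

lemma exp_difference_quotient_le:
  fixes y r s :: real
  assumes "0 \<le> s" "r \<noteq> 0"
  shows "\<bar>(exp (- (y + r) * s) * (- s) ^ k - exp (- y * s) * (- s) ^ k) / r - exp (- y * s) * (- s) ^ Suc k\<bar>
    \<le> \<bar>r\<bar> * (s ^ (k + 2) * exp (- ((y - \<bar>r\<bar>) * s)))"
proof -
  have "(exp (- (y + r) * s) * (- s) ^ k - exp (- y * s) * (- s) ^ k) / r - exp (- y * s) * (- s) ^ Suc k
      = exp (- y * s) * (- s) ^ k * ((exp (- r * s) - 1 - (- r * s)) / r)"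
    using assms(2) by (simp add: field_simps flip: exp_add)
  also have "\<bar>\<dots>\<bar> = exp (- y * s) * s ^ k * (\<bar>exp (- r * s) - 1 - (- r * s)\<bar> / \<bar>r\<bar>)"
    using assms(1) by (simp add: abs_mult power_abs)
  also have "\<dots> \<le> exp (- y * s) * s ^ k * ((- r * s)\<^sup>2 * exp \<bar>- r * s\<bar> / \<bar>r\<bar>)"
    using assms(1) by (intro mult_left_mono divide_right_mono abs_exp_minus_one_minus_le) auto
  also have "\<dots> = \<bar>r\<bar> * (s ^ (k + 2) * (exp (- y * s) * exp (\<bar>r\<bar> * s)))"
  proof -
    have 1: "(- r * s)\<^sup>2 = \<bar>r\<bar> * (\<bar>r\<bar> * s\<^sup>2)" by (simp add: power2_eq_square)
    have 2: "\<bar>- r * s\<bar> = \<bar>r\<bar> * s" using assms(1) by (simp add: abs_mult)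
    have "(- r * s)\<^sup>2 * exp \<bar>- r * s\<bar> / \<bar>r\<bar> = \<bar>r\<bar> * (s\<^sup>2 * exp (\<bar>r\<bar> * s))"
      unfolding 1 2 using assms(2) by simp
    then show ?thesis by (simp only: power_add mult_ac)
  qed
  also have "exp (- y * s) * exp (\<bar>r\<bar> * s) = exp (- ((y - \<bar>r\<bar>) * s))"
    by (simp add: algebra_simps flip: exp_add)
  finally show ?thesis .
qed

lemma exp_power_bounded:
  fixes y s L :: real
  assumes "0 \<le> s" "s \<le> L"
  shows "\<bar>exp (- y * s) * (- s) ^ k\<bar> \<le> exp (\<bar>y\<bar> * L) * L ^ k"
proof -
  have "- y * s \<le> \<bar>y\<bar> * L"
  proof -
    have "- y * s \<le> \<bar>y\<bar> * s" using assms by (intro mult_right_mono) auto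
    also have "\<dots> \<le> \<bar>y\<bar> * L" using assms by (intro mult_left_mono) auto
    finally show ?thesis .
  qed
  then have "exp (- y * s) * s ^ k \<le> exp (\<bar>y\<bar> * L) * L ^ k"
    using assms by (intro mult_mono power_mono) auto
  then show ?thesis using assms by (simp add: abs_mult power_abs)
qed

text \<open>Mean value inequality, the derivative being bounded by \<open>exp_power_bounded\<close>.
  The constant depends on \<open>y\<close> but not on \<open>s\<close> and \<open>t\<close>; for
  random \<open>y\<close> it becomes a random Lipschitz constant of the kernel.\<close>

lemma exp_power_Lipschitz:
  fixes y s t L :: real
  assumes "s \<in> {0..L}" "t \<in> {0..L}"
  shows "\<bar>exp (- y * s) * (- s) ^ k - exp (- y * t) * (- t) ^ k\<bar>
    \<le> (\<bar>y\<bar> * (exp (\<bar>y\<bar> * L) * L ^ k) + real k * (exp (\<bar>y\<bar> * L) * L ^ (k - 1))) * \<bar>s - t\<bar>"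
proof -
  have "norm (exp (- y * s) * (- s) ^ k - exp (- y * t) * (- t) ^ k)
    \<le> (\<bar>y\<bar> * (exp (\<bar>y\<bar> * L) * L ^ k) + real k * (exp (\<bar>y\<bar> * L) * L ^ (k - 1))) * norm (s - t)"
  proof (rule field_differentiable_bound[of "{0..L}"])
    fix z :: real assume z: "z \<in> {0..L}"
    \<comment> \<open>For \<open>k = 0\<close> the truncated exponent \<open>k - 1\<close> is
      harmless because of the factor \<open>real k\<close>.\<close>
    show "((\<lambda>s. exp (- y * s) * (- s) ^ k) has_field_derivative
      - y * (exp (- y * z) * (- z) ^ k) - real k * (exp (- y * z) * (- z) ^ (k - 1))) (at z within {0..L})"
      by (auto intro!: derivative_eq_intros simp: algebra_simps)
    have "\<bar>- y * (exp (- y * z) * (- z) ^ k) - real k * (exp (- y * z) * (- z) ^ (k - 1))\<bar>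
      \<le> \<bar>y\<bar> * \<bar>exp (- y * z) * (- z) ^ k\<bar> + real k * \<bar>exp (- y * z) * (- z) ^ (k - 1)\<bar>"
      by (rule order.trans[OF abs_triangle_ineq4]) (simp add: abs_mult)
    also have "\<dots> \<le> \<bar>y\<bar> * (exp (\<bar>y\<bar> * L) * L ^ k) + real k * (exp (\<bar>y\<bar> * L) * L ^ (k - 1))"
      using z by (intro add_mono mult_left_mono exp_power_bounded) auto
    finally show "norm (- y * (exp (- y * z) * (- z) ^ k) - real k * (exp (- y * z) * (- z) ^ (k - 1)))
      \<le> \<bar>y\<bar> * (exp (\<bar>y\<bar> * L) * L ^ k) + real k * (exp (\<bar>y\<bar> * L) * L ^ (k - 1))" by simp
  qed (use assms in auto)
  then show ?thesis by simp
qed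

section \<open>The locally \<open>L\<^sup>0\<close>-convex topology in terms of
  representatives\<close>

lemma borel_measurable_of_real_field [measurable]:
  "(of_real :: real \<Rightarrow> 'k::{real_normed_field,euclidean_space}) \<in> borel_measurable borel"
  by (intro borel_measurable_continuous_onI continuous_intros)

lemma openin_Tc_topology:
  assumes "\<And>x. x \<in> carrier S \<Longrightarrow> nrm x \<in> carrier (L0 P)"
  shows "openin (Tc_topology P S nrm) U \<longleftrightarrow> U \<subseteq> carrier S \<and>
     (\<forall>x\<in>U. \<exists>\<epsilon>\<in>L0_pplus P. \<forall>z\<in>Tc_nbhd P S nrm \<epsilon>. x \<oplus>\<^bsub>S\<^esub> z \<in> U)"
  unfolding Tc_topology_def by (subst topology_inverse'[OF istopology_Tc[OF assms]]) auto

lemma L0_pplus_class: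
  "e \<in> borel_measurable P \<Longrightarrow> L0_class P e \<in> L0_pplus P \<longleftrightarrow> (AE \<omega> in P. 0 < e \<omega>)"
  by (simp add: L0_pplus_def L0_class_in L0_zero_class L0_less_class)

lemma L0_above_class:
  "x \<in> borel_measurable P \<Longrightarrow> y \<in> borel_measurable P \<Longrightarrow>
    L0_class P y \<in> L0_above P (L0_class P x) \<longleftrightarrow> (AE \<omega> in P. x \<omega> < y \<omega>)"
  by (simp add: L0_above_def L0_class_in L0_less_class)

lemma L0_abs_class:
  "r \<in> borel_measurable P \<Longrightarrow> L0_map P abs (L0_class P r) = L0_class P (\<lambda>\<omega>. \<bar>r \<omega> :: real\<bar>)"
  by (rule L0_map_class) auto

lemma L0_abs_closed: "r \<in> carrier (L0 P) \<Longrightarrow> L0_map P (abs :: real \<Rightarrow> real) r \<in> carrier (L0 P)"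
  by (erule L0_class_rep) (simp add: L0_abs_class L0_class_in)

lemma openin_Tc_L0:
  "openin (Tc_topology P (L0 P) (L0_map P abs)) U \<longleftrightarrow> U \<subseteq> carrier (L0 P) \<and>
     (\<forall>x\<in>U. \<exists>\<epsilon>\<in>L0_pplus P. \<forall>z\<in>Tc_nbhd P (L0 P) (L0_map P (abs :: real \<Rightarrow> real)) \<epsilon>. x \<oplus>\<^bsub>L0 P\<^esub> z \<in> U)"
  by (rule openin_Tc_topology) (rule L0_abs_closed)

text \<open>The radius at \<open>y\<close> is the random gap \<open>y - x\<close>. An almost surely
  positive gap may have no positive constant below it, so random radii are essential.\<close>

lemma openin_Tc_L0_above:
  assumes [measurable]: "x \<in> borel_measurable P"
  shows "openin (Tc_topology P (L0 P) (L0_map P abs)) (L0_above P (L0_class P x))"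
  unfolding openin_Tc_L0
proof (intro conjI ballI)
  show "L0_above P (L0_class P x) \<subseteq> carrier (L0 P)" by (auto simp: L0_above_def)
  fix \<eta> assume \<eta>: "\<eta> \<in> L0_above P (L0_class P x)"
  then obtain y where y[measurable]: "y \<in> borel_measurable P" and \<eta>_eq: "\<eta> = L0_class P y"
    by (auto simp: L0_above_def elim: L0_class_rep)
  have xy: "AE \<omega> in P. x \<omega> < y \<omega>" using \<eta> by (simp add: \<eta>_eq L0_above_class)
  have "\<eta> \<oplus>\<^bsub>L0 P\<^esub> z \<in> L0_above P (L0_class P x)"
    if z: "z \<in> Tc_nbhd P (L0 P) (L0_map P abs) (L0_class P (\<lambda>\<omega>. y \<omega> - x \<omega>))" for z
  proof -
    obtain w where w[measurable]: "w \<in> borel_measurable P" and z_eq: "z = L0_class P w"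
      using z by (auto simp: Tc_nbhd_def elim: L0_class_rep)
    have "AE \<omega> in P. \<bar>w \<omega>\<bar> < y \<omega> - x \<omega>"
      using z by (simp add: Tc_nbhd_def z_eq L0_abs_class L0_less_class)
    then have "AE \<omega> in P. x \<omega> < y \<omega> + w \<omega>" by eventually_elim linarith
    then show ?thesis by (simp add: \<eta>_eq z_eq L0_add_class L0_above_class)
  qed
  moreover have "L0_class P (\<lambda>\<omega>. y \<omega> - x \<omega>) \<in> L0_pplus P"
    using xy by (simp add: L0_pplus_class)
  ultimately show "\<exists>\<epsilon>\<in>L0_pplus P. \<forall>z\<in>Tc_nbhd P (L0 P) (L0_map P abs) \<epsilon>.
      \<eta> \<oplus>\<^bsub>L0 P\<^esub> z \<in> L0_above P (L0_class P x)" by blast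
qed

text \<open>Supplies the neighbourhoods of 0 on which the difference quotient is estimated; the
  radius at a point \<open>y\<close> is the slack \<open>d - \<bar>y\<bar>\<close>.\<close>

lemma openin_Tc_abs_less:
  assumes [measurable]: "d \<in> borel_measurable P"
  shows "openin (Tc_topology P (L0 P) (L0_map P abs))
    {r \<in> carrier (L0 P). L0_less P (L0_map P abs r) (L0_class P d)}"
  unfolding openin_Tc_L0
proof (intro conjI ballI)
  fix \<eta> assume \<eta>: "\<eta> \<in> {r \<in> carrier (L0 P). L0_less P (L0_map P abs r) (L0_class P d)}"
  then obtain y where y[measurable]: "y \<in> borel_measurable P" and \<eta>_eq: "\<eta> = L0_class P y"
    by (auto elim: L0_class_rep)
  have yd: "AE \<omega> in P. \<bar>y \<omega>\<bar> < d \<omega>" using \<eta> by (simp add: \<eta>_eq L0_abs_class L0_less_class)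
  have "\<eta> \<oplus>\<^bsub>L0 P\<^esub> z \<in> {r \<in> carrier (L0 P). L0_less P (L0_map P abs r) (L0_class P d)}"
    if z: "z \<in> Tc_nbhd P (L0 P) (L0_map P abs) (L0_class P (\<lambda>\<omega>. d \<omega> - \<bar>y \<omega>\<bar>))" for z
  proof -
    obtain w where w[measurable]: "w \<in> borel_measurable P" and z_eq: "z = L0_class P w"
      using z by (auto simp: Tc_nbhd_def elim: L0_class_rep)
    have "AE \<omega> in P. \<bar>w \<omega>\<bar> < d \<omega> - \<bar>y \<omega>\<bar>"
      using z by (simp add: Tc_nbhd_def z_eq L0_abs_class L0_less_class)
    then have "AE \<omega> in P. \<bar>y \<omega> + w \<omega>\<bar> < d \<omega>" by eventually_elim linarith
    then show ?thesis by (simp add: \<eta>_eq z_eq L0_add_class L0_abs_class L0_less_class L0_class_in)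
  qed
  moreover have "L0_class P (\<lambda>\<omega>. d \<omega> - \<bar>y \<omega>\<bar>) \<in> L0_pplus P"
    using yd by (simp add: L0_pplus_class)
  ultimately show "\<exists>\<epsilon>\<in>L0_pplus P. \<forall>z\<in>Tc_nbhd P (L0 P) (L0_map P abs) \<epsilon>.
      \<eta> \<oplus>\<^bsub>L0 P\<^esub> z \<in> {r \<in> carrier (L0 P). L0_less P (L0_map P abs r) (L0_class P d)}" by blast
qed auto

context random_normed_module
begin

lemma nrm_closed: "z \<in> carrier S \<Longrightarrow> nrm z \<in> carrier (L0 P)"
  using nrm_in_L0_plus by (auto simp: L0_plus_def)

lemma openin_Tc:
  "openin (Tc_topology P S nrm) U \<longleftrightarrow> U \<subseteq> carrier S \<and>
     (\<forall>x\<in>U. \<exists>\<epsilon>\<in>L0_pplus P. \<forall>z\<in>Tc_nbhd P S nrm \<epsilon>. x \<oplus>\<^bsub>S\<^esub> z \<in> U)"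
  by (rule openin_Tc_topology) (rule nrm_closed)

text \<open>Reduces convergence to 0 to almost sure inequalities for the representatives
  \<open>N\<close>, one for each positive random variable \<open>e\<close>.\<close>

lemma limitin_Tc_zero:
  assumes "\<And>e. e \<in> borel_measurable P \<Longrightarrow> AE \<omega> in P. 0 < e \<omega> \<Longrightarrow>
    \<forall>\<^sub>F i in F. X i \<in> carrier S \<and> (AE \<omega> in P. N (X i) \<omega> < e \<omega>)"
  shows "limitin (Tc_topology P S nrm) X \<zero>\<^bsub>S\<^esub> F"
  unfolding limitin_def
proof (intro conjI allI impI)
  have "\<exists>\<epsilon>. \<epsilon> \<in> (L0_pplus P :: ('w \<Rightarrow> real) set set)"
    using L0_pplus_class[of "\<lambda>_. 1" P] by auto
  then have "openin (Tc_topology P S nrm) (carrier S)"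
    unfolding openin_Tc by (auto simp: Tc_nbhd_def)
  then show "\<zero>\<^bsub>S\<^esub> \<in> topspace (Tc_topology P S nrm)"
    using openin_subset by fastforce
  fix U assume U: "openin (Tc_topology P S nrm) U \<and> \<zero>\<^bsub>S\<^esub> \<in> U"
  then obtain \<epsilon> where \<epsilon>: "\<epsilon> \<in> L0_pplus P" "\<forall>z\<in>Tc_nbhd P S nrm \<epsilon>. \<zero>\<^bsub>S\<^esub> \<oplus>\<^bsub>S\<^esub> z \<in> U"
    unfolding openin_Tc by blast
  obtain e where e: "e \<in> borel_measurable P" "\<epsilon> = L0_class P e"
    using \<epsilon>(1) by (auto simp: L0_pplus_def elim: L0_class_rep)
  have "\<forall>\<^sub>F i in F. X i \<in> carrier S \<and> (AE \<omega> in P. N (X i) \<omega> < e \<omega>)"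
    using \<epsilon>(1) e by (intro assms) (auto simp: L0_pplus_class)
  then show "\<forall>\<^sub>F i in F. X i \<in> U"
  proof (rule eventually_mono)
    fix i assume i: "X i \<in> carrier S \<and> (AE \<omega> in P. N (X i) \<omega> < e \<omega>)"
    then have "X i \<in> Tc_nbhd P S nrm \<epsilon>"
      using e by (simp add: Tc_nbhd_def nrm_eq_class L0_less_class)
    with \<epsilon>(2) have "\<zero>\<^bsub>S\<^esub> \<oplus>\<^bsub>S\<^esub> X i \<in> U" by blast
    then show "X i \<in> U" using i by simp
  qed
qed

text \<open>Bridges the sums delivered by \<open>has_integral_0_inf_lincomb\<close> and the
  subtractions in the definition of the derivative.\<close>

lemma smult_uminus_class:
  fixes u :: "'w \<Rightarrow> 'k"
  assumes "u \<in> borel_measurable P" "z \<in> carrier S" "w \<in> carrier S"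
  shows "L0_class P u \<odot>\<^bsub>S\<^esub> z \<oplus>\<^bsub>S\<^esub> L0_class P (\<lambda>\<omega>. - u \<omega>) \<odot>\<^bsub>S\<^esub> w = L0_class P u \<odot>\<^bsub>S\<^esub> (z \<ominus>\<^bsub>S\<^esub> w)"
  using assms
  by (simp add: L0_minus_class[symmetric] smult_l_minus smult_r_minus smult_r_distr L0_class_in a_minus_def[of S])

lemma smult_add_class:
  fixes u v :: "'w \<Rightarrow> 'k"
  assumes "u \<in> borel_measurable P" "v \<in> borel_measurable P" "z \<in> carrier S"
  shows "L0_class P u \<odot>\<^bsub>S\<^esub> z \<oplus>\<^bsub>S\<^esub> L0_class P v \<odot>\<^bsub>S\<^esub> z = L0_class P (\<lambda>\<omega>. u \<omega> + v \<omega>) \<odot>\<^bsub>S\<^esub> z"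
  using assms by (simp add: L0_add_class[symmetric] smult_l_distr L0_class_in)

lemma smult_smult_class:
  fixes u v :: "'w \<Rightarrow> 'k"
  assumes "u \<in> borel_measurable P" "v \<in> borel_measurable P" "z \<in> carrier S"
  shows "L0_class P u \<odot>\<^bsub>S\<^esub> (L0_class P v \<odot>\<^bsub>S\<^esub> z) = L0_class P (\<lambda>\<omega>. u \<omega> * v \<omega>) \<odot>\<^bsub>S\<^esub> z"
  using assms by (simp add: L0_mult_class[symmetric] smult_assoc1 L0_class_in)

text \<open>The increment splits into \<open>a t\<close> times the increment of \<open>f\<close> and
  the increment of \<open>a\<close> times \<open>f s\<close>; continuity of \<open>f\<close>
  controls the first, the Lipschitz condition the second. One random variable has to bound
  \<open>a t\<close> for all \<open>t\<close> in \<open>{0..L}\<close>, since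
  \<open>tendsto_pd_mult\<close> works with a fixed factor.\<close>

lemma pcontinuous_on_smult:
  fixes a :: "real \<Rightarrow> 'w \<Rightarrow> 'k"
  assumes f: "f \<in> {0..} \<rightarrow> carrier S" and cont: "pcontinuous_on {0..} f"
    and a: "\<And>s. a s \<in> borel_measurable P"
    and A: "\<And>L. A L \<in> borel_measurable P" "\<And>L. A' L \<in> borel_measurable P"
    and bound: "\<And>L s \<omega>. s \<in> {0..L} \<Longrightarrow> norm (a s \<omega>) \<le> A L \<omega>"
    and Lip: "\<And>L s t \<omega>. s \<in> {0..L} \<Longrightarrow> t \<in> {0..L} \<Longrightarrow> norm (a s \<omega> - a t \<omega>) \<le> A' L \<omega> * \<bar>s - t\<bar>"
  shows "pcontinuous_on {0..} (\<lambda>s. L0_class P (a s) \<odot>\<^bsub>S\<^esub> f s)"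
  unfolding pcontinuous_on_def
proof
  fix s :: real assume s: "s \<in> {0..}"
  let ?F = "at s within {0..}"
  \<comment> \<open>All \<open>t \<ge> 0\<close> at distance less than 1 from \<open>s\<close> lie
    in \<open>{0..L}\<close>, so the constants for this interval apply near
    \<open>s\<close>.\<close>
  define L where "L = s + 1"
  have fs: "f s \<in> carrier S" using f s by auto
  have ev: "\<forall>\<^sub>F t in ?F. t \<in> {0..L}"
    unfolding eventually_at by (rule exI[of _ 1]) (auto simp: L_def dist_real_def)
  define X where "X t = L0_class P (a t) \<odot>\<^bsub>S\<^esub> (f t \<ominus>\<^bsub>S\<^esub> f s)" for t
  define Y where "Y t = L0_class P (\<lambda>\<omega>. a t \<omega> - a s \<omega>) \<odot>\<^bsub>S\<^esub> f s" for t
  have XY: "X t \<in> carrier S" "Y t \<in> carrier S" if "t \<ge> 0" for t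
  proof -
    have "f t \<in> carrier S" using that f by auto
    then show "X t \<in> carrier S" "Y t \<in> carrier S" using fs a by (simp_all add: X_def Y_def)
  qed
  have X: "((\<lambda>t. pd (N (X t))) \<longlongrightarrow> 0) ?F"
  proof (rule tendsto_pd_mult[OF A(1)[of L]])
    show "((\<lambda>t. pd (N (f t \<ominus>\<^bsub>S\<^esub> f s))) \<longlongrightarrow> 0) ?F"
      using cont s by (simp add: pcontinuous_on_def pdist_def)
    show "\<forall>\<^sub>F t in ?F. N (f t \<ominus>\<^bsub>S\<^esub> f s) \<in> borel_measurable P \<and> N (X t) \<in> borel_measurable P \<and>
        (AE \<omega> in P. \<bar>N (X t) \<omega>\<bar> \<le> A L \<omega> * \<bar>N (f t \<ominus>\<^bsub>S\<^esub> f s) \<omega>\<bar>)"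
      using ev
    proof (rule eventually_mono)
      fix t assume t: "t \<in> {0..L}"
      then have ft: "f t \<in> carrier S" using f by auto
      have "AE \<omega> in P. N (X t) \<omega> = norm (a t \<omega>) * N (f t \<ominus>\<^bsub>S\<^esub> f s) \<omega>"
        unfolding X_def using a ft fs by (intro N_smult) auto
      then have "AE \<omega> in P. \<bar>N (X t) \<omega>\<bar> \<le> A L \<omega> * \<bar>N (f t \<ominus>\<^bsub>S\<^esub> f s) \<omega>\<bar>"
        by eventually_elim (simp add: abs_mult mult_right_mono bound[OF t])
      then show "N (f t \<ominus>\<^bsub>S\<^esub> f s) \<in> borel_measurable P \<and> N (X t) \<in> borel_measurable P \<and>
        (AE \<omega> in P. \<bar>N (X t) \<omega>\<bar> \<le> A L \<omega> * \<bar>N (f t \<ominus>\<^bsub>S\<^esub> f s) \<omega>\<bar>)"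
        using ft fs XY t by auto
    qed
  qed
  have Y: "((\<lambda>t. pd (N (Y t))) \<longlongrightarrow> 0) ?F"
  proof (rule tendsto_pd_mult[where A = "\<lambda>\<omega>. A' L \<omega> * \<bar>N (f s) \<omega>\<bar>" and X = "\<lambda>t _. \<bar>t - s\<bar>"])
    show "(\<lambda>\<omega>. A' L \<omega> * \<bar>N (f s) \<omega>\<bar>) \<in> borel_measurable P"
      using A(2)[of L] N_measurable[OF fs] by simp
    have "((\<lambda>t. \<bar>t - s\<bar>) \<longlongrightarrow> \<bar>s - s\<bar>) ?F" by (intro tendsto_intros)
    then show "((\<lambda>t. pd (\<lambda>_. \<bar>t - s\<bar>)) \<longlongrightarrow> 0) ?F" by (intro tendsto_pd_const) simp
    show "\<forall>\<^sub>F t in ?F. (\<lambda>_. \<bar>t - s\<bar>) \<in> borel_measurable P \<and> N (Y t) \<in> borel_measurable P \<and>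
        (AE \<omega> in P. \<bar>N (Y t) \<omega>\<bar> \<le> A' L \<omega> * \<bar>N (f s) \<omega>\<bar> * \<bar>\<bar>t - s\<bar>\<bar>)"
      using ev
    proof (rule eventually_mono)
      fix t assume t: "t \<in> {0..L}"
      have sL: "s \<in> {0..L}" using s by (simp add: L_def)
      have "AE \<omega> in P. N (Y t) \<omega> = norm (a t \<omega> - a s \<omega>) * N (f s) \<omega>"
        unfolding Y_def using a fs by (intro N_smult) auto
      then have "AE \<omega> in P. \<bar>N (Y t) \<omega>\<bar> \<le> A' L \<omega> * \<bar>N (f s) \<omega>\<bar> * \<bar>\<bar>t - s\<bar>\<bar>"
      proof eventually_elim
        case (elim \<omega>)
        have "norm (a t \<omega> - a s \<omega>) * \<bar>N (f s) \<omega>\<bar> \<le> (A' L \<omega> * \<bar>t - s\<bar>) * \<bar>N (f s) \<omega>\<bar>"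
          by (intro mult_right_mono Lip[OF t sL]) simp
        then show ?case using elim by (simp add: abs_mult mult_ac)
      qed
      then show "(\<lambda>_. \<bar>t - s\<bar>) \<in> borel_measurable P \<and> N (Y t) \<in> borel_measurable P \<and>
        (AE \<omega> in P. \<bar>N (Y t) \<omega>\<bar> \<le> A' L \<omega> * \<bar>N (f s) \<omega>\<bar> * \<bar>\<bar>t - s\<bar>\<bar>)"
        using XY t by auto
    qed
  qed
  show "((\<lambda>t. pdist (L0_class P (a t) \<odot>\<^bsub>S\<^esub> f t) (L0_class P (a s) \<odot>\<^bsub>S\<^esub> f s)) \<longlongrightarrow> 0) ?F"
  proof (rule tendsto_sandwich[where f = "\<lambda>_. 0"])
    show "((\<lambda>t. pd (N (X t)) + pd (N (Y t))) \<longlongrightarrow> 0) ?F" using tendsto_add[OF X Y] by simp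
    show "\<forall>\<^sub>F t in ?F. pdist (L0_class P (a t) \<odot>\<^bsub>S\<^esub> f t) (L0_class P (a s) \<odot>\<^bsub>S\<^esub> f s)
        \<le> pd (N (X t)) + pd (N (Y t))"
      using ev
    proof (rule eventually_mono)
      fix t assume t: "t \<in> {0..L}"
      then have ft: "f t \<in> carrier S" using f by auto
      have "Y t = L0_class P (a t) \<odot>\<^bsub>S\<^esub> f s \<ominus>\<^bsub>S\<^esub> L0_class P (a s) \<odot>\<^bsub>S\<^esub> f s"
        using smult_add_class[of "a t" "\<lambda>\<omega>. - a s \<omega>" "f s"] a fs
        by (simp add: Y_def L0_minus_class[symmetric] smult_l_minus L0_class_in a_minus_def[of S])
      moreover have "X t = L0_class P (a t) \<odot>\<^bsub>S\<^esub> f t \<ominus>\<^bsub>S\<^esub> L0_class P (a t) \<odot>\<^bsub>S\<^esub> f s"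
        using a ft fs by (simp add: X_def smult_diff L0_class_in)
      ultimately have eq: "X t \<oplus>\<^bsub>S\<^esub> Y t = L0_class P (a t) \<odot>\<^bsub>S\<^esub> f t \<ominus>\<^bsub>S\<^esub> L0_class P (a s) \<odot>\<^bsub>S\<^esub> f s"
        using a ft fs by (simp add: diff_telescope)
      show "pdist (L0_class P (a t) \<odot>\<^bsub>S\<^esub> f t) (L0_class P (a s) \<odot>\<^bsub>S\<^esub> f s)
        \<le> pd (N (X t)) + pd (N (Y t))"
        unfolding pdist_def eq[symmetric] using XY t by (intro pd_N_triangle N_add M.a_closed) auto
    qed
  qed (auto simp: pdist_nonneg)
qed

end

section \<open>Laplace integrands: continuity, domination and integrability\<close>

lemma L0_aboveE:
  assumes "x \<in> borel_measurable P" "\<eta> \<in> L0_above P (L0_class P x)"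
  obtains y where "y \<in> borel_measurable P" "\<eta> = L0_class P y" "AE \<omega> in P. x \<omega> < y \<omega>"
proof -
  have "\<eta> \<in> carrier (L0 P)" using assms(2) by (simp add: L0_above_def)
  then obtain y where y: "y \<in> borel_measurable P" "\<eta> = L0_class P y" by (rule L0_class_rep)
  with assms show ?thesis using that[OF y] by (simp add: L0_above_class)
qed

text \<open>Representatives \<open>b\<close> and \<open>x\<close> of the two random bounds are fixed
  once, so that the hypotheses become almost sure inequalities between functions.\<close>

locale laplace_transform = random_normed_module P S nrm
  for P :: "'w measure"
    and S :: "(('w \<Rightarrow> 'k::{real_normed_field,euclidean_space}) set, 's, 'm) module_scheme"
    and nrm :: "'s \<Rightarrow> ('w \<Rightarrow> real) set" +
  fixes f :: "real \<Rightarrow> 's" and b x :: "'w \<Rightarrow> real"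
  assumes complete: "el_complete P S nrm"
    and cont: "continuous_map (top_of_set {0..}) (el_topology P S nrm) f"
    and b_measurable [measurable]: "b \<in> borel_measurable P"
    and x_measurable [measurable]: "x \<in> borel_measurable P"
    and b_nonneg: "AE \<omega> in P. 0 \<le> b \<omega>"
    and f_bound: "\<And>s. 0 \<le> s \<Longrightarrow> AE \<omega> in P. N (f s) \<omega> \<le> b \<omega> * exp (x \<omega> * s)"
begin

lemma f_closed: "f \<in> {0..} \<rightarrow> carrier S"
  using continuous_map_image_subset_topspace[OF cont] by (auto simp: topspace_el)

text \<open>Preimages of the open metric balls around \<open>f s\<close> are relatively open in the
  half-line; this carries topological continuity over to \<open>pdist\<close>.\<close>

lemma f_pcontinuous: "pcontinuous_on {0..} f"
  unfolding pcontinuous_on_def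
proof
  fix s :: real assume s: "s \<in> {0..}"
  then have fs: "f s \<in> carrier S" using f_closed by auto
  show "((\<lambda>t. pdist (f t) (f s)) \<longlongrightarrow> 0) (at s within {0..})"
  proof (rule order_tendstoI)
    fix e :: real assume "0 < e"
    have "openin (top_of_set {0..}) {t \<in> {0..}. f t \<in> {y \<in> carrier S. pdist y (f s) < e}}"
      using openin_continuous_map_preimage[OF cont openin_pdist_ball[OF fs]] by simp
    then obtain T where T: "open T" "{t \<in> {0..}. f t \<in> {y \<in> carrier S. pdist y (f s) < e}} = {0..} \<inter> T"
      by (auto simp: openin_open)
    have "s \<in> {t \<in> {0..}. f t \<in> {y \<in> carrier S. pdist y (f s) < e}}"
      using s fs \<open>0 < e\<close> by (simp add: pdist_self)
    then have "s \<in> T" using T(2) by blast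
    show "\<forall>\<^sub>F t in at s within {0..}. pdist (f t) (f s) < e"
      unfolding eventually_at_topological
    proof (intro exI[of _ T] conjI ballI impI T(1) \<open>s \<in> T\<close>)
      fix t :: real assume "t \<in> T" "t \<in> {0..}"
      then have "t \<in> {t \<in> {0..}. f t \<in> {y \<in> carrier S. pdist y (f s) < e}}" using T(2) by blast
      then show "pdist (f t) (f s) < e" by simp
    qed
  next
    fix e :: real assume "e < 0"
    then show "\<forall>\<^sub>F t in at s within {0..}. e < pdist (f t) (f s)"
      by (intro always_eventually allI) (use pdist_nonneg less_le_trans in blast)
  qed
qed

definition kern :: "nat \<Rightarrow> ('w \<Rightarrow> real) \<Rightarrow> real \<Rightarrow> 'w \<Rightarrow> 'k" where
  "kern k y s \<omega> = of_real (exp (- y \<omega> * s) * (- s) ^ k)"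

lemma kern_measurable [measurable]:
  assumes "y \<in> borel_measurable P"
  shows "kern k y s \<in> borel_measurable P"
proof -
  have "(\<lambda>y. of_real (exp (- y * s) * (- s) ^ k) :: 'k) \<in> borel_measurable borel"
    by (intro borel_measurable_continuous_onI continuous_intros)
  from measurable_compose[OF assms this] show ?thesis by (simp add: kern_def[abs_def])
qed

lemma laplace_integrand_class:
  assumes "y \<in> borel_measurable P"
  shows "laplace_integrand P S f k (L0_class P y) s = L0_class P (kern k y s) \<odot>\<^bsub>S\<^esub> f s"
proof -
  have [measurable]: "(\<lambda>y. of_real (exp (- y * s) * (- s) ^ k) :: 'k) \<in> borel_measurable borel"
    by measurable
  show ?thesis unfolding laplace_integrand_def kern_def using assms by (subst L0_map_class) auto
qed

lemma laplace_integrand_closed: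
  assumes "y \<in> borel_measurable P"
  shows "laplace_integrand P S f k (L0_class P y) \<in> {0..} \<rightarrow> carrier S"
proof
  fix s :: real assume "s \<in> {0..}"
  then have "f s \<in> carrier S" using f_closed by auto
  then show "laplace_integrand P S f k (L0_class P y) s \<in> carrier S"
    using assms by (simp add: laplace_integrand_class)
qed

lemma laplace_integrand_pcontinuous:
  assumes [measurable]: "y \<in> borel_measurable P"
  shows "pcontinuous_on {0..} (laplace_integrand P S f k (L0_class P y))"
proof -
  have "pcontinuous_on {0..} (\<lambda>s. L0_class P (kern k y s) \<odot>\<^bsub>S\<^esub> f s)"
  proof (rule pcontinuous_on_smult[OF f_closed f_pcontinuous])
    fix L s t :: real and \<omega>
    show "kern k y s \<in> borel_measurable P" by measurable
    show "(\<lambda>\<omega>. exp (\<bar>y \<omega>\<bar> * L) * L ^ k) \<in> borel_measurable P" by measurable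
    show "(\<lambda>\<omega>. \<bar>y \<omega>\<bar> * (exp (\<bar>y \<omega>\<bar> * L) * L ^ k) + real k * (exp (\<bar>y \<omega>\<bar> * L) * L ^ (k - 1)))
      \<in> borel_measurable P" by measurable
    show "norm (kern k y s \<omega>) \<le> exp (\<bar>y \<omega>\<bar> * L) * L ^ k" if "s \<in> {0..L}"
      using that exp_power_bounded[of s L "y \<omega>" k] unfolding kern_def norm_of_real by auto
    show "norm (kern k y s \<omega> - kern k y t \<omega>)
        \<le> (\<bar>y \<omega>\<bar> * (exp (\<bar>y \<omega>\<bar> * L) * L ^ k) + real k * (exp (\<bar>y \<omega>\<bar> * L) * L ^ (k - 1))) * \<bar>s - t\<bar>"
      if "s \<in> {0..L}" "t \<in> {0..L}"
      using exp_power_Lipschitz[OF that, of "y \<omega>" k]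
      unfolding kern_def of_real_diff[symmetric] norm_of_real .
  qed
  moreover have "laplace_integrand P S f k (L0_class P y) = (\<lambda>s. L0_class P (kern k y s) \<odot>\<^bsub>S\<^esub> f s)"
    by (rule ext) (rule laplace_integrand_class[OF assms])
  ultimately show ?thesis by (simp only:)
qed

text \<open>The kernel and the bound on \<open>f s\<close> together decay at rate
  \<open>y - x\<close>. Writing this rate as \<open>2 * c\<close>, \<open>power_mult_exp_le\<close>
  trades half of it for the factor \<open>s ^ k\<close>.\<close>

lemma laplace_integrand_exp_bounded:
  assumes y[measurable]: "y \<in> borel_measurable P" and xy: "AE \<omega> in P. x \<omega> < y \<omega>"
  shows "exp_bounded (laplace_integrand P S f k (L0_class P y))
    (\<lambda>\<omega>. b \<omega> * (fact k / ((y \<omega> - x \<omega>) / 2) ^ k)) (\<lambda>\<omega>. (y \<omega> - x \<omega>) / 2)"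
  unfolding exp_bounded_def
proof (intro conjI allI impI)
  show "AE \<omega> in P. 0 \<le> b \<omega> * (fact k / ((y \<omega> - x \<omega>) / 2) ^ k)"
    using b_nonneg xy by eventually_elim auto
  show "AE \<omega> in P. 0 < (y \<omega> - x \<omega>) / 2"
    using xy by eventually_elim auto
  fix s :: real assume s: "0 \<le> s"
  then have fs: "f s \<in> carrier S" using f_closed by auto
  have "AE \<omega> in P. N (L0_class P (kern k y s) \<odot>\<^bsub>S\<^esub> f s) \<omega> = norm (kern k y s \<omega>) * N (f s) \<omega>"
    using fs by (intro N_smult) auto
  with f_bound[OF s] b_nonneg xy
  show "AE \<omega> in P. N (laplace_integrand P S f k (L0_class P y) s) \<omega>
    \<le> b \<omega> * (fact k / ((y \<omega> - x \<omega>) / 2) ^ k) * exp (- ((y \<omega> - x \<omega>) / 2 * s))"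
  proof eventually_elim
    case (elim \<omega>)
    define c where "c = (y \<omega> - x \<omega>) / 2"
    have c: "0 < c" using elim by (simp add: c_def)
    have "norm (kern k y s \<omega>) = exp (- y \<omega> * s) * s ^ k"
      using s unfolding kern_def norm_of_real by (simp add: abs_mult power_abs)
    then have "N (laplace_integrand P S f k (L0_class P y) s) \<omega>
        \<le> exp (- y \<omega> * s) * s ^ k * (b \<omega> * exp (x \<omega> * s))"
      using elim s by (simp add: laplace_integrand_class mult_left_mono)
    also have "\<dots> = b \<omega> * (s ^ k * exp (- (2 * c * s)))"
    proof -
      have y_eq: "y \<omega> = x \<omega> + 2 * c" by (simp add: c_def field_simps)
      have "exp (- y \<omega> * s) * exp (x \<omega> * s) = exp (- (2 * c * s))"
        unfolding y_eq by (simp add: algebra_simps flip: exp_add)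
      then show ?thesis by (simp add: mult_ac)
    qed
    also have "\<dots> \<le> b \<omega> * (fact k / c ^ k * exp (- (c * s)))"
      using elim by (intro mult_left_mono power_mult_exp_le s c)
    finally show ?case by (simp add: c_def)
  qed
qed auto

section \<open>The Laplace integrals and their difference quotients\<close>

abbreviation LI :: "nat \<Rightarrow> ('w \<Rightarrow> real) set \<Rightarrow> 's" where
  "LI k \<eta> \<equiv> integral_0_inf P S nrm (laplace_integrand P S f k \<eta>)"

lemma laplace_integral_ex1:
  assumes "y \<in> borel_measurable P" "AE \<omega> in P. x \<omega> < y \<omega>"
  shows "\<exists>!I. has_integral_0_inf P S nrm (laplace_integrand P S f k (L0_class P y)) I"
  using integral_0_inf_exists[OF complete laplace_integrand_closed[OF assms(1)]
      laplace_integrand_exp_bounded[OF assms] laplace_integrand_pcontinuous[OF assms(1)]]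
    has_integral_0_inf_unique[OF laplace_integrand_closed[OF assms(1)]] by blast

lemma has_integral_LI:
  assumes "y \<in> borel_measurable P" "AE \<omega> in P. x \<omega> < y \<omega>"
  shows "has_integral_0_inf P S nrm (laplace_integrand P S f k (L0_class P y)) (LI k (L0_class P y))"
  unfolding integral_0_inf_def by (rule theI'[OF laplace_integral_ex1[OF assms]])

lemma LI_closed:
  assumes "y \<in> borel_measurable P" "AE \<omega> in P. x \<omega> < y \<omega>"
  shows "LI k (L0_class P y) \<in> carrier S"
  using has_integral_LI[OF assms] by (rule has_integral_0_inf_closed)

text \<open>This is the integrand of difference quotient minus derivative. The scalar 1 in front
  makes it literally one linear combination nested in another, the shape handled by
  \<open>has_integral_0_inf_lincomb\<close>. The factor \<open>\<bar>r\<bar>\<close> sits in the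
  constant and not in the rate, so that it survives integration as a factor.\<close>

lemma difference_quotient_bounded:
  assumes y[measurable]: "y \<in> borel_measurable P" and xy: "AE \<omega> in P. x \<omega> < y \<omega>"
    and r[measurable]: "r \<in> borel_measurable P" and r0: "AE \<omega> in P. r \<omega> \<noteq> 0"
    and r_small: "AE \<omega> in P. \<bar>r \<omega>\<bar> \<le> (y \<omega> - x \<omega>) / 2"
  shows "exp_bounded (\<lambda>s. L0_class P (\<lambda>_. 1) \<odot>\<^bsub>S\<^esub>
      (L0_class P (\<lambda>\<omega>. inverse (of_real (r \<omega>))) \<odot>\<^bsub>S\<^esub> laplace_integrand P S f k (L0_class P (\<lambda>\<omega>. y \<omega> + r \<omega>)) s \<oplus>\<^bsub>S\<^esub>
       L0_class P (\<lambda>\<omega>. - inverse (of_real (r \<omega>))) \<odot>\<^bsub>S\<^esub> laplace_integrand P S f k (L0_class P y) s) \<oplus>\<^bsub>S\<^esub>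
      L0_class P (\<lambda>_. - 1) \<odot>\<^bsub>S\<^esub> laplace_integrand P S f (Suc k) (L0_class P y) s)
    (\<lambda>\<omega>. \<bar>r \<omega>\<bar> * (b \<omega> * (fact (k + 2) / ((y \<omega> - x \<omega>) / 4) ^ (k + 2)))) (\<lambda>\<omega>. (y \<omega> - x \<omega>) / 4)"
    (is "exp_bounded ?g _ _")
  unfolding exp_bounded_def
proof (intro conjI allI impI)
  show "AE \<omega> in P. 0 \<le> \<bar>r \<omega>\<bar> * (b \<omega> * (fact (k + 2) / ((y \<omega> - x \<omega>) / 4) ^ (k + 2)))"
    using b_nonneg xy by eventually_elim auto
  show "AE \<omega> in P. 0 < (y \<omega> - x \<omega>) / 4"
    using xy by eventually_elim auto
  fix s :: real assume s: "0 \<le> s"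
  then have fs: "f s \<in> carrier S" using f_closed by auto
  \<comment> \<open>The whole integrand is a single scalar times \<open>f s\<close>; the products
    with \<open>1\<close> and \<open>- 1\<close> are kept so as to match the outcome of
    \<open>smult_smult_class\<close>.\<close>
  define a :: "'w \<Rightarrow> 'k" where "a \<omega> = 1 * (inverse (of_real (r \<omega>)) * kern k (\<lambda>\<omega>. y \<omega> + r \<omega>) s \<omega>
      + - inverse (of_real (r \<omega>)) * kern k y s \<omega>) + - 1 * kern (Suc k) y s \<omega>" for \<omega>
  have a: "a \<in> borel_measurable P" unfolding a_def by measurable
  have "?g s = L0_class P a \<odot>\<^bsub>S\<^esub> f s"
    unfolding a_def using fs
    by (simp only: laplace_integrand_class smult_smult_class smult_add_class y r
        kern_measurable borel_measurable_add borel_measurable_times borel_measurable_uminus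
        borel_measurable_inverse borel_measurable_const measurable_compose[OF r borel_measurable_of_real_field])
  then have "AE \<omega> in P. N (?g s) \<omega> = norm (a \<omega>) * N (f s) \<omega>"
    using a fs N_smult by simp
  with f_bound[OF s] b_nonneg xy r0 r_small N_nonneg[OF fs]
  show "AE \<omega> in P. N (?g s) \<omega> \<le> \<bar>r \<omega>\<bar> * (b \<omega> * (fact (k + 2) / ((y \<omega> - x \<omega>) / 4) ^ (k + 2))) *
      exp (- ((y \<omega> - x \<omega>) / 4 * s))"
  proof eventually_elim
    case (elim \<omega>)
    define c where "c = (y \<omega> - x \<omega>) / 4"
    have c: "0 < c" using elim by (simp add: c_def)
    have a_eq: "a \<omega> = of_real ((exp (- (y \<omega> + r \<omega>) * s) * (- s) ^ k - exp (- y \<omega> * s) * (- s) ^ k) / r \<omega>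
        - exp (- y \<omega> * s) * (- s) ^ Suc k)"
      unfolding a_def kern_def
      by (simp only: of_real_diff of_real_divide divide_inverse) (simp add: algebra_simps)
    have "norm (a \<omega>) \<le> \<bar>r \<omega>\<bar> * (s ^ (k + 2) * exp (- ((y \<omega> - \<bar>r \<omega>\<bar>) * s)))"
      unfolding a_eq norm_of_real by (rule exp_difference_quotient_le[OF s elim(4)])
    also have "\<dots> \<le> \<bar>r \<omega>\<bar> * (s ^ (k + 2) * exp (- ((2 * c + x \<omega>) * s)))"
    proof -
      \<comment> \<open>The gap between \<open>x\<close> and \<open>y\<close> is
        \<open>4 * c\<close>, and \<open>\<bar>r\<bar>\<close> uses up at most \<open>2 * c\<close>
        of it.\<close>
      have "(2 * c + x \<omega>) * s \<le> (y \<omega> - \<bar>r \<omega>\<bar>) * s"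
      proof (rule mult_right_mono[OF _ s])
        have "\<bar>r \<omega>\<bar> \<le> 2 * c" "y \<omega> = x \<omega> + 4 * c"
          using elim(5) by (simp_all add: c_def field_simps)
        then show "2 * c + x \<omega> \<le> y \<omega> - \<bar>r \<omega>\<bar>" by simp
      qed
      then show ?thesis using s by (intro mult_left_mono) auto
    qed
    finally have "norm (a \<omega>) * N (f s) \<omega>
        \<le> (\<bar>r \<omega>\<bar> * (s ^ (k + 2) * exp (- ((2 * c + x \<omega>) * s)))) * (b \<omega> * exp (x \<omega> * s))"
      using elim(1,6) s by (intro mult_mono') auto
    also have "\<dots> = \<bar>r \<omega>\<bar> * (b \<omega> * (s ^ (k + 2) * exp (- (2 * c * s))))"
      by (simp add: algebra_simps flip: exp_add)
    also have "\<dots> \<le> \<bar>r \<omega>\<bar> * (b \<omega> * (fact (k + 2) / c ^ (k + 2) * exp (- (c * s))))"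
      using elim by (intro mult_left_mono power_mult_exp_le s c) auto
    finally show ?case using elim by (simp add: c_def mult.assoc)
  qed
qed auto

text \<open>No limit is interchanged with the integral: for each small \<open>r\<close> the error is
  itself an improper integral, and its norm is bounded by \<open>\<bar>r\<bar> * K\<close> with
  \<open>K\<close> free of \<open>r\<close>.\<close>

lemma has_Tc_derivative_LI:
  assumes y[measurable]: "y \<in> borel_measurable P" and xy: "AE \<omega> in P. x \<omega> < y \<omega>"
  shows "has_Tc_derivative P S nrm (L0_above P (L0_class P x)) (LI k) (L0_class P y) (LI (Suc k) (L0_class P y))"
  unfolding has_Tc_derivative_def
proof (intro conjI)
  let ?G = "L0_above P (L0_class P x)" and ?T = "Tc_topology P (L0 P) (L0_map P (abs :: real \<Rightarrow> real))"
  show "openin ?T ?G" by (rule openin_Tc_L0_above) measurable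
  show "LI k \<in> ?G \<rightarrow> carrier S"
  proof
    fix \<eta> assume "\<eta> \<in> ?G"
    with x_measurable obtain z where "z \<in> borel_measurable P" "\<eta> = L0_class P z" "AE \<omega> in P. x \<omega> < z \<omega>"
      by (rule L0_aboveE)
    then show "LI k \<eta> \<in> carrier S" using LI_closed by simp
  qed
  show "L0_class P y \<in> ?G" using xy by (simp add: L0_above_class)
  show "LI (Suc k) (L0_class P y) \<in> carrier S" by (rule LI_closed[OF y xy])
  define C where "C \<omega> = b \<omega> * (fact (k + 2) / ((y \<omega> - x \<omega>) / 4) ^ (k + 2))" for \<omega>
  \<comment> \<open>The bound of \<open>N_integral_0_inf_le\<close> at the rate
    \<open>(y - x) / 4\<close>, with the factor \<open>\<bar>r\<bar>\<close> taken out.\<close>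
  define K where "K \<omega> = C \<omega> * exp ((y \<omega> - x \<omega>) / 4) / ((y \<omega> - x \<omega>) / 4)" for \<omega>
  have [measurable]: "C \<in> borel_measurable P" unfolding C_def by measurable
  have [measurable]: "K \<in> borel_measurable P" unfolding K_def by measurable
  have K0: "AE \<omega> in P. 0 \<le> K \<omega>" using b_nonneg xy
    by eventually_elim (simp add: K_def C_def)
  let ?D = "\<lambda>r. inv\<^bsub>L0 P\<^esub> (L0_map P of_real r) \<odot>\<^bsub>S\<^esub> (LI k (L0_class P y \<oplus>\<^bsub>L0 P\<^esub> r) \<ominus>\<^bsub>S\<^esub> LI k (L0_class P y))
      \<ominus>\<^bsub>S\<^esub> LI (Suc k) (L0_class P y)"
  have main: "?D (L0_class P r) \<in> carrier S \<and> (AE \<omega> in P. N (?D (L0_class P r)) \<omega> \<le> \<bar>r \<omega>\<bar> * K \<omega>)"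
    if r[measurable]: "r \<in> borel_measurable P" and r0: "AE \<omega> in P. r \<omega> \<noteq> 0"
      and r_small: "AE \<omega> in P. \<bar>r \<omega>\<bar> < (y \<omega> - x \<omega>) / 2" for r
  proof -
    define u :: "'w \<Rightarrow> 'k" where "u \<omega> = inverse (of_real (r \<omega>))" for \<omega>
    have u[measurable]: "u \<in> borel_measurable P" unfolding u_def by measurable
    have "L0_map P of_real (L0_class P r) = L0_class P (\<lambda>\<omega>. of_real (r \<omega>) :: 'k)"
      by (rule L0_map_class) measurable
    then have inv: "inv\<^bsub>L0 P\<^esub> (L0_map P of_real (L0_class P r)) = L0_class P u"
      using r0 u by (simp add: L0_inv_class u_def[abs_def])
    have yr: "(\<lambda>\<omega>. y \<omega> + r \<omega>) \<in> borel_measurable P" by measurable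
    \<comment> \<open>Smallness of \<open>r\<close> also keeps \<open>y + r\<close> in the domain,
      where the integrals exist.\<close>
    have xyr: "AE \<omega> in P. x \<omega> < y \<omega> + r \<omega>" using r_small xy by eventually_elim (simp add: abs_less_iff field_simps)
    define H1 H2 H3 where "H1 = LI k (L0_class P (\<lambda>\<omega>. y \<omega> + r \<omega>))"
      and "H2 = LI k (L0_class P y)" and "H3 = LI (Suc k) (L0_class P y)"
    have H: "H1 \<in> carrier S" "H2 \<in> carrier S" "H3 \<in> carrier S"
      unfolding H1_def H2_def H3_def by (intro LI_closed y xy yr xyr)+
    \<comment> \<open>The error term, written in the same nested form as the integrand of
      \<open>difference_quotient_bounded\<close>.\<close>
    define E where "E = L0_class P (\<lambda>_. 1) \<odot>\<^bsub>S\<^esub>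
      (L0_class P u \<odot>\<^bsub>S\<^esub> H1 \<oplus>\<^bsub>S\<^esub> L0_class P (\<lambda>\<omega>. - u \<omega>) \<odot>\<^bsub>S\<^esub> H2) \<oplus>\<^bsub>S\<^esub> L0_class P (\<lambda>_. - 1) \<odot>\<^bsub>S\<^esub> H3"
    have D_eq: "?D (L0_class P r) = E"
    proof -
      have "E = L0_class P (\<lambda>_. 1) \<odot>\<^bsub>S\<^esub> (L0_class P u \<odot>\<^bsub>S\<^esub> (H1 \<ominus>\<^bsub>S\<^esub> H2) \<ominus>\<^bsub>S\<^esub> H3)"
        unfolding E_def smult_uminus_class[OF u H(1,2)]
        using H by (intro smult_uminus_class) auto
      also have "\<dots> = L0_class P u \<odot>\<^bsub>S\<^esub> (H1 \<ominus>\<^bsub>S\<^esub> H2) \<ominus>\<^bsub>S\<^esub> H3"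
        unfolding L0_one_class[symmetric] using H by (intro smult_one) auto
      finally show ?thesis by (simp add: inv L0_add_class H1_def H2_def H3_def)
    qed
    let ?g = "\<lambda>s. L0_class P (\<lambda>_. 1) \<odot>\<^bsub>S\<^esub>
      (L0_class P u \<odot>\<^bsub>S\<^esub> laplace_integrand P S f k (L0_class P (\<lambda>\<omega>. y \<omega> + r \<omega>)) s \<oplus>\<^bsub>S\<^esub>
       L0_class P (\<lambda>\<omega>. - u \<omega>) \<odot>\<^bsub>S\<^esub> laplace_integrand P S f k (L0_class P y) s) \<oplus>\<^bsub>S\<^esub>
      L0_class P (\<lambda>_. - 1) \<odot>\<^bsub>S\<^esub> laplace_integrand P S f (Suc k) (L0_class P y) s"
    note closed = laplace_integrand_closed[OF yr] laplace_integrand_closed[OF y]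
    have inner: "(\<lambda>s. L0_class P u \<odot>\<^bsub>S\<^esub> laplace_integrand P S f k (L0_class P (\<lambda>\<omega>. y \<omega> + r \<omega>)) s \<oplus>\<^bsub>S\<^esub>
       L0_class P (\<lambda>\<omega>. - u \<omega>) \<odot>\<^bsub>S\<^esub> laplace_integrand P S f k (L0_class P y) s) \<in> {0..} \<rightarrow> carrier S"
    proof
      fix s :: real assume "s \<in> {0..}"
      then show "L0_class P u \<odot>\<^bsub>S\<^esub> laplace_integrand P S f k (L0_class P (\<lambda>\<omega>. y \<omega> + r \<omega>)) s \<oplus>\<^bsub>S\<^esub>
       L0_class P (\<lambda>\<omega>. - u \<omega>) \<odot>\<^bsub>S\<^esub> laplace_integrand P S f k (L0_class P y) s \<in> carrier S"
        by (intro M.a_closed smult_class_closed funcset_mem[OF closed(1)] funcset_mem[OF closed(2)]) auto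
    qed
    have int: "has_integral_0_inf P S nrm ?g E"
      unfolding E_def H1_def H2_def H3_def
      by (intro has_integral_0_inf_lincomb has_integral_LI inner closed y xy yr xyr) auto
    have g: "?g \<in> {0..} \<rightarrow> carrier S"
    proof
      fix s :: real assume "s \<in> {0..}"
      then show "?g s \<in> carrier S"
        by (intro M.a_closed[of "L0_class P (\<lambda>_. 1) \<odot>\<^bsub>S\<^esub> _"] smult_class_closed funcset_mem[OF inner] funcset_mem[OF closed(2)]) auto
    qed
    have "exp_bounded ?g (\<lambda>\<omega>. \<bar>r \<omega>\<bar> * C \<omega>) (\<lambda>\<omega>. (y \<omega> - x \<omega>) / 4)"
      unfolding C_def u_def using r_small
      by (intro difference_quotient_bounded y xy r r0) (auto elim: eventually_mono)
    from N_integral_0_inf_le[OF g this int]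
    have "AE \<omega> in P. N E \<omega> \<le> \<bar>r \<omega>\<bar> * K \<omega>" by (simp add: K_def mult.assoc)
    moreover have "E \<in> carrier S" using int by (rule has_integral_0_inf_closed)
    ultimately show ?thesis unfolding D_eq by blast
  qed
  show "limitin (Tc_topology P S nrm) ?D \<zero>\<^bsub>S\<^esub>
     (atin_within ?T \<zero>\<^bsub>L0 P\<^esub> {r \<in> carrier (L0 P). L0_map P abs r \<in> L0_pplus P \<and> L0_class P y \<oplus>\<^bsub>L0 P\<^esub> r \<in> ?G})"
  proof (rule limitin_Tc_zero)
    fix e :: "'w \<Rightarrow> real" assume e[measurable]: "e \<in> borel_measurable P" and e0: "AE \<omega> in P. 0 < e \<omega>"
    \<comment> \<open>The first entry keeps \<open>r\<close> in the range of \<open>main\<close>;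
      the second makes \<open>\<bar>r\<bar> * (K + 1)\<close> smaller than \<open>e\<close>, the
      summand 1 guarding against zeros of \<open>K\<close>. The minimum is again a positive random
      variable, hence an admissible radius.\<close>
    define d where "d \<omega> = min ((y \<omega> - x \<omega>) / 2) (e \<omega> / (K \<omega> + 1))" for \<omega>
    have d[measurable]: "d \<in> borel_measurable P" unfolding d_def by measurable
    have d0: "AE \<omega> in P. 0 < d \<omega>" using xy e0 K0 by eventually_elim (simp add: d_def)
    let ?U = "{r \<in> carrier (L0 P). L0_less P (L0_map P abs r) (L0_class P d)}"
    show "\<forall>\<^sub>F r in atin_within ?T \<zero>\<^bsub>L0 P\<^esub>
        {r \<in> carrier (L0 P). L0_map P abs r \<in> L0_pplus P \<and> L0_class P y \<oplus>\<^bsub>L0 P\<^esub> r \<in> ?G}.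
        ?D r \<in> carrier S \<and> (AE \<omega> in P. N (?D r) \<omega> < e \<omega>)"
      unfolding eventually_atin_within
    proof (intro disjI2 exI[of _ ?U] conjI ballI impI)
      show "openin ?T ?U" by (rule openin_Tc_abs_less[OF d])
      show "\<zero>\<^bsub>L0 P\<^esub> \<in> ?U"
        using d0 by (simp add: L0_zero_class L0_class_in L0_abs_class L0_less_class)
      fix \<rho> assume \<rho>U: "\<rho> \<in> ?U"
        and \<rho>': "\<rho> \<in> {r \<in> carrier (L0 P). L0_map P abs r \<in> L0_pplus P \<and> L0_class P y \<oplus>\<^bsub>L0 P\<^esub> r \<in> ?G} \<and> \<rho> \<noteq> \<zero>\<^bsub>L0 P\<^esub>"
      have "\<rho> \<in> carrier (L0 P)" using \<rho>U by simp
      then obtain r where r[measurable]: "r \<in> borel_measurable P" and \<rho>: "\<rho> = L0_class P r"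
        by (rule L0_class_rep)
      have rd: "AE \<omega> in P. \<bar>r \<omega>\<bar> < d \<omega>"
        using \<rho>U by (simp add: \<rho> L0_abs_class L0_less_class)
      have "AE \<omega> in P. 0 < \<bar>r \<omega>\<bar>" using \<rho>' by (simp add: \<rho> L0_abs_class L0_pplus_class)
      then have "AE \<omega> in P. r \<omega> \<noteq> 0" by eventually_elim simp
      moreover have "AE \<omega> in P. \<bar>r \<omega>\<bar> < (y \<omega> - x \<omega>) / 2" using rd by eventually_elim (simp add: d_def)
      ultimately have D: "?D \<rho> \<in> carrier S" "AE \<omega> in P. N (?D \<rho>) \<omega> \<le> \<bar>r \<omega>\<bar> * K \<omega>"
        using main[OF r] unfolding \<rho> by blast+
      show "?D \<rho> \<in> carrier S" by (rule D(1))
      show "AE \<omega> in P. N (?D \<rho>) \<omega> < e \<omega>"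
        using D(2) rd K0
      proof eventually_elim
        case (elim \<omega>)
        have "\<bar>r \<omega>\<bar> * K \<omega> \<le> \<bar>r \<omega>\<bar> * (K \<omega> + 1)" by (intro mult_left_mono) auto
        also have "\<dots> < e \<omega> / (K \<omega> + 1) * (K \<omega> + 1)"
          using elim by (intro mult_strict_right_mono) (auto simp: d_def)
        also have "\<dots> = e \<omega>" using elim by simp
        finally show ?case using elim by simp
      qed
    qed
  qed
qed

text \<open>\<open>LI (Suc k)\<close> is the derivative of \<open>LI k\<close> on the whole domain,
  which is what the recursion asks of the witness \<open>LI k\<close>; at order 0 the transform is
  \<open>LI 0\<close> by definition.\<close>

lemma has_nth_Tc_derivative_LI:
  assumes "\<eta> \<in> L0_above P (L0_class P x)"
  shows "has_nth_Tc_derivative k P S nrm (L0_above P (L0_class P x)) (laplace P S nrm f) \<eta> (LI k \<eta>)"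
  using assms
proof (induction k arbitrary: \<eta>)
  case 0
  then show ?case by (simp add: laplace_def)
next
  case (Suc k)
  obtain y where y: "y \<in> borel_measurable P" "\<eta> = L0_class P y" "AE \<omega> in P. x \<omega> < y \<omega>"
    using x_measurable Suc.prems by (rule L0_aboveE)
  have "has_Tc_derivative P S nrm (L0_above P (L0_class P x)) (LI k) \<eta> (LI (Suc k) \<eta>)"
    unfolding y(2) by (rule has_Tc_derivative_LI[OF y(1,3)])
  then show ?case
    unfolding has_nth_Tc_derivative.simps by (intro exI[of _ "LI k"] conjI ballI Suc.IH)
qed

end

text \<open>Existence and uniqueness of the integrals belong to the conclusion because
  \<open>integral_0_inf\<close> is a definite description, which has the intended meaning only when
  there is exactly one value.\<close>

theorem lemma3p2:
  fixes P :: "'w measure"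
    and S :: "(('w \<Rightarrow> 'k::{real_normed_field,euclidean_space}) set, 's, 'm) module_scheme"
    and nrm :: "'s \<Rightarrow> ('w \<Rightarrow> real) set"
    and f :: "real \<Rightarrow> 's"
    and B \<xi> :: "('w \<Rightarrow> real) set"
  assumes "random_normed_module P S nrm"
    and "el_complete P S nrm"
    and "continuous_map (top_of_set {0..}) (el_topology P S nrm) f"
    and "B \<in> L0_plus P"
    and "\<xi> \<in> carrier (L0 P)"
    and "\<And>s. s \<ge> 0 \<Longrightarrow> L0_le P (nrm (f s)) (B \<otimes>\<^bsub>L0 P\<^esub> L0_map P (\<lambda>y. exp (y * s)) \<xi>)"
  shows "(\<forall>\<eta>\<in>L0_above P \<xi>. \<exists>!I. has_integral_0_inf P S nrm (laplace_integrand P S f 0 \<eta>) I) \<and>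
         (\<forall>k>0. \<forall>\<eta>\<in>L0_above P \<xi>.
            (\<exists>!I. has_integral_0_inf P S nrm (laplace_integrand P S f k \<eta>) I) \<and>
            has_nth_Tc_derivative k P S nrm (L0_above P \<xi>) (laplace P S nrm f) \<eta>
              (integral_0_inf P S nrm (laplace_integrand P S f k \<eta>)))"
proof -
  interpret random_normed_module P S nrm by fact
  obtain b where b: "b \<in> borel_measurable P" "B = L0_class P b" "AE \<omega> in P. 0 \<le> b \<omega>"
    using assms(4) by (auto simp: L0_plus_def L0_zero_class L0_le_class elim!: L0_class_rep)
  obtain x where x: "x \<in> borel_measurable P" "\<xi> = L0_class P x"
    using assms(5) by (rule L0_class_rep)
  have "AE \<omega> in P. N (f s) \<omega> \<le> b \<omega> * exp (x \<omega> * s)" if "s \<ge> 0" for s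
  proof -
    have "f s \<in> carrier S"
      using continuous_map_image_subset_topspace[OF assms(3)] that by (auto simp: topspace_el)
    moreover have "L0_map P (\<lambda>y. exp (y * s)) \<xi> = L0_class P (\<lambda>\<omega>. exp (x \<omega> * s))"
      unfolding x(2) using x(1) by (intro L0_map_class) auto
    moreover have "(\<lambda>\<omega>. exp (x \<omega> * s)) \<in> borel_measurable P" using x(1) by measurable
    ultimately show ?thesis
      using assms(6)[OF that] b by (simp add: nrm_eq_class L0_mult_class L0_le_class)
  qed
  then interpret laplace_transform P S nrm f b x
    using assms(2,3) b x by unfold_locales auto
  have "\<exists>!I. has_integral_0_inf P S nrm (laplace_integrand P S f k \<eta>) I" if \<eta>: "\<eta> \<in> L0_above P \<xi>" for k \<eta>
  proof -
    obtain y where "y \<in> borel_measurable P" "\<eta> = L0_class P y" "AE \<omega> in P. x \<omega> < y \<omega>"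
      by (rule L0_aboveE[OF x(1) \<eta>[unfolded x(2)]])
    then show ?thesis using laplace_integral_ex1 by simp
  qed
  moreover have "has_nth_Tc_derivative k P S nrm (L0_above P \<xi>) (laplace P S nrm f) \<eta> (LI k \<eta>)"
    if "\<eta> \<in> L0_above P \<xi>" for k \<eta>
    using that has_nth_Tc_derivative_LI unfolding x(2) by blast
  ultimately show ?thesis by blast
qed

end
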